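(* Let $G$ be a finitely generated solvable group admitting a purely positive length function. Suppose that $G$ is virtually torsion-free and that every abelian subgroup $A<G$ satisfies $\dim_{\mathbb{Q}}(A\otimes_{\mathbb{Z}}\mathbb{Q})<+\infty$. Then $G$ is virtually either abelian, or isomorphic to a non-nilpotent subgroup of $\mathrm{GL}_N(\mathbb{C})$ (for some $N$) which is also a subgroup of a semidirect product $H\rtimes\mathbb{Z}^{n}$ for some integer $n\geq 0$ and some finitely generated $\mathbb{Z}[\mathbb{Z}^{n}]$-module $H$.
   Context: A length function on a group $G$ is a function $l:G\to[0,\infty)$ such that (1) $l(g^{n})=|n|\,l(g)$ for all $g\in G$, $n\in\mathbb{Z}$; (2) $l(hgh^{-1})=l(g)$ for all $g,h\in G$; (3) $l(ab)\leq l(a)+l(b)$ whenever $a,b\in G$ commute. A length function $l$ is purely positive if $l(g)>0$ for every element $g$ of infinite order. "Virtually $P$" means some finite-index subgroup has property $P$. *)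

theory Defs
  imports "HOL-Algebra.Algebra" "Jordan_Normal_Form.Matrix"
begin

definition length_function :: "('a, 'b) monoid_scheme \<Rightarrow> ('a \<Rightarrow> real) \<Rightarrow> bool" where
  "length_function G l \<longleftrightarrow>
     (\<forall>g \<in> carrier G. l g \<ge> 0) \<and>
     (\<forall>g \<in> carrier G. \<forall>n::int. l (g [^]\<^bsub>G\<^esub> n) = \<bar>real_of_int n\<bar> * l g) \<and>
     (\<forall>g \<in> carrier G. \<forall>h \<in> carrier G. l (h \<otimes>\<^bsub>G\<^esub> g \<otimes>\<^bsub>G\<^esub> inv\<^bsub>G\<^esub> h) = l g) \<and>
     (\<forall>a \<in> carrier G. \<forall>b \<in> carrier G. a \<otimes>\<^bsub>G\<^esub> b = b \<otimes>\<^bsub>G\<^esub> a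
        \<longrightarrow> l (a \<otimes>\<^bsub>G\<^esub> b) \<le> l a + l b)"

definition infinite_order :: "('a, 'b) monoid_scheme \<Rightarrow> 'a \<Rightarrow> bool" where
  "infinite_order G g \<longleftrightarrow> (\<forall>n::nat. n > 0 \<longrightarrow> g [^]\<^bsub>G\<^esub> n \<noteq> \<one>\<^bsub>G\<^esub>)"

definition purely_positive :: "('a, 'b) monoid_scheme \<Rightarrow> ('a \<Rightarrow> real) \<Rightarrow> bool" where
  "purely_positive G l \<longleftrightarrow>
     length_function G l \<and> (\<forall>g \<in> carrier G. infinite_order G g \<longrightarrow> l g > 0)"

definition finitely_generated_group :: "('a, 'b) monoid_scheme \<Rightarrow> bool" where
  "finitely_generated_group G \<longleftrightarrow>
     (\<exists>S. finite S \<and> S \<subseteq> carrier G \<and> generate G S = carrier G)"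

definition finite_index :: "('a, 'b) monoid_scheme \<Rightarrow> 'a set \<Rightarrow> bool" where
  "finite_index G K \<longleftrightarrow> subgroup K G \<and> finite (rcosets\<^bsub>G\<^esub> K)"

definition torsion_free_set :: "('a, 'b) monoid_scheme \<Rightarrow> 'a set \<Rightarrow> bool" where
  "torsion_free_set G K \<longleftrightarrow> (\<forall>g \<in> K. g \<noteq> \<one>\<^bsub>G\<^esub> \<longrightarrow> infinite_order G g)"

definition virtually_torsion_free :: "('a, 'b) monoid_scheme \<Rightarrow> bool" where
  "virtually_torsion_free G \<longleftrightarrow> (\<exists>K. finite_index G K \<and> torsion_free_set G K)"

definition abelian_set :: "('a, 'b) monoid_scheme \<Rightarrow> 'a set \<Rightarrow> bool" where
  "abelian_set G A \<longleftrightarrow> (\<forall>x \<in> A. \<forall>y \<in> A. x \<otimes>\<^bsub>G\<^esub> y = y \<otimes>\<^bsub>G\<^esub> x)"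

fun lower_central :: "('a, 'b) monoid_scheme \<Rightarrow> nat \<Rightarrow> 'a set" where
  "lower_central G 0 = carrier G"
| "lower_central G (Suc i) = generate G
     (\<Union>h \<in> lower_central G i. \<Union>g \<in> carrier G.
        {h \<otimes>\<^bsub>G\<^esub> g \<otimes>\<^bsub>G\<^esub> inv\<^bsub>G\<^esub> h \<otimes>\<^bsub>G\<^esub> inv\<^bsub>G\<^esub> g})"

definition nilpotent_group :: "('a, 'b) monoid_scheme \<Rightarrow> bool" where
  "nilpotent_group G \<longleftrightarrow> (\<exists>i. lower_central G i = {\<one>\<^bsub>G\<^esub>})"

text \<open>A list of elements is Z-linearly independent if the only integer
  relation among them is the trivial one.  dim_Q (A \<otimes> Q) is the supremum
  of the lengths of such lists in A.\<close>
definition Z_independent :: "('a, 'b) monoid_scheme \<Rightarrow> 'a list \<Rightarrow> bool" where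
  "Z_independent G xs \<longleftrightarrow>
     (\<forall>es::int list. length es = length xs \<longrightarrow>
        foldr (\<lambda>(x, e) acc. (x [^]\<^bsub>G\<^esub> e) \<otimes>\<^bsub>G\<^esub> acc) (zip xs es) \<one>\<^bsub>G\<^esub> = \<one>\<^bsub>G\<^esub>
        \<longrightarrow> (\<forall>e \<in> set es. e = 0))"

definition finite_Q_rank :: "('a, 'b) monoid_scheme \<Rightarrow> 'a set \<Rightarrow> bool" where
  "finite_Q_rank G A \<longleftrightarrow>
     (\<exists>B::nat. \<forall>xs. set xs \<subseteq> A \<and> Z_independent G xs \<longrightarrow> length xs \<le> B)"

definition GL :: "nat \<Rightarrow> complex mat monoid" where
  "GL N = \<lparr>carrier = {M \<in> carrier_mat N N. invertible_mat M},
           Group.monoid.mult = (\<lambda>A B. A * B), one = 1\<^sub>m N\<rparr>"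

definition Zn :: "nat \<Rightarrow> (nat \<Rightarrow> int) monoid" where
  "Zn n = \<lparr>carrier = {v. \<forall>i \<ge> n. v i = 0},
           Group.monoid.mult = (\<lambda>v w i. v i + w i), one = (\<lambda>_. 0)\<rparr>"

text \<open>A Z[Z^n]-module is an abelian group H with an action of Z^n by
  automorphisms, i.e. a homomorphism rho from Z^n to Aut(H).  It is finitely
  generated iff some finite S generates H as an abelian group together with
  all its Z^n-translates.\<close>
definition fg_ZZn_module :: "nat \<Rightarrow> ('h, 'c) monoid_scheme \<Rightarrow> ((nat \<Rightarrow> int) \<Rightarrow> 'h \<Rightarrow> 'h) \<Rightarrow> bool" where
  "fg_ZZn_module n H rho \<longleftrightarrow>
     comm_group H \<and> rho \<in> hom (Zn n) (AutoGroup H) \<and>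
     (\<exists>S. finite S \<and> S \<subseteq> carrier H \<and>
          generate H (\<Union>v \<in> carrier (Zn n). rho v ` S) = carrier H)"

definition semidirect :: "nat \<Rightarrow> ('h, 'c) monoid_scheme \<Rightarrow> ((nat \<Rightarrow> int) \<Rightarrow> 'h \<Rightarrow> 'h)
                           \<Rightarrow> ('h \<times> (nat \<Rightarrow> int)) monoid" where
  "semidirect n H rho = \<lparr>carrier = carrier H \<times> carrier (Zn n),
     Group.monoid.mult = (\<lambda>(h, v) (h', v'). (h \<otimes>\<^bsub>H\<^esub> rho v h', (\<lambda>i. v i + v' i))),
     one = (\<one>\<^bsub>H\<^esub>, (\<lambda>_. 0))\<rparr>"

definition embeds_into :: "('a, 'b) monoid_scheme \<Rightarrow> ('c, 'd) monoid_scheme \<Rightarrow> bool" where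
  "embeds_into K M \<longleftrightarrow> (\<exists>f. f \<in> hom K M \<and> inj_on f (carrier K))"

end

(* After passing to a torsion-free subgroup of finite index, a commutator [x, y] that commutes with
   x and y has length 0, hence is trivial.  So the Fitting subgroup F is abelian; by solvability it
   is its own centralizer.  It has finite rank, and l restricts to a conjugation-invariant norm on
   it.  The isometries induced by G form a totally bounded set, so the elements that are close to
   the identity generate a subgroup of finite index; a Jordan-type contraction argument along the
   derived series shows that this subgroup is abelian modulo F.  This replaces Mal'cev's theorem on
   solvable linear groups.

   Now let K be a subgroup of finite index with F <= K and K/F free abelian.  A mean ergodic argument
   shows that the center of K meets [K, K] trivially, so some homomorphism K -> Z^t is injective on
   it.  With generators s_j of K, the derivations g |-> [s_j, g] from K to F together with K -> K/F
   and K -> Z^t embed K into the semidirect product of a finitely generated submodule of a power of F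
   by Z^(n+t).  As F sits in a finite-dimensional rational vector space, each derivation is also an
   affine representation, which makes K linear. *)

theory Submission
  imports Defs "HOL-Library.Function_Algebras"
begin

section \<open>Normed abelian groups of finite rank\<close>

text \<open>The norm on F need not extend to a norm on the real span of F: on Z[sqrt 2] with the
  usual absolute value the extension vanishes on a line. F need not be finitely generated either, so
  there is no lattice and no compact isometry group to start from. Total boundedness comes from
  systems whose independence is quantified by the norm; their maximal size is the dimension of the
  completion, possibly below the rank.

  The contraction argument rests on two facts: the commutator of two isometries within e <= 1/2 of
  the identity is again within e, and the powers of a nontrivial isometry cannot all stay within
  1/2. Solvability replaces the discreteness or finiteness used in Jordan's theorem.

  Commutators with generators vanish on the center, and homomorphisms to Z^t vanish on [K, K]. A
  central element of [K, K], as in the Heisenberg group, would escape both. Averaging excludes it: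
  commutators have arbitrarily small averages, whereas an average of a fixed vector is that
  vector.\<close>

text \<open>Rank at most \<open>r\<close> is expressed by a relation among any \<open>r + 1\<close>
  elements, so no basis has to be chosen. The ring serves to write integer multiples as
  \<open>of_int k * u\<close>; in the application it is the pointwise ring of functions
  \<open>nat => rat\<close>, whose integers are the constant functions.\<close>

locale normed_lattice =
  fixes W :: "'v::comm_ring_1 set" and L :: "'v \<Rightarrow> real" and r :: nat
  assumes zero_mem: "0 \<in> W"
    and add_mem: "\<And>u v. u \<in> W \<Longrightarrow> v \<in> W \<Longrightarrow> u + v \<in> W"
    and uminus_mem: "\<And>u. u \<in> W \<Longrightarrow> - u \<in> W"
    and L_add: "\<And>u v. u \<in> W \<Longrightarrow> v \<in> W \<Longrightarrow> L (u + v) \<le> L u + L v"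
    and L_scale: "\<And>k u. u \<in> W \<Longrightarrow> L (of_int k * u) = \<bar>real_of_int k\<bar> * L u"
    and L_eq_0: "\<And>u. u \<in> W \<Longrightarrow> L u = 0 \<Longrightarrow> u = 0"
    and relation: "\<And>w. (\<And>i::nat. i \<le> r \<Longrightarrow> w i \<in> W) \<Longrightarrow>
      \<exists>a::nat \<Rightarrow> int. (\<exists>i\<le>r. a i \<noteq> 0) \<and> (\<Sum>i\<le>r. of_int (a i) * w i) = 0"
begin

lemma diff_mem: "u \<in> W \<Longrightarrow> v \<in> W \<Longrightarrow> u - v \<in> W"
  using add_mem[of u "- v"] uminus_mem[of v] by simp

lemma scale_nat_mem: "u \<in> W \<Longrightarrow> of_nat n * u \<in> W"
  by (induction n) (auto simp: zero_mem algebra_simps intro: add_mem)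

lemma scale_mem: "u \<in> W \<Longrightarrow> of_int k * u \<in> W"
  using scale_nat_mem[of u "nat \<bar>k\<bar>"] uminus_mem[of "of_nat (nat \<bar>k\<bar>) * u"]
  by (cases "k \<ge> 0") auto

lemma sum_mem: "(\<And>i. i \<in> A \<Longrightarrow> f i \<in> W) \<Longrightarrow> sum f A \<in> W"
  by (induction A rule: infinite_finite_induct) (auto simp: zero_mem add_mem)

lemma L_uminus: "u \<in> W \<Longrightarrow> L (- u) = L u"
  using L_scale[of u "-1"] by simp

lemma L_zero: "L 0 = 0"
  using L_scale[of 0 0] zero_mem by simp

lemma L_nonneg: "u \<in> W \<Longrightarrow> 0 \<le> L u"
  using L_add[of u "- u"] by (simp add: L_zero L_uminus uminus_mem)

lemma L_diff: "u \<in> W \<Longrightarrow> v \<in> W \<Longrightarrow> L (u - v) \<le> L u + L v"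
  using L_add[of u "- v"] by (simp add: L_uminus uminus_mem)

lemma L_sum: "(\<And>i. i \<in> A \<Longrightarrow> f i \<in> W) \<Longrightarrow> L (sum f A) \<le> (\<Sum>i\<in>A. L (f i))"
proof (induction A rule: infinite_finite_induct)
  case (insert x F)
  then have "L (f x + sum f F) \<le> L (f x) + L (sum f F)"
    by (intro L_add sum_mem) auto
  with insert show ?case by auto
qed (auto simp: L_zero)

lemma scale_eq_0: "u \<in> W \<Longrightarrow> of_int k * u = 0 \<Longrightarrow> k = 0 \<or> u = 0"
  using L_scale[of u k] L_eq_0[of u] by (auto simp: L_zero)

section \<open>Independence and approximation\<close>

lemma no_long_independent:
  assumes "\<And>i::nat. i < n \<Longrightarrow> x i \<in> W"
    and "\<And>k::nat \<Rightarrow> int. (\<Sum>i<n. of_int (k i) * x i) = 0 \<Longrightarrow> \<forall>i<n. k i = 0"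
  shows "n \<le> r"
proof (rule ccontr)
  assume "\<not> n \<le> r"
  then have rn: "r < n" by simp
  obtain a :: "nat \<Rightarrow> int" where a: "\<exists>i\<le>r. a i \<noteq> 0" "(\<Sum>i\<le>r. of_int (a i) * x i) = 0"
    using relation[of x] assms(1) rn by auto
  define k where "k i = (if i \<le> r then a i else 0)" for i
  have "(\<Sum>i<n. of_int (k i) * x i) = (\<Sum>i\<le>r. of_int (k i) * x i)"
    using rn by (intro sum.mono_neutral_right) (auto simp: k_def)
  also have "\<dots> = 0" using a(2) by (simp add: k_def)
  finally have "\<forall>i<n. k i = 0" using assms(2) by blast
  with rn have "\<forall>i\<le>r. a i = 0" unfolding k_def by (metis le_less_trans)
  with a(1) show False by blast
qed

text \<open>This is linear independence over the reals in the completion of \<open>W\<close>.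
  Independence over the integers is weaker: 1 and sqrt 2 are independent, but their integer
  combinations come arbitrarily close to 0.\<close>

definition L_independent :: "nat \<Rightarrow> (nat \<Rightarrow> 'v) \<Rightarrow> real \<Rightarrow> bool" where
  "L_independent n x \<kappa> \<longleftrightarrow> \<kappa> > 0 \<and> (\<forall>i<n. x i \<in> W) \<and>
     (\<forall>k::nat \<Rightarrow> int. \<kappa> * (\<Sum>i<n. \<bar>real_of_int (k i)\<bar>) \<le> L (\<Sum>i<n. of_int (k i) * x i))"

lemma L_independent_le: assumes "L_independent n x \<kappa>" shows "n \<le> r"
proof (rule no_long_independent)
  fix k :: "nat \<Rightarrow> int" assume k: "(\<Sum>i<n. of_int (k i) * x i) = 0"
  have \<kappa>: "\<kappa> > 0" and "\<kappa> * (\<Sum>i<n. \<bar>real_of_int (k i)\<bar>) \<le> L (\<Sum>i<n. of_int (k i) * x i)"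
    using assms unfolding L_independent_def by blast+
  then have "\<kappa> * (\<Sum>i<n. \<bar>real_of_int (k i)\<bar>) \<le> 0" by (simp add: k L_zero)
  with \<kappa> have "(\<Sum>i<n. \<bar>real_of_int (k i)\<bar>) \<le> 0" by (simp add: mult_le_0_iff)
  moreover have "(\<Sum>i<n. \<bar>real_of_int (k i)\<bar>) \<ge> 0" by (intro sum_nonneg) auto
  ultimately have "(\<Sum>i<n. \<bar>real_of_int (k i)\<bar>) = 0" by linarith
  then show "\<forall>i<n. k i = 0" by (subst (asm) sum_nonneg_eq_0_iff) auto
qed (use assms in \<open>auto simp: L_independent_def\<close>)

lemma maximal_L_independent:
  obtains n x \<kappa> where "L_independent n x \<kappa>"
    and "\<And>x' \<kappa>'. \<not> L_independent (Suc n) x' \<kappa>'"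
proof -
  define P where "P n \<longleftrightarrow> (\<exists>x \<kappa>. L_independent n x \<kappa>)" for n
  have "P 0" unfolding P_def L_independent_def by (rule exI, rule exI[of _ 1]) (simp add: L_zero)
  moreover have "\<forall>n. P n \<longrightarrow> n \<le> r" using L_independent_le by (auto simp: P_def)
  ultimately have "P (GREATEST n. P n)" "\<not> P (Suc (GREATEST n. P n))"
    using GreatestI_nat[of P 0 r] Greatest_le_nat[of P "Suc (GREATEST n. P n)" r]
    by (blast, metis not_less_eq_eq order_refl)
  then show ?thesis using that unfolding P_def by blast
qed

text \<open>Adjoining \<open>w\<close> to a maximal \<open>L\<close>-independent system destroys the
  lower bound for every positive constant, which yields an integer relation with small error. The
  coefficient of \<open>w\<close> in it becomes \<open>m\<close>, so this is an approximation of
  \<open>w\<close> by rational combinations, cleared of denominators.\<close>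

lemma approximation:
  obtains n :: nat and x \<kappa> where "\<kappa> > 0" and "\<And>i. i < n \<Longrightarrow> x i \<in> W"
    and "\<And>w \<theta>. w \<in> W \<Longrightarrow> \<theta> > 0 \<Longrightarrow> \<exists>m k. m > 0 \<and>
       L (of_int m * w - (\<Sum>i<n. of_int (k i) * x i)) \<le> \<theta> * real_of_int m \<and>
       (\<Sum>i<n. \<bar>real_of_int (k i)\<bar>) \<le> (2 / \<kappa>) * (L w + \<theta>) * real_of_int m"
proof -
  obtain n x \<kappa> where ind: "L_independent n x \<kappa>"
    and max: "\<And>x' \<kappa>'. \<not> L_independent (Suc n) x' \<kappa>'"
    using maximal_L_independent by blast
  have \<kappa>: "\<kappa> > 0" and x: "\<And>i. i < n \<Longrightarrow> x i \<in> W"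
    and low: "\<And>k. \<kappa> * (\<Sum>i<n. \<bar>real_of_int (k i)\<bar>) \<le> L (\<Sum>i<n. of_int (k i) * x i)"
    using ind unfolding L_independent_def by blast+
  show ?thesis
  proof (rule that[OF \<kappa> x])
    fix w \<theta> assume w: "w \<in> W" and \<theta>: "(\<theta>::real) > 0"
    define B where "B = 1 + (2 / \<kappa>) * (L w + \<theta>)"
    have B: "B \<ge> 1" using \<kappa> \<theta> L_nonneg[OF w] by (simp add: B_def)
    \<comment> \<open>The bound \<open>\<kappa> / 2\<close> lets the coefficient sum
      \<open>s\<close> be absorbed on the left, \<open>\<theta>\<close> gives the stated bound on
      \<open>s\<close>, and \<open>\<theta> / B\<close> turns the error
      \<open>\<eta> * (s + a)\<close> into \<open>\<theta> * a\<close>, because \<open>s + a\<close>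
      is at most \<open>B * a\<close>.\<close>
    define \<eta> where "\<eta> = min (\<kappa> / 2) (min \<theta> (\<theta> / B))"
    have \<eta>: "\<eta> > 0" "\<eta> \<le> \<kappa> / 2" "\<eta> \<le> \<theta>" "\<eta> \<le> \<theta> / B"
      using \<kappa> \<theta> B unfolding \<eta>_def by (simp, linarith, linarith, linarith)
    have \<eta>B: "\<eta> * B \<le> \<theta>" using \<eta>(4) B by (simp add: field_simps)
    let ?x' = "\<lambda>i. if i = n then w else x i"
    have "\<forall>i<Suc n. ?x' i \<in> W" using w x by (simp add: less_Suc_eq)
    with max[of ?x' \<eta>] obtain k :: "nat \<Rightarrow> int"
      where "\<not> \<eta> * (\<Sum>i<Suc n. \<bar>real_of_int (k i)\<bar>) \<le> L (\<Sum>i<Suc n. of_int (k i) * ?x' i)"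
      unfolding L_independent_def using \<eta>(1) by blast
    moreover have "(\<Sum>i<n. of_int (k i) * ?x' i) = (\<Sum>i<n. of_int (k i) * x i)"
      by (intro sum.cong) auto
    ultimately have k: "L ((\<Sum>i<n. of_int (k i) * x i) + of_int (k n) * w)
        < \<eta> * ((\<Sum>i<n. \<bar>real_of_int (k i)\<bar>) + \<bar>real_of_int (k n)\<bar>)"
      by simp
    define s where "s = (\<Sum>i<n. \<bar>real_of_int (k i)\<bar>)"
    define a where "a = \<bar>real_of_int (k n)\<bar>"
    define y where "y = (\<Sum>i<n. of_int (k i) * x i)"
    have y: "y \<in> W" unfolding y_def by (intro sum_mem scale_mem x) auto
    have s0: "s \<ge> 0" unfolding s_def by (intro sum_nonneg) auto
    have Lya: "L (y + of_int (k n) * w) < \<eta> * (s + a)" using k by (simp add: s_def a_def y_def)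
    have "L y \<le> L (y + of_int (k n) * w) + L (of_int (k n) * w)"
      using L_diff[of "y + of_int (k n) * w" "of_int (k n) * w"] y w by (simp add: add_mem scale_mem)
    then have "\<kappa> * s \<le> \<eta> * (s + a) + a * L w"
      using low[of k] Lya L_scale[OF w, of "k n"] by (simp add: s_def y_def a_def)
    moreover have "\<eta> * s \<le> (\<kappa> / 2) * s" using \<eta>(2) s0 by (rule mult_right_mono)
    ultimately have "(\<kappa> / 2) * s \<le> a * (\<eta> + L w)" by (simp add: algebra_simps)
    moreover have "a * (\<eta> + L w) \<le> a * (\<theta> + L w)" using \<eta>(3) by (intro mult_left_mono) (auto simp: a_def)
    ultimately have "(\<kappa> / 2) * s \<le> a * (\<theta> + L w)" by linarith
    then have s: "s \<le> (2 / \<kappa>) * (L w + \<theta>) * a" using \<kappa> by (simp add: field_simps)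
    have "a \<noteq> 0"
    proof
      assume "a = 0"
      with s s0 have "s = 0" by simp
      with Lya \<open>a = 0\<close> L_nonneg[of "y + of_int (k n) * w"] y w show False
        by (simp add: add_mem scale_mem)
    qed
    then have a: "a > 0" by (simp add: a_def)
    have "L (y + of_int (k n) * w) \<le> \<eta> * (s + a)" using Lya by simp
    also have "\<dots> \<le> \<eta> * (B * a)" using s \<eta>(1) by (intro mult_left_mono) (auto simp: B_def algebra_simps)
    also have "\<dots> \<le> \<theta> * a" using mult_right_mono[OF \<eta>B, of a] a by (simp add: mult.assoc)
    finally have fin: "L (y + of_int (k n) * w) \<le> \<theta> * a" .
    have "- of_int (k n) * w - y = - (y + of_int (k n) * w)" by simp
    then have Lneg: "L (- of_int (k n) * w - y) = L (y + of_int (k n) * w)"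
      using L_uminus[of "y + of_int (k n) * w"] y w by (simp only: add_mem scale_mem)
    have neg: "(\<Sum>i<n. of_int (- k i) * x i) = - y" by (simp add: y_def sum_negf)
    show "\<exists>m k. m > 0 \<and> L (of_int m * w - (\<Sum>i<n. of_int (k i) * x i)) \<le> \<theta> * real_of_int m \<and>
       (\<Sum>i<n. \<bar>real_of_int (k i)\<bar>) \<le> (2 / \<kappa>) * (L w + \<theta>) * real_of_int m"
    proof (cases "0 < k n")
      case True
      then show ?thesis
        using fin s neg by (intro exI[of _ "k n"] exI[of _ "\<lambda>i. - k i"]) (simp add: a_def s_def add.commute)
    next
      case False
      then have "k n < 0" using a by (simp add: a_def)
      then show ?thesis
        using fin s Lneg by (intro exI[of _ "- k n"] exI[of _ k]) (simp add: a_def s_def y_def)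
    qed
  qed auto
qed

section \<open>Finiteness of \<open>W\<close> modulo integer multiples\<close>

lemma finite_mod_mult:
  assumes "finite S" "S \<subseteq> W" "\<forall>w\<in>W. \<exists>s\<in>S. \<exists>u\<in>W. w = s + of_nat m * u"
    and "finite S'" "S' \<subseteq> W" "\<forall>w\<in>W. \<exists>s\<in>S'. \<exists>u\<in>W. w = s + of_nat n * u"
  shows "\<exists>S. finite S \<and> S \<subseteq> W \<and> (\<forall>w\<in>W. \<exists>s\<in>S. \<exists>u\<in>W. w = s + of_nat (m * n) * u)"
proof (intro exI conjI)
  show "finite ((\<lambda>(s, s'). s + of_nat m * s') ` (S \<times> S'))" using assms by simp
  show "(\<lambda>(s, s'). s + of_nat m * s') ` (S \<times> S') \<subseteq> W"
    using assms by (auto intro!: add_mem scale_nat_mem)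
  show "\<forall>w\<in>W. \<exists>s\<in>(\<lambda>(s, s'). s + of_nat m * s') ` (S \<times> S'). \<exists>u\<in>W. w = s + of_nat (m * n) * u"
  proof
    fix w assume "w \<in> W"
    then obtain s u where 1: "s \<in> S" "u \<in> W" "w = s + of_nat m * u" using assms(3) by blast
    then obtain s' u' where 2: "s' \<in> S'" "u' \<in> W" "u = s' + of_nat n * u'" using assms(6) by blast
    have "w = (s + of_nat m * s') + of_nat (m * n) * u'" using 1 2 by (simp add: algebra_simps)
    then show "\<exists>s\<in>(\<lambda>(s, s'). s + of_nat m * s') ` (S \<times> S'). \<exists>u\<in>W. w = s + of_nat (m * n) * u"
      using 1 2 by (intro bexI[of _ "s + of_nat m * s'"] bexI[of _ u']) auto
  qed
qed

definition indep_mod :: "nat \<Rightarrow> nat \<Rightarrow> (nat \<Rightarrow> 'v) \<Rightarrow> bool" where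
  "indep_mod p n x \<longleftrightarrow> (\<forall>i<n. x i \<in> W) \<and>
     (\<forall>k::nat \<Rightarrow> int. \<forall>u\<in>W. (\<Sum>i<n. of_int (k i) * x i) = of_nat p * u \<longrightarrow> (\<forall>i<n. int p dvd k i))"

text \<open>Infinite descent: in an integer relation \<open>p\<close> divides every coefficient, and
  as \<open>W\<close> has no torsion the relation can be divided by \<open>p\<close>. Hence
  independence modulo \<open>p\<close> implies independence over the integers.\<close>

lemma indep_mod_le:
  assumes p: "Factorial_Ring.prime p" and ind: "indep_mod p n x" shows "n \<le> r"
proof (rule no_long_independent)
  have x: "x i \<in> W" if "i < n" for i using ind that by (auto simp: indep_mod_def)
  fix k :: "nat \<Rightarrow> int"
  have p1: "p > 1" using p prime_gt_1_nat by blast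
  assume "(\<Sum>i<n. of_int (k i) * x i) = 0"
  then show "\<forall>i<n. k i = 0"
  proof (induction "\<Sum>i<n. nat \<bar>k i\<bar>" arbitrary: k rule: less_induct)
    case less
    have "\<forall>i<n. int p dvd k i"
      using ind less.prems zero_mem unfolding indep_mod_def by (metis mult_zero_right)
    then obtain q where q: "\<And>i. i < n \<Longrightarrow> k i = int p * q i" unfolding dvd_def by metis
    have "of_int (int p) * (\<Sum>i<n. of_int (q i) * x i) = (\<Sum>i<n. of_int (k i) * x i)"
      unfolding sum_distrib_left by (intro sum.cong) (auto simp: q algebra_simps)
    then have "of_int (int p) * (\<Sum>i<n. of_int (q i) * x i) = 0" using less.prems by simp
    then have 0: "(\<Sum>i<n. of_int (q i) * x i) = 0"
      using scale_eq_0[of "\<Sum>i<n. of_int (q i) * x i" "int p"] p1 x by (auto intro!: sum_mem scale_mem)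
    show ?case
    proof (rule ccontr)
      assume "\<not> ?thesis"
      then obtain j where j: "j < n" "k j \<noteq> 0" by blast
      have le: "nat \<bar>q i\<bar> \<le> nat \<bar>k i\<bar>" if "i < n" for i
        using q[OF that] p1 by (simp add: abs_mult nat_mult_distrib)
      have lt: "nat \<bar>q j\<bar> < nat \<bar>k j\<bar>"
        using q[OF j(1)] j(2) p1 by (simp add: abs_mult nat_mult_distrib)
      have "(\<Sum>i<n. nat \<bar>q i\<bar>) < (\<Sum>i<n. nat \<bar>k i\<bar>)"
        using le lt j by (intro sum_strict_mono_ex1) auto
      then have "\<forall>i<n. q i = 0" using less.hyps 0 by blast
      with q j show False by auto
    qed
  qed
qed (use ind in \<open>auto simp: indep_mod_def\<close>)

text \<open>\<open>W\<close> modulo \<open>p\<close> is a vector space over the field with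
  \<open>p\<close> elements, of dimension at most \<open>r\<close> by \<open>indep_mod_le\<close>;
  so it is finite even if \<open>W\<close> is not finitely generated. A maximal independent system
  spans it.\<close>

lemma finite_mod_prime:
  assumes p: "Factorial_Ring.prime (p::nat)"
  shows "\<exists>S. finite S \<and> S \<subseteq> W \<and> (\<forall>w\<in>W. \<exists>s\<in>S. \<exists>u\<in>W. w = s + of_nat p * u)"
proof -
  define P where "P n \<longleftrightarrow> (\<exists>x. indep_mod p n x)" for n
  have "P 0" unfolding P_def indep_mod_def by simp
  moreover have le: "\<forall>n. P n \<longrightarrow> n \<le> r" using indep_mod_le p by (auto simp: P_def)
  ultimately have "P (GREATEST n. P n)" "\<not> P (Suc (GREATEST n. P n))"
    using GreatestI_nat[of P 0 r] Greatest_le_nat[of P "Suc (GREATEST n. P n)" r]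
    by (blast, metis not_less_eq_eq order_refl)
  then obtain n x where ind: "indep_mod p n x" and max: "\<And>x'. \<not> indep_mod p (Suc n) x'"
    unfolding P_def by blast
  have x: "x i \<in> W" if "i < n" for i using ind that by (auto simp: indep_mod_def)
  have p1: "p > 1" using p prime_gt_1_nat by blast
  let ?f = "\<lambda>k::nat \<Rightarrow> int. \<Sum>i<n. of_int (k i) * x i"
  have fW: "?f k \<in> W" for k by (intro sum_mem scale_mem x) auto
  let ?S = "?f ` (PiE {..<n} (\<lambda>_. {0..<int p}))"
  show ?thesis
  proof (intro exI[of _ ?S] conjI ballI)
    show "finite ?S" by (intro finite_imageI finite_PiE) auto
    show "?S \<subseteq> W" using fW by auto
    fix w assume w: "w \<in> W"
    let ?x' = "\<lambda>i. if i = n then w else x i"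
    have "\<not> indep_mod p (Suc n) ?x'" by (rule max)
    moreover have "\<forall>i<Suc n. ?x' i \<in> W" using x w by auto
    ultimately obtain k u where k: "u \<in> W" "(\<Sum>i<Suc n. of_int (k i) * ?x' i) = of_nat p * u"
      "\<not> (\<forall>i<Suc n. int p dvd k i)" unfolding indep_mod_def by blast
    have "(\<Sum>i<n. of_int (k i) * ?x' i) = ?f k" by (intro sum.cong) auto
    with k(2) have eq: "?f k + of_int (k n) * w = of_nat p * u" by simp
    \<comment> \<open>Otherwise the term with \<open>w\<close> could be moved to the right side, and
      independence of the \<open>x i\<close> would make \<open>p\<close> divide the remaining
      coefficients too.\<close>
    have "\<not> int p dvd k n"
    proof
      assume "int p dvd k n"
      then obtain q where q: "k n = int p * q" by blast
      have "?f k = of_nat p * (u - of_int q * w)" using eq q by (simp add: algebra_simps)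
      moreover have "u - of_int q * w \<in> W" by (intro diff_mem scale_mem k w)
      ultimately have "\<forall>i<n. int p dvd k i" using ind unfolding indep_mod_def by blast
      with k(3) \<open>int p dvd k n\<close> show False by (auto simp: less_Suc_eq)
    qed
    \<comment> \<open>Bezout inverts the coefficient of \<open>w\<close> modulo \<open>p\<close>,
      which solves the relation for \<open>w\<close>; the coefficients \<open>e\<close> are then
      reduced modulo \<open>p\<close>.\<close>
    then have "coprime (int p) (k n)" using p by (intro prime_imp_coprime) auto
    then obtain b c where bc: "b * int p + c * k n = 1" using bezout_int[of "int p" "k n"] by auto
    define e where "e i = - c * k i" for i
    have "w = of_int (b * int p + c * k n) * w" using bc by simp
    also have "\<dots> = of_nat p * (of_int b * w) + of_int c * (of_int (k n) * w)" by (simp add: algebra_simps)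
    also have "of_int (k n) * w = of_nat p * u - ?f k" using eq by (simp add: algebra_simps)
    also have "of_nat p * (of_int b * w) + of_int c * (of_nat p * u - ?f k)
      = of_nat p * (of_int b * w + of_int c * u) + ?f e"
      by (simp add: e_def algebra_simps sum_distrib_left sum_negf)
    finally have w1: "w = of_nat p * (of_int b * w + of_int c * u) + ?f e" .
    have "?f e = (\<Sum>i<n. of_int (int p * (e i div int p) + e i mod int p) * x i)" by simp
    also have "\<dots> = of_nat p * ?f (\<lambda>i. e i div int p) + ?f (\<lambda>i. e i mod int p)"
      unfolding sum_distrib_left sum.distrib[symmetric]
      by (intro sum.cong refl) (simp only: of_int_add of_int_mult of_int_of_nat_eq algebra_simps)
    finally have "w = ?f (\<lambda>i. e i mod int p)
        + of_nat p * (of_int b * w + of_int c * u + ?f (\<lambda>i. e i div int p))"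
      using w1 by (simp add: algebra_simps)
    moreover have "?f (\<lambda>i. e i mod int p) = ?f (restrict (\<lambda>i. e i mod int p) {..<n})" by simp
    moreover have "restrict (\<lambda>i. e i mod int p) {..<n} \<in> PiE {..<n} (\<lambda>_. {0..<int p})" using p1 by auto
    moreover have "of_int b * w + of_int c * u + ?f (\<lambda>i. e i div int p) \<in> W"
      by (intro add_mem scale_mem w k fW)
    ultimately show "\<exists>s\<in>?S. \<exists>u\<in>W. w = s + of_nat p * u" by blast
  qed
qed

lemma finite_mod:
  assumes "m > 0"
  shows "\<exists>S. finite S \<and> S \<subseteq> W \<and> (\<forall>w\<in>W. \<exists>s\<in>S. \<exists>u\<in>W. w = s + of_nat m * u)"
  using assms
proof (induction m rule: prime_divisors_induct)
  case zero then show ?case by simp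
next
  case (unit u)
  then show ?case using zero_mem by (intro exI[of _ "{0}"]) auto
next
  case (factor p m)
  then have "m > 0" by (metis mult_is_0 neq0_conv)
  with factor finite_mod_prime[of p] show ?case
    using finite_mod_mult[of _ p _ m] by blast
qed

end

section \<open>Subgroups of finite index and free abelian quotients\<close>

text \<open>Finite index of \<open>K\<close> in \<open>H\<close>, stated inside the ambient group:
  chains of subgroups are handled without changing the group record, and the representatives may be
  redundant.\<close>

definition cofinite_in :: "('a, 'b) monoid_scheme \<Rightarrow> 'a set \<Rightarrow> 'a set \<Rightarrow> bool" where
  "cofinite_in G H K \<longleftrightarrow> (\<exists>T. finite T \<and> T \<subseteq> H \<and> H \<subseteq> (\<Union>t\<in>T. K #>\<^bsub>G\<^esub> t))"

definition fg_subgroup :: "('a, 'b) monoid_scheme \<Rightarrow> 'a set \<Rightarrow> bool" where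
  "fg_subgroup G H \<longleftrightarrow> (\<exists>S. finite S \<and> S \<subseteq> H \<and> generate G S = H)"

context group
begin

lemma finite_index_iff_cofinite:
  assumes "subgroup K G"
  shows "finite_index G K \<longleftrightarrow> cofinite_in G (carrier G) K"
proof
  interpret K: subgroup K G by (rule assms)
  assume "finite_index G K"
  then have fin: "finite (rcosets K)" by (simp add: finite_index_def)
  define f where "f C = (SOME a. a \<in> carrier G \<and> C = K #> a)" for C
  have f: "f C \<in> carrier G \<and> C = K #> f C" if "C \<in> rcosets K" for C
    unfolding f_def by (rule someI_ex) (use that in \<open>auto simp: RCOSETS_def\<close>)
  show "cofinite_in G (carrier G) K"
    unfolding cofinite_in_def
  proof (intro exI[of _ "f ` (rcosets K)"] conjI subsetI)
    fix x assume x: "x \<in> carrier G"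
    then have "K #> x \<in> rcosets K" by (auto simp: RCOSETS_def)
    then have "x \<in> K #> f (K #> x)" using f rcos_self[OF x assms] by blast
    with \<open>K #> x \<in> rcosets K\<close> show "x \<in> (\<Union>t\<in>f ` (rcosets K). K #> t)" by blast
  qed (use fin f in auto)
next
  assume "cofinite_in G (carrier G) K"
  then obtain T where T: "finite T" "T \<subseteq> carrier G" "carrier G \<subseteq> (\<Union>t\<in>T. K #> t)"
    unfolding cofinite_in_def by blast
  have "rcosets K \<subseteq> (\<lambda>t. K #> t) ` T"
  proof
    fix C assume "C \<in> rcosets K"
    then obtain a where a: "a \<in> carrier G" "C = K #> a" by (auto simp: RCOSETS_def)
    then obtain t where t: "t \<in> T" "a \<in> K #> t" using T by blast
    then have "C = K #> t" using a(2) repr_independence[of a K t] T assms by auto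
    with t show "C \<in> (\<lambda>t. K #> t) ` T" by blast
  qed
  then show "finite_index G K"
    using assms T(1) by (auto simp: finite_index_def intro: finite_subset)
qed

lemma cofinite_in_trans:
  assumes "H \<subseteq> carrier G" "K \<subseteq> H" "J \<subseteq> K" "subgroup H G"
    and "cofinite_in G H K" "cofinite_in G K J"
  shows "cofinite_in G H J"
proof -
  obtain T where T: "finite T" "T \<subseteq> H" "H \<subseteq> (\<Union>t\<in>T. K #> t)"
    using assms unfolding cofinite_in_def by blast
  obtain U where U: "finite U" "U \<subseteq> K" "K \<subseteq> (\<Union>t\<in>U. J #> t)"
    using assms unfolding cofinite_in_def by blast
  show ?thesis unfolding cofinite_in_def
  proof (intro exI[of _ "(\<lambda>(u, t). u \<otimes> t) ` (U \<times> T)"] conjI)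
    show "(\<lambda>(u, t). u \<otimes> t) ` (U \<times> T) \<subseteq> H"
      using U T assms by (auto intro!: subgroup.m_closed[OF assms(4)])
    show "H \<subseteq> (\<Union>t\<in>(\<lambda>(u, t). u \<otimes> t) ` (U \<times> T). J #> t)"
    proof
      fix h assume "h \<in> H"
      then obtain t k where 1: "t \<in> T" "k \<in> K" "h = k \<otimes> t" using T(3) by (auto simp: r_coset_def)
      then obtain u j where 2: "u \<in> U" "j \<in> J" "k = j \<otimes> u" using U(3) by (auto simp: r_coset_def)
      have "h = j \<otimes> (u \<otimes> t)"
        using 1 2 m_assoc[of j u t] assms T(2) U(2) by (metis subset_eq)
      moreover have "u \<otimes> t \<in> (\<lambda>(u, t). u \<otimes> t) ` (U \<times> T)" using 1 2 by force
      ultimately show "h \<in> (\<Union>t\<in>(\<lambda>(u, t). u \<otimes> t) ` (U \<times> T). J #> t)"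
        using 2 unfolding r_coset_def by blast
    qed
  qed (use T U in auto)
qed

text \<open>Schreier's lemma; the transversal need not consist of unique representatives.\<close>

lemma fg_subgroup_cofinite:
  assumes K: "subgroup K G" and H: "subgroup H G" and KH: "K \<subseteq> H"
    and fg: "fg_subgroup G H" and co: "cofinite_in G H K"
  shows "fg_subgroup G K"
proof -
  interpret K: subgroup K G by (rule K)
  interpret H: subgroup H G by (rule H)
  obtain S where S: "finite S" "S \<subseteq> H" "generate G S = H" using fg unfolding fg_subgroup_def by blast
  obtain T0 where T0: "finite T0" "T0 \<subseteq> H" "H \<subseteq> (\<Union>t\<in>T0. K #> t)"
    using co unfolding cofinite_in_def by blast
  define T where "T = insert \<one> T0"
  have T: "finite T" "T \<subseteq> H" "H \<subseteq> (\<Union>t\<in>T. K #> t)" "\<one> \<in> T" using T0 by (auto simp: T_def)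
  define R where "R = S \<union> (\<lambda>s. inv s) ` S"
  have R: "finite R" "R \<subseteq> H" using S(1,2) by (auto simp: R_def)
  have "\<exists>t'. t' \<in> T \<and> x \<otimes> inv t' \<in> K" if x: "x \<in> H" for x
  proof -
    obtain t k where t: "t \<in> T" "k \<in> K" "x = k \<otimes> t" using T(3) x by (auto simp: r_coset_def)
    then have "x \<otimes> inv t \<in> K" using T(2) by (auto simp: m_assoc)
    with t(1) show ?thesis by blast
  qed
  then obtain \<tau> where \<tau>: "\<And>x. x \<in> H \<Longrightarrow> \<tau> x \<in> T \<and> x \<otimes> inv (\<tau> x) \<in> K" by metis
  \<comment> \<open>\<open>T \<inter> K\<close> is added to the Schreier generators because
    \<open>\<tau>\<close> need not send elements of \<open>K\<close> to 1: the final argument only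
    writes an element of \<open>K\<close> as \<open>j \<otimes> t\<close> with some \<open>t\<close>
    in \<open>T\<close>, and this \<open>t\<close> then lies in \<open>K\<close>.\<close>
  define S' where "S' = (\<lambda>(t, s). (t \<otimes> s) \<otimes> inv (\<tau> (t \<otimes> s))) ` (T \<times> R) \<union> (T \<inter> K)"
  have S': "finite S'" "S' \<subseteq> K" using T R \<tau> by (auto simp: S'_def subset_iff)
  let ?J = "generate G S'"
  have S'c: "S' \<subseteq> carrier G" using S' by auto
  have J: "subgroup ?J G" by (rule generate_is_subgroup[OF S'c])
  interpret J: subgroup ?J G by (rule J)
  have JK: "?J \<subseteq> K" by (rule generate_subgroup_incl[OF S'(2) K])
  \<comment> \<open>\<open>Y\<close> contains 1 and is stable under right multiplication by
    generators and their inverses, so it contains \<open>H\<close>: the cosets of \<open>?J\<close>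
    by \<open>T\<close> already cover everything.\<close>
  define Y where "Y = (\<Union>t\<in>T. ?J #> t)"
  have step: "x \<otimes> s \<in> Y" if x: "x \<in> Y" and s: "s \<in> R" for x s
  proof -
    obtain t j where t: "t \<in> T" "j \<in> ?J" "x = j \<otimes> t" using x by (auto simp: Y_def r_coset_def)
    have tH: "t \<in> H" "s \<in> H" using t T s R by auto
    then have ts: "t \<otimes> s \<in> H" by auto
    let ?k = "(t \<otimes> s) \<otimes> inv (\<tau> (t \<otimes> s))"
    have \<tau>c: "\<tau> (t \<otimes> s) \<in> carrier G" using \<tau>[OF ts] T by auto
    have "?k \<in> S'" using t s by (auto simp: S'_def)
    then have k: "?k \<in> ?J" by (rule generate.incl)
    have "x \<otimes> s = (j \<otimes> ?k) \<otimes> \<tau> (t \<otimes> s)"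
      using t tH \<tau>c by (simp add: m_assoc)
    moreover have "j \<otimes> ?k \<in> ?J" using t k by auto
    ultimately show ?thesis using \<tau>[OF ts] by (auto simp: Y_def r_coset_def)
  qed
  have gen: "\<forall>x\<in>Y. x \<otimes> h \<in> Y" if "h \<in> generate G S" for h
    using that
  proof (induction rule: generate.induct)
    case one
    have "Y \<subseteq> carrier G" using T by (auto simp: Y_def r_coset_def)
    then show ?case by auto
  next
    case (incl h)
    then show ?case using step by (auto simp: R_def)
  next
    case (inv h)
    then show ?case using step by (auto simp: R_def)
  next
    case (eng h1 h2)
    have "Y \<subseteq> carrier G" using T by (auto simp: Y_def r_coset_def)
    moreover have "h1 \<in> carrier G" "h2 \<in> carrier G" using eng S by auto
    ultimately have "x \<otimes> (h1 \<otimes> h2) = (x \<otimes> h1) \<otimes> h2" if "x \<in> Y" for x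
      using that by (simp add: m_assoc subset_iff)
    then show ?case using eng by simp
  qed
  have one: "\<one> \<in> Y" using T(4) J.one_closed by (auto simp: Y_def r_coset_def intro!: bexI[of _ "\<one>"])
  have "K \<subseteq> ?J"
  proof
    fix k assume k: "k \<in> K"
    then have "k \<in> generate G S" using KH S by auto
    then have "\<one> \<otimes> k \<in> Y" using gen one by blast
    then have "k \<in> Y" using k by simp
    then obtain t j where t: "t \<in> T" "j \<in> ?J" "k = j \<otimes> t" by (auto simp: Y_def r_coset_def)
    then have tj: "t = inv j \<otimes> k" using T(2) by (auto simp: m_assoc[symmetric])
    have "inv j \<otimes> k \<in> K" using t(2) JK k by (meson K.m_closed K.m_inv_closed subsetD)
    then have "t \<in> K" unfolding tj[symmetric] .
    with t have "t \<in> S'" by (auto simp: S'_def)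
    then have "t \<in> ?J" by (rule generate.incl)
    with t show "k \<in> ?J" by auto
  qed
  with JK S' show ?thesis unfolding fg_subgroup_def by blast
qed

end

section \<open>The groups \<open>Zn n\<close> and homomorphisms out of them\<close>

lemma Zn_simps [simp]:
  "v \<in> carrier (Zn n) \<longleftrightarrow> (\<forall>i\<ge>n. v i = 0)" "v \<otimes>\<^bsub>Zn n\<^esub> w = (\<lambda>i. v i + w i)" "\<one>\<^bsub>Zn n\<^esub> = (\<lambda>_. 0)"
  by (auto simp: Zn_def)

lemma comm_group_Zn: "comm_group (Zn n)"
proof (rule comm_groupI)
  fix x assume "x \<in> carrier (Zn n)"
  then show "\<exists>y\<in>carrier (Zn n). y \<otimes>\<^bsub>Zn n\<^esub> x = \<one>\<^bsub>Zn n\<^esub>"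
    by (intro bexI[of _ "\<lambda>i. - x i"]) auto
qed (auto simp: algebra_simps)

lemma group_Zn: "group (Zn n)"
  using comm_group_Zn by (simp add: comm_group_def)

lemma Zn_inv: "v \<in> carrier (Zn n) \<Longrightarrow> inv\<^bsub>Zn n\<^esub> v = (\<lambda>i. - v i)"
  by (rule group.inv_equality[OF group_Zn]) auto

lemma Zn_int_pow:
  assumes "v \<in> carrier (Zn n)" shows "v [^]\<^bsub>Zn n\<^esub> (k::int) = (\<lambda>i. k * v i)"
proof -
  have nat: "v [^]\<^bsub>Zn n\<^esub> (m::nat) = (\<lambda>i. int m * v i)" for m
    by (induction m) (auto simp: algebra_simps)
  show ?thesis
    using assms by (auto simp: int_pow_def2 nat Zn_inv)
qed

definition Zn_restrict :: "nat \<Rightarrow> (nat \<Rightarrow> int) \<Rightarrow> nat \<Rightarrow> int" where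
  "Zn_restrict n e = (\<lambda>i. if i < n then e i else 0)"

definition Zn_unit :: "nat \<Rightarrow> nat \<Rightarrow> int" where
  "Zn_unit j = (\<lambda>i. if i = j then 1 else 0)"

lemma (in group) hom_Zn_scale:
  assumes "P \<in> hom (Zn n) G" "e \<in> carrier (Zn n)"
  shows "P (\<lambda>i. k * e i) = P e [^] (k::int)"
  using hom_int_pow[OF assms group_Zn is_group, of k] Zn_int_pow[OF assms(2)] by simp

lemma (in group) hom_Zn_add:
  assumes "P \<in> hom (Zn n) G" "e \<in> carrier (Zn n)" "e' \<in> carrier (Zn n)"
  shows "P (\<lambda>i. e i + e' i) = P e \<otimes> P e'"
  using hom_mult[OF assms] by simp

lemma (in group) hom_Zn_zero:
  assumes "P \<in> hom (Zn n) G" shows "P (\<lambda>i. 0) = \<one>"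
  using hom_one[OF assms group_Zn is_group] by simp

lemma (in group) hom_Zn_closed:
  assumes "P \<in> hom (Zn n) G" "e \<in> carrier (Zn n)"
  shows "P e \<in> carrier G"
  using hom_in_carrier[OF assms] .

lemma (in group) hom_Zn_inj_iff:
  assumes "P \<in> hom (Zn n) G"
  shows "inj_on P (carrier (Zn n)) \<longleftrightarrow> (\<forall>e\<in>carrier (Zn n). P e = \<one> \<longrightarrow> e = (\<lambda>_. 0))"
proof -
  interpret h: group_hom "Zn n" G P
    by (simp add: group_hom_def group_hom_axioms_def group_Zn is_group assms)
  show ?thesis unfolding h.inj_on_one_iff by (simp add: Ball_def)
qed

context comm_group
begin

text \<open>An element none of whose positive powers lies in the image is independent of it and can
  serve as image of a new unit vector.\<close>

lemma hom_Zn_extend: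
  assumes P: "P \<in> hom (Zn n) G" and inj: "inj_on P (carrier (Zn n))" and a: "a \<in> carrier G"
    and notin: "\<And>m::nat. m > 0 \<Longrightarrow> a [^] m \<notin> P ` carrier (Zn n)"
  defines "P' \<equiv> \<lambda>e. P (Zn_restrict n e) \<otimes> a [^] (e n)"
  shows "P' \<in> hom (Zn (Suc n)) G" and "inj_on P' (carrier (Zn (Suc n)))"
    and "\<And>e. e \<in> carrier (Zn n) \<Longrightarrow> P' e = P e" and "P' (Zn_unit n) = a"
proof -
  have r: "Zn_restrict n e \<in> carrier (Zn n)" for e by (simp add: Zn_restrict_def)
  have Pc: "P (Zn_restrict n e) \<in> carrier G" for e using hom_Zn_closed[OF P r] .
  show hom: "P' \<in> hom (Zn (Suc n)) G"
  proof (rule homI)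
    fix x y
    have "P (Zn_restrict n (\<lambda>i. x i + y i)) = P (\<lambda>i. Zn_restrict n x i + Zn_restrict n y i)"
      by (rule arg_cong[of _ _ P]) (auto simp: Zn_restrict_def)
    also have "\<dots> = P (Zn_restrict n x) \<otimes> P (Zn_restrict n y)" by (rule hom_Zn_add[OF P r r])
    finally show "P' (x \<otimes>\<^bsub>Zn (Suc n)\<^esub> y) = P' x \<otimes> P' y"
      using a Pc by (simp add: P'_def int_pow_mult m_ac)
  qed (use a Pc in \<open>simp add: P'_def\<close>)
  show eq: "P' e = P e" if "e \<in> carrier (Zn n)" for e
  proof -
    have "Zn_restrict n e = e" using that by (auto simp: Zn_restrict_def)
    then show ?thesis using that hom_Zn_closed[OF P that] by (simp add: P'_def)
  qed
  have "Zn_restrict n (Zn_unit n) = (\<lambda>_. 0)" by (auto simp: Zn_restrict_def Zn_unit_def)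
  then show "P' (Zn_unit n) = a" using a hom_Zn_zero[OF P] by (simp add: P'_def Zn_unit_def int_pow_1)
  show "inj_on P' (carrier (Zn (Suc n)))"
    unfolding hom_Zn_inj_iff[OF hom]
  proof (intro ballI impI)
    fix e assume e: "e \<in> carrier (Zn (Suc n))" and 1: "P' e = \<one>"
    let ?e = "Zn_restrict n e"
    have "a [^] (e n) = inv (P ?e)" using 1 a Pc[of e] unfolding P'_def
      by (metis inv_equality inv_inv int_pow_closed m_comm)
    also have "\<dots> = P (\<lambda>i. -1 * ?e i)" using hom_Zn_scale[OF P r, of "-1" e] Pc[of e]
      by (simp add: int_pow_neg int_pow_1)
    finally have a1: "a [^] (e n) = P (\<lambda>i. -1 * ?e i)" .
    have m1: "(\<lambda>i. -1 * ?e i) \<in> carrier (Zn n)" "(\<lambda>i. -1 * (-1 * ?e i)) \<in> carrier (Zn n)"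
      using r[of e] by auto
    have "P (\<lambda>i. -1 * (-1 * ?e i)) = inv (P (\<lambda>i. -1 * ?e i))"
      using hom_Zn_scale[OF P m1(1), of "-1"] hom_Zn_closed[OF P m1(1)]
      by (simp only: int_pow_neg int_pow_1)
    then have a2: "a [^] (- e n) = P (\<lambda>i. -1 * (-1 * ?e i))"
      using a by (simp only: int_pow_neg a1)
    \<comment> \<open>\<open>notin\<close> speaks of positive powers only, so \<open>a1\<close>
      refutes a positive coordinate and its inverted form \<open>a2\<close> a negative one.\<close>
    have "e n = 0"
    proof (rule ccontr)
      assume "e n \<noteq> 0"
      then consider "e n > 0" | "e n < 0" by linarith
      then show False
      proof cases
        case 1
        then have "a [^] (nat (e n)) = a [^] (e n)" by (simp flip: int_pow_int)
        with a1 m1 notin[of "nat (e n)"] 1 show False by auto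
      next
        case 2
        then have "a [^] (nat (- e n)) = a [^] (- e n)" by (simp flip: int_pow_int)
        with a2 m1 notin[of "nat (- e n)"] 2 show False by auto
      qed
    qed
    then have "P ?e = \<one>" using 1 Pc[of e] by (simp add: P'_def)
    then have "?e = (\<lambda>_. 0)" using inj r[of e] unfolding hom_Zn_inj_iff[OF P] by blast
    then have "\<forall>i<n. e i = 0" unfolding Zn_restrict_def by meson
    with \<open>e n = 0\<close> e show "e = (\<lambda>_. 0)" by (intro ext) (metis Zn_simps(1) linorder_neqE_nat Suc_leI)
  qed
qed

lemma pow_in_hom_image:
  assumes "P \<in> hom (Zn n) G" "a \<in> carrier G" "a [^] (m::nat) \<in> P ` carrier (Zn n)"
  shows "a [^] (m * k) \<in> P ` carrier (Zn n)"
proof -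
  obtain e where e: "e \<in> carrier (Zn n)" "a [^] m = P e" using assms(3) by auto
  have "a [^] (m * k) = (a [^] m) [^] k" using assms(2) by (simp add: nat_pow_pow)
  also have "\<dots> = P (\<lambda>i. int k * e i)" using hom_Zn_scale[OF assms(1) e(1), of "int k"] e(2) by (simp add: int_pow_int)
  finally show ?thesis using e(1) by auto
qed

section \<open>Finitely generated abelian groups up to finite index\<close>

lemma image_subgroup_Zn:
  assumes "P \<in> hom (Zn n) G" shows "subgroup (P ` carrier (Zn n)) G"
proof -
  interpret h: group_hom "Zn n" G P
    by (simp add: group_hom_def group_hom_axioms_def group_Zn is_group assms)
  show ?thesis by (rule h.img_is_subgroup)
qed

lemma torsion_mod_subgroup_generate:
  assumes B: "subgroup B G" and S: "S \<subseteq> carrier G" and tor: "\<forall>s\<in>S. s [^] (N::nat) \<in> B"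
    and a: "a \<in> generate G S"
  shows "a [^] N \<in> B"
  using a
proof (induction rule: generate.induct)
  case one then show ?case using B by (simp add: subgroup.one_closed)
next
  case (incl h) then show ?case using tor by simp
next
  case (inv h)
  then have "inv (h [^] N) \<in> B" using tor B by (simp add: subgroup.m_inv_closed)
  then show ?case using inv S by (simp add: nat_pow_inv subset_iff)
next
  case (eng h1 h2)
  then have "h1 \<in> carrier G" "h2 \<in> carrier G" using generate_in_carrier[OF S] by auto
  with eng show ?case using B by (simp add: nat_pow_distrib subgroup.m_closed)
qed

text \<open>This takes the place of the structure theorem. Generators are adjoined one by one: if
  some positive power of the new one lies in the image so far, its exponent is multiplied into
  \<open>N\<close>; if none does, the rank grows by one.\<close>

lemma free_part:
  assumes "finite S" "S \<subseteq> carrier G"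
  shows "\<exists>n P N. P \<in> hom (Zn n) G \<and> inj_on P (carrier (Zn n)) \<and> (N::nat) > 0 \<and>
    (\<forall>a\<in>generate G S. a [^] N \<in> P ` carrier (Zn n))"
proof -
  have "\<exists>n P N. P \<in> hom (Zn n) G \<and> inj_on P (carrier (Zn n)) \<and> (N::nat) > 0 \<and>
    (\<forall>a\<in>S. a [^] N \<in> P ` carrier (Zn n))"
    using assms
  proof (induction S)
    case empty
    have "(\<lambda>_. \<one>) \<in> hom (Zn 0) G" by (rule homI) auto
    moreover have "inj_on (\<lambda>_. \<one>) (carrier (Zn 0))" by (auto intro!: inj_onI)
    ultimately show ?case by blast
  next
    case (insert s S)
    then obtain n P N where IH: "P \<in> hom (Zn n) G" "inj_on P (carrier (Zn n))" "(N::nat) > 0"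
      "\<forall>a\<in>S. a [^] N \<in> P ` carrier (Zn n)" by auto
    have s: "s \<in> carrier G" using insert by auto
    show ?case
    proof (cases "\<exists>m::nat. m > 0 \<and> s [^] m \<in> P ` carrier (Zn n)")
      case True
      then obtain m :: nat where m: "m > 0" "s [^] m \<in> P ` carrier (Zn n)" by blast
      have "\<forall>a\<in>insert s S. a [^] (N * m) \<in> P ` carrier (Zn n)"
      proof
        fix a assume "a \<in> insert s S"
        then show "a [^] (N * m) \<in> P ` carrier (Zn n)"
          using pow_in_hom_image[OF IH(1) s m(2), of N] pow_in_hom_image[OF IH(1), of a N m] IH(4) insert.prems
          by (auto simp: mult.commute)
      qed
      then show ?thesis using IH m(1) by (intro exI[of _ n] exI[of _ P] exI[of _ "N * m"]) simp
    next
      case False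
      define P' where "P' = (\<lambda>e. P (Zn_restrict n e) \<otimes> s [^] (e n))"
      have P': "P' \<in> hom (Zn (Suc n)) G" "inj_on P' (carrier (Zn (Suc n)))"
        "\<And>e. e \<in> carrier (Zn n) \<Longrightarrow> P' e = P e" "P' (Zn_unit n) = s"
        using hom_Zn_extend[OF IH(1,2) s] False unfolding P'_def by blast+
      have sub: "P ` carrier (Zn n) \<subseteq> P' ` carrier (Zn (Suc n))"
      proof
        fix y assume "y \<in> P ` carrier (Zn n)"
        then obtain e where e: "e \<in> carrier (Zn n)" "y = P e" by blast
        then have "e \<in> carrier (Zn (Suc n))" by simp
        with e P'(3)[OF e(1)] show "y \<in> P' ` carrier (Zn (Suc n))" by (intro image_eqI[of _ _ e]) auto
      qed
      have u: "Zn_unit n \<in> carrier (Zn (Suc n))" by (auto simp: Zn_unit_def)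
      have "s [^] (1::nat) \<in> P' ` carrier (Zn (Suc n))"
        using P'(4) u s by (intro image_eqI[of _ _ "Zn_unit n"]) auto
      then have "s [^] (1 * N) \<in> P' ` carrier (Zn (Suc n))" by (rule pow_in_hom_image[OF P'(1) s])
      then have "\<forall>a\<in>insert s S. a [^] N \<in> P' ` carrier (Zn (Suc n))"
        using IH(4) sub by auto
      then show ?thesis using P'(1,2) IH(3) by blast
    qed
  qed
  then obtain n P N where 1: "P \<in> hom (Zn n) G" "inj_on P (carrier (Zn n))" "(N::nat) > 0"
    "\<forall>a\<in>S. a [^] N \<in> P ` carrier (Zn n)" by blast
  then show ?thesis
    using torsion_mod_subgroup_generate[OF image_subgroup_Zn[OF 1(1)] assms(2) 1(4)] by blast
qed

text \<open>An element is a product of powers of the generators. Reducing the exponents modulo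
  \<open>N\<close> changes it by an \<open>N\<close>-th power, which lies in \<open>B\<close>, so
  the products with exponents below \<open>N\<close> meet all cosets.\<close>

lemma cofinite_of_torsion:
  assumes S: "finite S" "S \<subseteq> carrier G" "generate G S = carrier G" and B: "subgroup B G"
    and N: "(N::nat) > 0" "\<And>a. a \<in> carrier G \<Longrightarrow> a [^] N \<in> B"
  shows "cofinite_in G (carrier G) B"
proof -
  define F where "F e = (\<Otimes>s\<in>S. s [^] (e s :: int))" for e
  have c: "(\<lambda>s. s [^] (e s :: int)) \<in> S \<rightarrow> carrier G" for e using S(2) by auto
  have Fc: "F e \<in> carrier G" for e unfolding F_def by (rule finprod_closed[OF c])
  have Fadd: "F (\<lambda>s. e s + e' s) = F e \<otimes> F e'" for e e'
  proof -
    have "F e \<otimes> F e' = (\<Otimes>s\<in>S. s [^] (e s) \<otimes> s [^] (e' s))"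
      unfolding F_def by (rule finprod_multf[OF c c, symmetric])
    also have "\<dots> = F (\<lambda>s. e s + e' s)" unfolding F_def
      using S(2) by (intro finprod_cong') (auto simp: int_pow_mult subset_iff)
    finally show ?thesis ..
  qed
  have F0: "F (\<lambda>_. 0) = \<one>" unfolding F_def by simp
  have gen: "\<exists>e. a = F e" if "a \<in> generate G S" for a
    using that
  proof (induction rule: generate.induct)
    case one then show ?case using F0 by metis
  next
    case (incl h)
    have "F (\<lambda>s. if s = h then 1 else 0) = (\<Otimes>s\<in>S. if h = s then h else \<one>)"
      unfolding F_def using S(2) incl by (intro finprod_cong') (auto simp: subset_iff int_pow_1)
    also have "\<dots> = h" using finprod_singleton[OF incl S(1), of "\<lambda>_. h"] S(2) incl by auto
    finally show ?case by metis
  next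
    case (inv h)
    have "F (\<lambda>s. if s = h then -1 else 0) = (\<Otimes>s\<in>S. if h = s then inv h else \<one>)"
      unfolding F_def using S(2) inv by (intro finprod_cong') (auto simp: subset_iff int_pow_neg int_pow_1)
    also have "\<dots> = inv h" using finprod_singleton[OF inv S(1), of "\<lambda>_. inv h"] S(2) inv by auto
    finally show ?case by metis
  next
    case (eng h1 h2) then show ?case using Fadd by metis
  qed
  define T where "T = F ` (PiE S (\<lambda>_. {0..<int N}))"
  show ?thesis unfolding cofinite_in_def
  proof (intro exI[of _ T] conjI subsetI)
    show "finite T" unfolding T_def by (intro finite_imageI finite_PiE S(1)) auto
    show "a \<in> carrier G" if "a \<in> T" for a using that Fc by (auto simp: T_def)
    fix a assume "a \<in> carrier G"
    then obtain e where e: "a = F e" using gen S(3) by auto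
    define q where "q s = e s div int N" for s
    define d where "d = restrict (\<lambda>s. e s mod int N) S"
    have d: "d \<in> PiE S (\<lambda>_. {0..<int N})" using N(1) by (auto simp: d_def)
    have "F (\<lambda>s. int N * q s) = F q [^] N"
    proof -
      have "F (\<lambda>s. int m * q s) = F q [^] m" for m
      proof (induction m)
        case (Suc m)
        have "F (\<lambda>s. int (Suc m) * q s) = F (\<lambda>s. int m * q s + q s)"
          by (rule arg_cong[of _ _ F]) (auto simp: algebra_simps)
        then show ?case using Suc Fadd[of "\<lambda>s. int m * q s" q] by simp
      qed (simp add: F0)
      then show ?thesis .
    qed
    then have B1: "F (\<lambda>s. int N * q s) \<in> B" using N(2)[OF Fc] by simp
    have "F e = F (\<lambda>s. int N * q s + d s)" unfolding F_def
      using S(2) by (intro finprod_cong') (auto simp: q_def d_def)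
    then have "a = F (\<lambda>s. int N * q s) \<otimes> F d" using e Fadd by simp
    then show "a \<in> (\<Union>t\<in>T. B #> t)" using B1 d by (auto simp: T_def r_coset_def)
  qed
qed

text \<open>Coordinates of a torsion-free abelian group of finite rank with respect to a maximal
  independent system.\<close>

lemma rational_coordinates:
  assumes tf: "\<And>a m. a \<in> carrier G \<Longrightarrow> (m::nat) > 0 \<Longrightarrow> a [^] m = \<one> \<Longrightarrow> a = \<one>"
    and bound: "\<And>n P. P \<in> hom (Zn n) G \<Longrightarrow> inj_on P (carrier (Zn n)) \<Longrightarrow> n \<le> B"
  obtains r P and \<iota> :: "'a \<Rightarrow> nat \<Rightarrow> rat" where
    "P \<in> hom (Zn r) G" "inj_on P (carrier (Zn r))"
    "\<And>n P. P \<in> hom (Zn n) G \<Longrightarrow> inj_on P (carrier (Zn n)) \<Longrightarrow> n \<le> r"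
    "\<And>a. a \<in> carrier G \<Longrightarrow> \<exists>m e. (m::nat) > 0 \<and> e \<in> carrier (Zn r) \<and> a [^] m = P e"
    "\<And>a m e. a \<in> carrier G \<Longrightarrow> (m::nat) > 0 \<Longrightarrow> e \<in> carrier (Zn r) \<Longrightarrow> a [^] m = P e \<Longrightarrow>
       \<iota> a = (\<lambda>i. of_int (e i) / of_nat m)"
    "\<And>a b. a \<in> carrier G \<Longrightarrow> b \<in> carrier G \<Longrightarrow> \<iota> (a \<otimes> b) = \<iota> a + \<iota> b"
    "inj_on \<iota> (carrier G)"
proof -
  define Q where "Q n \<longleftrightarrow> (\<exists>P. P \<in> hom (Zn n) G \<and> inj_on P (carrier (Zn n)))" for n
  have "(\<lambda>_. \<one>) \<in> hom (Zn 0) G" by (rule homI) auto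
  moreover have "inj_on (\<lambda>_. \<one>) (carrier (Zn 0))" by (auto intro!: inj_onI)
  ultimately have Q0: "Q 0" unfolding Q_def by blast
  define r where "r = (GREATEST n. Q n)"
  have QB: "\<forall>n. Q n \<longrightarrow> n \<le> B" using bound by (auto simp: Q_def)
  have "Q r" unfolding r_def by (rule GreatestI_nat[of Q 0 B]) (use Q0 QB in auto)
  have max: "n \<le> r" if "P \<in> hom (Zn n) G" "inj_on P (carrier (Zn n))" for n P
    unfolding r_def by (rule Greatest_le_nat[of Q _ B]) (use that QB in \<open>auto simp: Q_def\<close>)
  from \<open>Q r\<close> obtain P where P: "P \<in> hom (Zn r) G" "inj_on P (carrier (Zn r))" unfolding Q_def by blast
  have ex: "\<exists>m e. (m::nat) > 0 \<and> e \<in> carrier (Zn r) \<and> a [^] m = P e" if a: "a \<in> carrier G" for a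
  proof (rule ccontr)
    assume "\<not> ?thesis"
    then have "\<And>m::nat. m > 0 \<Longrightarrow> a [^] m \<notin> P ` carrier (Zn r)" by blast
    from hom_Zn_extend(1,2)[OF P a this] max show False by fastforce
  qed
  \<comment> \<open>Cross-multiplication: \<open>m' e\<close> and \<open>m e'\<close> both describe
    the power of \<open>a\<close> with exponent \<open>m m'\<close>, so the fraction does not depend
    on the chosen power.\<close>
  have uniq: "(\<lambda>i. of_int (e i) / of_nat m) = (\<lambda>i. of_int (e' i) / of_nat m' :: rat)"
    if "a \<in> carrier G" "(m::nat) > 0" "e \<in> carrier (Zn r)" "a [^] m = P e"
      "(m'::nat) > 0" "e' \<in> carrier (Zn r)" "a [^] m' = P e'" for a m e m' e'
  proof -
    have "P (\<lambda>i. int m' * e i) = (a [^] m) [^] m'"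
      unfolding hom_Zn_scale[OF P(1) that(3)] that(4) by (rule int_pow_int)
    moreover have "P (\<lambda>i. int m * e' i) = (a [^] m') [^] m"
      unfolding hom_Zn_scale[OF P(1) that(6)] that(7) by (rule int_pow_int)
    moreover have "(a [^] m) [^] m' = (a [^] m') [^] m"
      using that(1) by (simp add: nat_pow_pow mult.commute)
    ultimately have "(\<lambda>i. int m' * e i) = (\<lambda>i. int m * e' i)"
      using inj_onD[OF P(2), of "\<lambda>i. int m' * e i" "\<lambda>i. int m * e' i"] that(3,6) by simp
    then have "int m' * e i = int m * e' i" for i by meson
    then have "of_nat m' * of_int (e i) = (of_nat m * of_int (e' i) :: rat)" for i
      by (metis of_int_mult of_int_of_nat_eq)
    then show ?thesis using that(2,5) by (auto simp: field_simps)
  qed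
  define \<iota> where "\<iota> a = (SOME x. \<exists>m e. (m::nat) > 0 \<and> e \<in> carrier (Zn r) \<and> a [^] m = P e \<and>
     x = (\<lambda>i. of_int (e i) / of_nat m :: rat))" for a
  have \<iota>: "\<iota> a = (\<lambda>i. of_int (e i) / of_nat m)"
    if "a \<in> carrier G" "(m::nat) > 0" "e \<in> carrier (Zn r)" "a [^] m = P e" for a m e
  proof -
    have "\<exists>x m e. (m::nat) > 0 \<and> e \<in> carrier (Zn r) \<and> a [^] m = P e \<and>
        x = (\<lambda>i. of_int (e i) / of_nat m :: rat)"
      by (intro exI conjI, rule that(2), rule that(3), rule that(4), rule refl)
    from someI_ex[OF this] obtain m' e' where "(m'::nat) > 0" "e' \<in> carrier (Zn r)" "a [^] m' = P e'"
      "\<iota> a = (\<lambda>i. of_int (e' i) / of_nat m' :: rat)" unfolding \<iota>_def by (elim exE conjE)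
    then show ?thesis using uniq[OF that] by metis
  qed
  have add: "\<iota> (a \<otimes> b) = \<iota> a + \<iota> b" if ab: "a \<in> carrier G" "b \<in> carrier G" for a b
  proof -
    obtain m e where 1: "(m::nat) > 0" "e \<in> carrier (Zn r)" "a [^] m = P e" using ex ab by blast
    obtain m' e' where 2: "(m'::nat) > 0" "e' \<in> carrier (Zn r)" "b [^] m' = P e'" using ex ab by blast
    have "(a \<otimes> b) [^] (m * m') = (a [^] m) [^] m' \<otimes> (b [^] m') [^] m"
      using ab by (simp add: nat_pow_distrib nat_pow_pow mult.commute)
    also have "\<dots> = P (\<lambda>i. int m' * e i) \<otimes> P (\<lambda>i. int m * e' i)"
      using hom_Zn_scale[OF P(1) 1(2), of "int m'"] hom_Zn_scale[OF P(1) 2(2), of "int m"] 1 2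
      by (simp add: int_pow_int)
    also have "\<dots> = P (\<lambda>i. int m' * e i + int m * e' i)"
      using hom_Zn_add[OF P(1), of "\<lambda>i. int m' * e i" "\<lambda>i. int m * e' i"] 1 2 by simp
    finally have "\<iota> (a \<otimes> b) = (\<lambda>i. of_int (int m' * e i + int m * e' i) / of_nat (m * m'))"
      using 1 2 ab by (intro \<iota>) auto
    then show ?thesis unfolding \<iota>[OF ab(1) 1] \<iota>[OF ab(2) 2] using 1(1) 2(1)
      by (simp add: fun_eq_iff add_divide_distrib)
  qed
  have inj: "inj_on \<iota> (carrier G)"
  proof (rule inj_onI)
    fix a b assume ab: "a \<in> carrier G" "b \<in> carrier G" "\<iota> a = \<iota> b"
    have "\<iota> a = \<iota> (a \<otimes> inv b) + \<iota> b" using add[of "a \<otimes> inv b" b] ab by (simp add: m_assoc)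
    then have 0: "\<iota> (a \<otimes> inv b) = 0" using ab by simp
    obtain m e where 1: "(m::nat) > 0" "e \<in> carrier (Zn r)" "(a \<otimes> inv b) [^] m = P e"
      using ex[of "a \<otimes> inv b"] ab by auto
    have "(\<lambda>i. of_int (e i) / of_nat m) = (0::nat \<Rightarrow> rat)" using \<iota>[OF _ 1] 0 ab by simp
    then have "e = (\<lambda>_. 0)" using 1(1) by (auto simp: fun_eq_iff)
    then have "(a \<otimes> inv b) [^] m = \<one>" using 1 hom_Zn_zero[OF P(1)] by simp
    then have "a \<otimes> inv b = \<one>" using tf[of "a \<otimes> inv b" m] 1 ab by simp
    then show "a = b" using ab by (metis inv_equality inv_inv inv_closed)
  qed
  show ?thesis by (rule that[OF P max ex \<iota> add inj])
qed

end

section \<open>Free abelian subgroups and the rank hypothesis\<close>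

context group
begin

text \<open>The iterated product in \<open>Z_independent\<close>, taken over the images of the unit
  vectors, is \<open>P\<close> of the exponent vector; so injectivity of \<open>P\<close> is
  independence. The auxiliary \<open>fold\<close> starts at an arbitrary index \<open>j\<close> for
  the sake of the induction on the exponent list.\<close>

lemma Z_independent_of_hom_Zn:
  assumes P: "P \<in> hom (Zn n) G" and inj: "inj_on P (carrier (Zn n))"
  shows "Z_independent G (map (\<lambda>j. P (Zn_unit j)) [0..<n])"
proof -
  have fold: "foldr (\<lambda>(x, e) acc. (x [^] e) \<otimes> acc) (zip (map (\<lambda>j. P (Zn_unit j)) [j..<n]) es) \<one> =
     P (\<lambda>i. if j \<le> i \<and> i < n then es ! (i - j) else 0)"
    if "length es = n - j" "j \<le> n" for es :: "int list" and j
    using that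
  proof (induction es arbitrary: j)
    case Nil
    then have "(\<lambda>i. if j \<le> i \<and> i < n then [] ! (i - j) else 0) = (\<lambda>_. 0 :: int)" by auto
    then show ?case using Nil hom_Zn_zero[OF P] by simp
  next
    case (Cons x es)
    then have jn: "j < n" by auto
    have u: "Zn_unit j \<in> carrier (Zn n)" using jn by (auto simp: Zn_unit_def)
    have "foldr (\<lambda>(x, e) acc. (x [^] e) \<otimes> acc) (zip (map (\<lambda>j. P (Zn_unit j)) [j..<n]) (x # es)) \<one> =
      P (Zn_unit j) [^] x \<otimes> P (\<lambda>i. if Suc j \<le> i \<and> i < n then es ! (i - Suc j) else 0)"
      using Cons jn by (simp add: upt_conv_Cons)
    also have "\<dots> = P (\<lambda>i. x * Zn_unit j i + (if Suc j \<le> i \<and> i < n then es ! (i - Suc j) else 0))"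
      unfolding hom_Zn_scale[OF P u, symmetric]
      by (rule hom_Zn_add[OF P, symmetric]) (use jn in \<open>auto simp: Zn_unit_def\<close>)
    also have "(\<lambda>i. x * Zn_unit j i + (if Suc j \<le> i \<and> i < n then es ! (i - Suc j) else 0))
      = (\<lambda>i. if j \<le> i \<and> i < n then (x # es) ! (i - j) else 0)"
      using jn by (auto simp: Zn_unit_def fun_eq_iff nth_Cons' Suc_le_eq)
    finally show ?case .
  qed
  show ?thesis unfolding Z_independent_def
  proof (intro allI impI)
    fix es :: "int list"
    assume len: "length es = length (map (\<lambda>j. P (Zn_unit j)) [0..<n])"
      and 1: "foldr (\<lambda>(x, e) acc. (x [^] e) \<otimes> acc) (zip (map (\<lambda>j. P (Zn_unit j)) [0..<n]) es) \<one> = \<one>"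
    then have "P (\<lambda>i. if i < n then es ! i else 0) = \<one>" using fold[of es 0] by (simp only: le0 simp_thms length_map length_upt minus_nat.diff_0)
    then have "(\<lambda>i. if i < n then es ! i else 0) = (\<lambda>_. 0)"
      using inj unfolding hom_Zn_inj_iff[OF P] by simp
    then have "\<forall>i<n. es ! i = 0" by meson
    then show "\<forall>e\<in>set es. e = 0" using len by (auto simp: in_set_conv_nth)
  qed
qed

lemma finite_Q_rank_hom_bound:
  assumes H: "subgroup H G" and "finite_Q_rank G H"
  obtains B where "\<And>n P. P \<in> hom (Zn n) (G\<lparr>carrier := H\<rparr>) \<Longrightarrow> inj_on P (carrier (Zn n)) \<Longrightarrow> n \<le> B"
proof -
  obtain B where B: "\<And>xs. set xs \<subseteq> H \<Longrightarrow> Z_independent G xs \<Longrightarrow> length xs \<le> B"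
    using assms(2) unfolding finite_Q_rank_def by blast
  show ?thesis
  proof (rule that[of B])
    fix n P assume P: "P \<in> hom (Zn n) (G\<lparr>carrier := H\<rparr>)" and inj: "inj_on P (carrier (Zn n))"
    have H': "P e \<in> H" if "e \<in> carrier (Zn n)" for e using P that by (auto simp: hom_def Pi_iff)
    have "P \<in> hom (Zn n) G" using P subgroup.subset[OF H] by (auto simp: hom_def Pi_iff)
    then have "Z_independent G (map (\<lambda>j. P (Zn_unit j)) [0..<n])"
      by (rule Z_independent_of_hom_Zn[OF _ inj])
    moreover have "set (map (\<lambda>j. P (Zn_unit j)) [0..<n]) \<subseteq> H"
      by (auto intro!: H' simp: Zn_unit_def)
    ultimately show "n \<le> B" using B by fastforce
  qed
qed

end

section \<open>Isometric actions\<close>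

text \<open>The way in which lengths are exploited throughout: homogeneity makes a length grow
  linearly in \<open>n\<close>, another argument bounds it, so it vanishes.\<close>

lemma archimedean_nonpos:
  assumes "\<And>n::nat. real n * a \<le> b" shows "a \<le> 0"
proof (rule ccontr)
  assume "\<not> a \<le> 0"
  then obtain n :: nat where "b < real n * a" using reals_Archimedean3[of a] by auto
  with assms[of n] show False by simp
qed

context group
begin

lemma inv_cancel_left [simp]:
  "x \<in> carrier G \<Longrightarrow> y \<in> carrier G \<Longrightarrow> inv x \<otimes> (x \<otimes> y) = y"
  "x \<in> carrier G \<Longrightarrow> y \<in> carrier G \<Longrightarrow> x \<otimes> (inv x \<otimes> y) = y"
  by (simp_all flip: m_assoc)

definition comm :: "'a \<Rightarrow> 'a \<Rightarrow> 'a" where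
  "comm x y = x \<otimes> y \<otimes> inv x \<otimes> inv y"

lemma comm_closed [simp]: "x \<in> carrier G \<Longrightarrow> y \<in> carrier G \<Longrightarrow> comm x y \<in> carrier G"
  by (simp add: comm_def)

lemma comm_mult: "x \<in> carrier G \<Longrightarrow> y \<in> carrier G \<Longrightarrow> comm x y \<otimes> (y \<otimes> x) = x \<otimes> y"
  by (simp add: comm_def m_assoc)

lemma comm_eq_one_iff: "x \<in> carrier G \<Longrightarrow> y \<in> carrier G \<Longrightarrow> comm x y = \<one> \<longleftrightarrow> x \<otimes> y = y \<otimes> x"
  by (metis comm_closed comm_mult l_one m_closed r_cancel one_closed)

lemma inv_commute:
  "x \<in> carrier G \<Longrightarrow> y \<in> carrier G \<Longrightarrow> x \<otimes> y = y \<otimes> x \<Longrightarrow> x \<otimes> inv y = inv y \<otimes> x"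
  by (metis inv_closed inv_solve_left inv_solve_right m_assoc m_closed)

lemma mult_commute:
  assumes "x \<in> carrier G" "y \<in> carrier G" "z \<in> carrier G" "x \<otimes> y = y \<otimes> x" "x \<otimes> z = z \<otimes> x"
  shows "x \<otimes> (y \<otimes> z) = (y \<otimes> z) \<otimes> x"
  using assms by (metis m_assoc m_closed)

end

locale lattice_action = normed_lattice W L r + group G
  for W :: "'v::comm_ring_1 set" and L r and G :: "('a, 'b) monoid_scheme" (structure) +
  fixes T :: "'a \<Rightarrow> 'v \<Rightarrow> 'v"
  assumes T_add: "\<And>g u v. g \<in> carrier G \<Longrightarrow> T g (u + v) = T g u + T g v"
    and T_mult: "\<And>g h u. g \<in> carrier G \<Longrightarrow> h \<in> carrier G \<Longrightarrow> T (g \<otimes> h) u = T g (T h u)"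
    and T_one: "\<And>u. T \<one> u = u"
    and T_mem: "\<And>g u. g \<in> carrier G \<Longrightarrow> u \<in> W \<Longrightarrow> T g u \<in> W"
    and L_T: "\<And>g u. g \<in> carrier G \<Longrightarrow> u \<in> W \<Longrightarrow> L (T g u) = L u"
begin

lemma T_zero: "g \<in> carrier G \<Longrightarrow> T g 0 = 0"
  using T_add[of g 0 0] by simp

lemma T_uminus: "g \<in> carrier G \<Longrightarrow> T g (- u) = - T g u"
  using T_add[of g u "- u"] T_zero[of g] by (simp add: eq_neg_iff_add_eq_0 add.commute)

lemma T_diff: "g \<in> carrier G \<Longrightarrow> T g (u - v) = T g u - T g v"
  using T_add[of g u "- v"] by (simp add: T_uminus)

lemma T_sum: "g \<in> carrier G \<Longrightarrow> T g (sum f A) = (\<Sum>i\<in>A. T g (f i))"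
  by (induction A rule: infinite_finite_induct) (auto simp: T_zero T_add)

lemma T_scale_nat: "g \<in> carrier G \<Longrightarrow> T g (of_nat k * u) = of_nat k * T g u"
  by (induction k) (auto simp: T_zero T_add distrib_right)

lemma T_scale: "g \<in> carrier G \<Longrightarrow> T g (of_int k * u) = of_int k * T g u"
  using T_scale_nat[of g "nat \<bar>k\<bar>" u] T_uminus[of g "of_nat (nat \<bar>k\<bar>) * u"]
  by (cases "k \<ge> 0") auto

lemma T_inv: "g \<in> carrier G \<Longrightarrow> T (inv g) (T g u) = u" "g \<in> carrier G \<Longrightarrow> T g (T (inv g) u) = u"
  by (simp_all flip: T_mult add: T_one)

section \<open>Operators close to the identity\<close>

definition near :: "real \<Rightarrow> 'a \<Rightarrow> bool" where
  "near \<epsilon> g \<longleftrightarrow> g \<in> carrier G \<and> (\<forall>w\<in>W. L (T g w - w) \<le> \<epsilon> * L w)"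

text \<open>Only the operators are asked to commute. In \<open>G\<close> this means commuting up to
  the kernel of the action, which will turn out to be the Fitting subgroup.\<close>

definition commT :: "'a \<Rightarrow> 'a \<Rightarrow> bool" where
  "commT x y \<longleftrightarrow> (\<forall>w\<in>W. T x (T y w) = T y (T x w))"

lemma near_closed: "near \<epsilon> g \<Longrightarrow> g \<in> carrier G"
  by (simp add: near_def)

lemma near_inv: assumes "near \<epsilon> g" shows "near \<epsilon> (inv g)"
  unfolding near_def
proof (intro conjI ballI)
  have g: "g \<in> carrier G" using assms by (rule near_closed)
  then show "inv g \<in> carrier G" by simp
  fix w assume w: "w \<in> W"
  have u: "T (inv g) w \<in> W" using g w by (simp add: T_mem)
  have "L (T (inv g) w - w) = L (T g (T (inv g) w) - T (inv g) w)"
    using L_uminus[of "T (inv g) w - w"] u w by (simp add: T_inv g diff_mem)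
  also have "\<dots> \<le> \<epsilon> * L (T (inv g) w)" using assms u by (auto simp: near_def)
  finally show "L (T (inv g) w - w) \<le> \<epsilon> * L w" using g w by (simp add: L_T)
qed

lemma near_mult: assumes "near \<epsilon> x" "near \<delta> y" shows "near (\<epsilon> + \<delta>) (x \<otimes> y)"
  unfolding near_def
proof (intro conjI ballI)
  have xy: "x \<in> carrier G" "y \<in> carrier G" using assms near_closed by auto
  then show "x \<otimes> y \<in> carrier G" by simp
  fix w assume w: "w \<in> W"
  have u: "T y w \<in> W" using xy w by (simp add: T_mem)
  have "T (x \<otimes> y) w - w = (T x (T y w) - T y w) + (T y w - w)" using xy by (simp add: T_mult)
  also have "L \<dots> \<le> L (T x (T y w) - T y w) + L (T y w - w)"
    using u w xy by (intro L_add diff_mem T_mem) auto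
  also have "\<dots> \<le> \<epsilon> * L (T y w) + \<delta> * L w" using assms u w by (intro add_mono) (auto simp: near_def)
  finally show "L (T (x \<otimes> y) w - w) \<le> (\<epsilon> + \<delta>) * L w" using xy w by (simp add: L_T algebra_simps)
qed

lemma near_conj: assumes "near \<epsilon> x" "g \<in> carrier G" shows "near \<epsilon> (g \<otimes> x \<otimes> inv g)"
  unfolding near_def
proof (intro conjI ballI)
  have x: "x \<in> carrier G" using assms near_closed by auto
  with assms show "g \<otimes> x \<otimes> inv g \<in> carrier G" by simp
  fix w assume w: "w \<in> W"
  define u where "u = T (inv g) w"
  have u: "u \<in> W" "w = T g u" using assms w by (simp_all add: u_def T_mem T_inv)
  have "T (g \<otimes> x \<otimes> inv g) w - w = T g (T x u - u)"
    using assms x by (simp add: T_mult T_diff u_def T_inv)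
  then have "L (T (g \<otimes> x \<otimes> inv g) w - w) = L (T x u - u)"
    using assms x u by (simp add: L_T diff_mem T_mem)
  also have "\<dots> \<le> \<epsilon> * L u" using assms u by (auto simp: near_def)
  finally show "L (T (g \<otimes> x \<otimes> inv g) w - w) \<le> \<epsilon> * L w" using u assms by (simp add: L_T)
qed

text \<open>With \<open>u = (y x)^-1 w\<close> one has \<open>[x, y] w - w = (x y - y x) u\<close>.
  As operators, \<open>x y - y x = (x - 1) (y - 1) - (y - 1) (x - 1)\<close>, which has norm at most
  \<open>2 \<epsilon>^2\<close>, and this is at most \<open>\<epsilon>\<close> for
  \<open>\<epsilon> \<le> 1/2\<close>.\<close>

lemma near_comm:
  assumes "near \<epsilon> x" "near \<epsilon> y" "0 \<le> \<epsilon>" "\<epsilon> \<le> 1/2" shows "near \<epsilon> (comm x y)"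
  unfolding near_def
proof (intro conjI ballI)
  have xy: "x \<in> carrier G" "y \<in> carrier G" using assms near_closed by auto
  then show "comm x y \<in> carrier G" by simp
  fix w assume w: "w \<in> W"
  define u where "u = T (inv x) (T (inv y) w)"
  have u: "u \<in> W" "w = T y (T x u)" using xy w by (simp_all add: u_def T_mem T_inv)
  have step: "L (T g (T h u - u) - (T h u - u)) \<le> \<epsilon> * (\<epsilon> * L u)"
    if "near \<epsilon> g" "near \<epsilon> h" for g h
  proof -
    have "L (T g (T h u - u) - (T h u - u)) \<le> \<epsilon> * L (T h u - u)"
      using that u(1) by (auto simp: near_def intro!: diff_mem T_mem)
    also have "\<dots> \<le> \<epsilon> * (\<epsilon> * L u)"
      using that u(1) assms(3) by (intro mult_left_mono) (auto simp: near_def)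
    finally show ?thesis .
  qed
  have "T (comm x y) w - w = T x (T y u) - T y (T x u)"
    using xy u(2) by (simp add: comm_def T_mult T_inv)
  also have "\<dots> = (T x (T y u - u) - (T y u - u)) - (T y (T x u - u) - (T x u - u))"
    using xy by (simp add: T_diff)
  also have "L \<dots> \<le> L (T x (T y u - u) - (T y u - u)) + L (T y (T x u - u) - (T x u - u))"
    using u(1) xy by (intro L_diff diff_mem T_mem) auto
  also have "\<dots> \<le> 2 * (\<epsilon> * (\<epsilon> * L u))" using step[of x y] step[of y x] assms by simp
  also have "\<dots> \<le> \<epsilon> * L u"
    using mult_right_mono[of "2 * \<epsilon>" 1 "\<epsilon> * L u"] assms(3,4) L_nonneg[OF u(1)] by simp
  finally show "L (T (comm x y) w - w) \<le> \<epsilon> * L w" using u xy by (simp add: L_T T_mem)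
qed

text \<open>There are no small subgroups: \<open>c\<^sup>2 - 1 = (c - 1)\<^sup>2 + 2 (c - 1)\<close> expands distances from 1.\<close>

lemma near_powers_trivial:
  assumes c: "c \<in> carrier G" and near: "\<And>n::nat. near (1/2) (c [^] n)" and w: "w \<in> W"
  shows "T c w = w"
proof -
  have dbl: "3/2 * L (T g w - w) \<le> L (T (g \<otimes> g) w - w)" if g: "near (1/2) g" for g
  proof -
    have gc: "g \<in> carrier G" using g by (rule near_closed)
    define v where "v = T g w - w"
    have v: "v \<in> W" using gc w by (simp add: v_def diff_mem T_mem)
    have eq: "of_int 2 * v = (T (g \<otimes> g) w - w) - (T g v - v)"
      using gc by (simp add: v_def T_mult T_diff)
    have "2 * L v = L ((T (g \<otimes> g) w - w) - (T g v - v))"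
      using L_scale[OF v, of 2] unfolding eq by simp
    also have "\<dots> \<le> L (T (g \<otimes> g) w - w) + L (T g v - v)"
      using gc w v by (intro L_diff diff_mem T_mem) auto
    also have "L (T g v - v) \<le> 1/2 * L v" using g v by (auto simp: near_def)
    finally show ?thesis by (simp add: v_def)
  qed
  have grow: "(3/2) ^ k * L (T c w - w) \<le> L (T (c [^] (2 ^ k :: nat)) w - w)" for k
  proof (induction k)
    case (Suc k)
    have "c [^] (2 ^ Suc k :: nat) = c [^] (2 ^ k :: nat) \<otimes> c [^] (2 ^ k :: nat)"
      using c by (simp add: nat_pow_mult mult_2)
    then have "3/2 * L (T (c [^] (2 ^ k :: nat)) w - w) \<le> L (T (c [^] (2 ^ Suc k :: nat)) w - w)"
      using dbl[OF near[of "2 ^ k"]] by simp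
    with Suc show ?case by simp
  qed (use c in simp)
  have "L (T c w - w) \<le> 0"
  proof (rule archimedean_nonpos)
    fix n :: nat
    have d: "0 \<le> L (T c w - w)" using c w by (simp add: L_nonneg diff_mem T_mem)
    have "1 + real (2 * n) * (1/2) \<le> (1 + 1/2) ^ (2 * n)" by (rule Bernoulli_inequality) simp
    then have "real n \<le> (3/2) ^ (2 * n)" by simp
    then have "real n * L (T c w - w) \<le> (3/2) ^ (2 * n) * L (T c w - w)" using d by (rule mult_right_mono)
    also have "\<dots> \<le> L (T (c [^] (2 ^ (2 * n) :: nat)) w - w)" by (rule grow)
    also have "\<dots> \<le> 1/2 * L w" using near w by (auto simp: near_def)
    finally show "real n * L (T c w - w) \<le> 1/2 * L w" .
  qed
  then have "L (T c w - w) = 0" using L_nonneg[of "T c w - w"] c w by (simp add: diff_mem T_mem)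
  then show ?thesis using L_eq_0[of "T c w - w"] c w by (simp add: diff_mem T_mem)
qed

lemma commT_refl: "commT x x" by (simp add: commT_def)

lemma commT_sym: "commT x y \<Longrightarrow> commT y x" by (simp add: commT_def)

lemma commT_mult:
  "x \<in> carrier G \<Longrightarrow> y \<in> carrier G \<Longrightarrow> z \<in> carrier G \<Longrightarrow> commT x y \<Longrightarrow> commT x z \<Longrightarrow> commT x (y \<otimes> z)"
  by (auto simp: commT_def T_mult T_mem)

lemma commT_inv:
  assumes "x \<in> carrier G" "y \<in> carrier G" "commT x y" shows "commT x (inv y)"
  unfolding commT_def
proof
  fix w assume w: "w \<in> W"
  have "T x (T y (T (inv y) w)) = T y (T x (T (inv y) w))"
    using assms w by (simp add: commT_def T_mem)
  then have "T (inv y) (T x w) = T (inv y) (T y (T x (T (inv y) w)))" using assms by (simp add: T_inv)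
  then show "T x (T (inv y) w) = T (inv y) (T x w)" using assms by (simp add: T_inv)
qed

lemma commT_one: "commT x \<one>" by (simp add: commT_def T_one)

lemma commT_pow:
  "x \<in> carrier G \<Longrightarrow> y \<in> carrier G \<Longrightarrow> commT x y \<Longrightarrow> commT x (y [^] (n::nat))"
  by (induction n) (auto simp: commT_one commT_mult)

lemma commT_comm_trivial:
  assumes "x \<in> carrier G" "y \<in> carrier G" shows "commT x y \<longleftrightarrow> (\<forall>w\<in>W. T (comm x y) w = w)"
proof
  assume c: "commT x y"
  show "\<forall>w\<in>W. T (comm x y) w = w"
  proof
    fix w assume w: "w \<in> W"
    have "T (comm x y) w = T x (T y (T (inv x) (T (inv y) w)))" using assms by (simp add: comm_def T_mult)
    also have "\<dots> = T y (T x (T (inv x) (T (inv y) w)))" using c w assms by (simp add: commT_def T_mem)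
    finally show "T (comm x y) w = w" using assms by (simp add: T_inv)
  qed
next
  assume c: "\<forall>w\<in>W. T (comm x y) w = w"
  show "commT x y" unfolding commT_def
  proof
    fix w assume w: "w \<in> W"
    have "T x (T y w) = T (comm x y \<otimes> (y \<otimes> x)) w" using assms by (simp add: comm_mult T_mult)
    also have "\<dots> = T (comm x y) (T y (T x w))" using assms by (simp add: T_mult)
    also have "\<dots> = T y (T x w)" using c assms w by (simp add: T_mem)
    finally show "T x (T y w) = T y (T x w)" .
  qed
qed

text \<open>If \<open>a\<close> commutes with \<open>c = [a, b]\<close>, then \<open>c\<^sup>n = [a\<^sup>n, b]\<close> stays close to 1 together with
  \<open>b\<close>.\<close>

lemma commT_of_near:
  assumes a: "a \<in> carrier G" and b: "near (1/4) b" and ac: "commT a (comm a b)"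
  shows "commT a b"
proof -
  have bc: "b \<in> carrier G" using b by (rule near_closed)
  define c where "c = comm a b"
  have c: "c \<in> carrier G" using a bc by (simp add: c_def)
  have pow: "\<forall>w\<in>W. T (c [^] n) w = T (comm (a [^] n) b) w" for n :: nat
  proof (induction n)
    case 0
    then show ?case using bc by (simp add: comm_def)
  next
    case (Suc n)
    show ?case
    proof
      fix w assume w: "w \<in> W"
      have "comm (a [^] Suc n) b = a \<otimes> comm (a [^] n) b \<otimes> inv a \<otimes> c"
        unfolding c_def comm_def nat_pow_Suc2[OF a] using a bc by (simp add: m_assoc inv_mult_group)
      then have "T (comm (a [^] Suc n) b) w = T a (T (comm (a [^] n) b) (T (inv a) (T c w)))"
        using a bc c by (simp add: T_mult)
      also have "\<dots> = T a (T (c [^] n) (T (inv a) (T c w)))" using Suc a c w by (simp add: T_mem)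
      also have "\<dots> = T (c [^] n) (T a (T (inv a) (T c w)))"
        using commT_pow[OF a c, of n] ac a c w by (simp add: commT_def c_def T_mem)
      also have "\<dots> = T (c [^] Suc n) w" using a c by (simp add: T_inv T_mult)
      finally show "T (c [^] Suc n) w = T (comm (a [^] Suc n) b) w" by simp
    qed
  qed
  have "near (1/2) (c [^] n)" for n :: nat
  proof -
    have "near (1/4 + 1/4) (a [^] n \<otimes> b \<otimes> inv (a [^] n) \<otimes> inv b)"
      using a b by (intro near_mult near_conj near_inv) auto
    then have "near (1/2) (comm (a [^] n) b)" by (simp add: comm_def)
    then show ?thesis using pow[of n] c by (simp add: near_def)
  qed
  then have "\<forall>w\<in>W. T c w = w" using near_powers_trivial[OF c] by blast
  then show ?thesis using commT_comm_trivial[OF a bc] by (simp add: c_def)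
qed

text \<open>Descending induction along the derived series. For near \<open>x\<close>,
  \<open>y\<close> in one term, \<open>u = [x, y]\<close> and \<open>x u x^-1\<close> are near and
  lie in the next term, so by induction \<open>u\<close> commutes with \<open>x u x^-1\<close>,
  hence with \<open>[u, x]\<close>. Then \<open>commT_of_near\<close> shows first that
  \<open>u\<close> commutes with \<open>x\<close> and then that \<open>x\<close> commutes with
  \<open>y\<close>. All commutation is that of operators.\<close>

lemma near_commT_of_solvable:
  assumes sol: "(derived G ^^ n) (carrier G) = {\<one>}"
    and xy: "near (1/4) x" "near (1/4) y"
  shows "commT x y"
proof -
  let ?D = "\<lambda>i. (derived G ^^ i) (carrier G)"
  have Dsub: "?D i \<subseteq> carrier G" for i by (rule exp_of_derived_in_carrier) simp
  have Dcomm: "comm x y \<in> ?D (Suc i)" if "x \<in> ?D i" "y \<in> ?D i" for x y i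
    using that by (auto simp: derived_def comm_def intro!: generate.incl)
  have "\<forall>x y. near (1/4) x \<longrightarrow> near (1/4) y \<longrightarrow> x \<in> ?D (n - k) \<longrightarrow> y \<in> ?D (n - k) \<longrightarrow> commT x y"
    if "k \<le> n" for k
    using that
  proof (induction k)
    case 0
    then show ?case using sol by (auto simp: commT_one)
  next
    case (Suc k)
    then have k: "n - k = Suc (n - Suc k)" by simp
    show ?case
    proof (intro allI impI)
      fix x y assume x: "near (1/4) x" "x \<in> ?D (n - Suc k)" and y: "near (1/4) y" "y \<in> ?D (n - Suc k)"
      have c: "x \<in> carrier G" "y \<in> carrier G" using x y near_closed by auto
      define u where "u = comm x y"
      have uc: "u \<in> carrier G" using c by (simp add: u_def)
      have u1: "near (1/4) u" unfolding u_def using near_comm[OF x(1) y(1)] by simp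
      have u2: "u \<in> ?D (n - k)" unfolding k u_def by (rule Dcomm) (use x y in auto)
      have cj: "near (1/4) (x \<otimes> u \<otimes> inv x)" by (rule near_conj[OF u1 c(1)])
      have "comm x u \<in> ?D (n - k)"
      proof -
        have "?D (n - k) \<subseteq> ?D (n - Suc k)" unfolding k
          using derived_incl[OF _ exp_of_derived_is_subgroup[OF subgroup_self, of "n - Suc k"]] by simp
        with u2 have "u \<in> ?D (n - Suc k)" by auto
        then show ?thesis unfolding k by (intro Dcomm x)
      qed
      then have "comm x u \<otimes> u \<in> ?D (n - k)"
        using u2 subgroup.m_closed[OF exp_of_derived_is_subgroup[OF subgroup_self, of "n - k"]] by blast
      moreover have "comm x u \<otimes> u = x \<otimes> u \<otimes> inv x" using c uc by (simp add: comm_def m_assoc)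
      ultimately have "commT u (x \<otimes> u \<otimes> inv x)" using Suc u1 u2 cj by simp
      then have "commT u (u \<otimes> inv (x \<otimes> u \<otimes> inv x))"
        using c uc by (intro commT_mult[OF uc uc _ commT_refl] commT_inv[OF uc]) auto
      moreover have "u \<otimes> inv (x \<otimes> u \<otimes> inv x) = comm u x" using c uc by (simp add: comm_def m_assoc inv_mult_group)
      ultimately have "commT u x" using commT_of_near[OF uc x(1)] by simp
      then have "commT x (comm x y)" by (simp add: commT_sym u_def)
      then show "commT x y" by (rule commT_of_near[OF c(1) y(1)])
    qed
  qed
  from this[of n] xy show ?thesis using near_closed by auto
qed

lemma commT_generate:
  assumes "S \<subseteq> carrier G" "\<And>x y. x \<in> S \<Longrightarrow> y \<in> S \<Longrightarrow> commT x y"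
    and "x \<in> generate G S" "y \<in> generate G S"
  shows "commT x y"
proof -
  have 1: "commT x y" if "x \<in> S" "y \<in> generate G S" for x y
    using that(2)
  proof (induction rule: generate.induct)
    case (eng h1 h2)
    then show ?case using that assms(1) generate_in_carrier[OF assms(1)] by (intro commT_mult) auto
  qed (use that assms in \<open>auto simp: commT_one intro!: commT_inv\<close>)
  have "commT y x"
    using assms(3)
  proof (induction rule: generate.induct)
    case (eng h1 h2)
    then show ?case using assms generate_in_carrier[OF assms(1)] by (intro commT_mult) auto
  next
    case (inv h)
    then show ?case using 1[OF inv assms(4)] assms generate_in_carrier[OF assms(1)]
      by (intro commT_inv) (auto simp: commT_sym)
  qed (use 1[OF _ assms(4)] in \<open>auto simp: commT_one commT_sym\<close>)
  then show ?thesis by (rule commT_sym)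
qed

end

section \<open>Total boundedness and averages\<close>

context lattice_action
begin

text \<open>An element is coded by the rounded rational coordinates of approximations to the vectors
  \<open>T g (x i)\<close>. Isometry bounds these coordinates, so only finitely many codes occur.
  Two elements with equal code differ little on each \<open>x i\<close>, hence on all of
  \<open>W\<close> by a second use of the approximation property.\<close>

lemma near_cover:
  assumes "\<epsilon> > 0"
  shows "\<exists>R. finite R \<and> R \<subseteq> carrier G \<and> (\<forall>g\<in>carrier G. \<exists>t\<in>R. near \<epsilon> (g \<otimes> inv t))"
proof -
  obtain n :: nat and x \<kappa> where \<kappa>: "\<kappa> > 0" and x: "\<And>i. i < n \<Longrightarrow> x i \<in> W"
    and app: "\<And>w \<theta>. w \<in> W \<Longrightarrow> \<theta> > 0 \<Longrightarrow> \<exists>m k. m > 0 \<and>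
       L (of_int m * w - (\<Sum>i<n. of_int (k i) * x i)) \<le> \<theta> * real_of_int m \<and>
       (\<Sum>i<n. \<bar>real_of_int (k i)\<bar>) \<le> (2 / \<kappa>) * (L w + \<theta>) * real_of_int m"
    by (rule approximation) blast
  define M where "M = (\<Sum>j<n. L (x j))"
  have M: "M \<ge> 0" unfolding M_def using x by (intro sum_nonneg L_nonneg) auto
  have LxM: "L (x i) \<le> M" if "i < n" for i
    unfolding M_def using that x by (intro member_le_sum) (auto intro: L_nonneg)
  \<comment> \<open>The closeness needed on the \<open>x i\<close>: a combination approximating
    \<open>w\<close> has coefficient sum about \<open>(2 / \<kappa>) * L w\<close>, so an error
    \<open>e\<close> on each \<open>x i\<close> becomes \<open>\<epsilon> * L w\<close>. Half of
    \<open>e\<close> is spent on the errors \<open>\<theta> = e / 4\<close> for \<open>g\<close> and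
    for \<open>t\<close>, the other half on rounding with step \<open>d\<close>. The summand 1 in
    the denominator of \<open>d\<close> covers \<open>M = 0\<close>.\<close>
  define e where "e = \<epsilon> * \<kappa> / 2"
  have e: "e > 0" using assms \<kappa> by (simp add: e_def)
  define \<theta> where "\<theta> = e / 4"
  have \<theta>: "\<theta> > 0" using e by (simp add: \<theta>_def)
  define d where "d = e / (2 * (1 + M))"
  have d: "d > 0" using e M by (simp add: d_def)
  have dM: "d * M \<le> e / 2" using e M by (simp add: d_def field_simps)
  define Q where "Q g i m k \<longleftrightarrow> (m::int) > 0 \<and>
       L (of_int m * T g (x i) - (\<Sum>j<n. of_int (k j) * x j)) \<le> \<theta> * real_of_int m \<and>
       (\<Sum>j<n. \<bar>real_of_int (k j)\<bar>) \<le> (2 / \<kappa>) * (L (T g (x i)) + \<theta>) * real_of_int m" for g i m k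
  have "\<exists>m k. Q g i m k" if "g \<in> carrier G" "i < n" for g i
    unfolding Q_def using app[OF T_mem \<theta>] x that by blast
  then obtain m :: "'a \<Rightarrow> nat \<Rightarrow> int" and k :: "'a \<Rightarrow> nat \<Rightarrow> nat \<Rightarrow> int" where
    Q: "\<And>g i. g \<in> carrier G \<Longrightarrow> i < n \<Longrightarrow> Q g i (m g i) (k g i)"
    by metis
  note mk = Q[unfolded Q_def]
  define q where "q g i j = real_of_int (k g i j) / real_of_int (m g i)" for g i j
  define B where "B = (2 / \<kappa>) * (M + \<theta>)"
  have qB: "\<bar>q g i j\<bar> \<le> B" if g: "g \<in> carrier G" and i: "i < n" and j: "j < n" for g i j
  proof -
    have m: "real_of_int (m g i) > 0" using mk[OF g i] by simp
    have "\<bar>real_of_int (k g i j)\<bar> \<le> (\<Sum>j<n. \<bar>real_of_int (k g i j)\<bar>)"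
      using j by (intro member_le_sum) auto
    also have "\<dots> \<le> (2 / \<kappa>) * (L (T g (x i)) + \<theta>) * real_of_int (m g i)" using mk[OF g i] by blast
    also have "\<dots> \<le> B * real_of_int (m g i)" unfolding B_def
      using m \<kappa> LxM[OF i] L_T[OF g x[OF i]] by (intro mult_right_mono mult_left_mono) auto
    finally show ?thesis using m by (simp add: q_def abs_divide pos_divide_le_eq)
  qed
  define code where "code g = restrict (\<lambda>(i, j). \<lfloor>q g i j / d\<rfloor>) ({..<n} \<times> {..<n})" for g
  have "code ` carrier G \<subseteq> PiE ({..<n} \<times> {..<n}) (\<lambda>_. {\<lfloor>- B / d\<rfloor>..\<lfloor>B / d\<rfloor>})"
  proof (intro image_subsetI PiE_I)
    fix g ij assume g: "g \<in> carrier G" and ij: "ij \<in> {..<n} \<times> {..<n}"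
    then obtain i j where 1: "ij = (i, j)" "i < n" "j < n" by auto
    have "- B \<le> q g i j" "q g i j \<le> B" using qB[OF g 1(2,3)] by (simp_all add: abs_le_iff)
    then have "- B / d \<le> q g i j / d" "q g i j / d \<le> B / d" using d by (intro divide_right_mono; simp)+
    then show "code g ij \<in> {\<lfloor>- B / d\<rfloor>..\<lfloor>B / d\<rfloor>}" using 1 by (auto simp: code_def intro!: floor_mono)
  qed (auto simp: code_def)
  then have "finite (code ` carrier G)" by (rule finite_subset) (intro finite_PiE; auto)
  then obtain R where R: "R \<subseteq> carrier G" "finite R" "code ` carrier G = code ` R"
    using finite_subset_image[of "code ` carrier G" code "carrier G"] by blast
  have "near \<epsilon> (g \<otimes> inv t)" if g: "g \<in> carrier G" and t: "t \<in> carrier G" and code: "code g = code t" for g t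
  proof -
    define \<phi> where "\<phi> w = T g w - T t w" for w
    have \<phi>W: "\<phi> w \<in> W" if "w \<in> W" for w using that g t by (simp add: \<phi>_def diff_mem T_mem)
    have small: "L (\<phi> (x i)) \<le> e" if i: "i < n" for i
    proof -
      define a where "a = m g i"
      define b where "b = m t i"
      have ab: "a > 0" "b > 0" using mk g t i by (auto simp: a_def b_def)
      define Y where "Y = (\<lambda>c. \<Sum>j<n. of_int (c j) * x j)"
      have YW: "Y c \<in> W" for c unfolding Y_def using x by (intro sum_mem scale_mem) auto
      define y where "y = of_int a * T g (x i) - Y (k g i)"
      define z where "z = of_int b * T t (x i) - Y (k t i)"
      have y: "L y \<le> \<theta> * a" "y \<in> W" and z: "L z \<le> \<theta> * b" "z \<in> W"
        using mk[OF g i] mk[OF t i] x[OF i] g t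
        by (auto simp: y_def z_def a_def b_def Y_def intro!: diff_mem scale_mem T_mem sum_mem x)
      have co: "real_of_int \<bar>b * k g i j - a * k t i j\<bar> \<le> a * b * d" if j: "j < n" for j
      proof -
        have "code g (i, j) = code t (i, j)" using code by simp
        then have "\<lfloor>q g i j / d\<rfloor> = \<lfloor>q t i j / d\<rfloor>" using i j by (simp add: code_def)
        then have "\<bar>q g i j / d - q t i j / d\<bar> \<le> 1" by linarith
        then have "\<bar>q g i j - q t i j\<bar> \<le> d" using d by (simp add: field_simps abs_le_iff flip: diff_divide_distrib)
        then have "(a * b) * \<bar>q g i j - q t i j\<bar> \<le> (a * b) * d" using ab by (intro mult_left_mono) auto
        moreover have "real_of_int (b * k g i j - a * k t i j) = (a * b) * (q g i j - q t i j)"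
          using ab by (simp add: q_def a_def b_def field_simps)
        ultimately show ?thesis using ab by (simp add: abs_mult del: of_int_diff of_int_mult)
      qed
      have "of_int (a * b) * \<phi> (x i)
          = (of_int b * y - of_int a * z) + (\<Sum>j<n. of_int (b * k g i j - a * k t i j) * x j)"
        by (simp add: \<phi>_def y_def z_def Y_def algebra_simps sum_subtractf sum_distrib_left)
      then have "real_of_int (a * b) * L (\<phi> (x i)) =
          L ((of_int b * y - of_int a * z) + (\<Sum>j<n. of_int (b * k g i j - a * k t i j) * x j))"
        using L_scale[OF \<phi>W[OF x[OF i]], of "a * b"] ab by (simp add: abs_mult)
      also have "\<dots> \<le> L (of_int b * y - of_int a * z) + L (\<Sum>j<n. of_int (b * k g i j - a * k t i j) * x j)"
        by (intro L_add diff_mem scale_mem sum_mem y z x) auto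
      also have "L (of_int b * y - of_int a * z) \<le> L (of_int b * y) + L (of_int a * z)"
        by (intro L_diff scale_mem y z)
      also have "\<dots> = b * L y + a * L z" using ab by (simp add: L_scale y z)
      also have "\<dots> \<le> b * (\<theta> * a) + a * (\<theta> * b)" using ab y z by (intro add_mono mult_left_mono) auto
      also have "L (\<Sum>j<n. of_int (b * k g i j - a * k t i j) * x j)
          \<le> (\<Sum>j<n. L (of_int (b * k g i j - a * k t i j) * x j))"
        by (intro L_sum scale_mem x) auto
      also have "\<dots> = (\<Sum>j<n. real_of_int \<bar>b * k g i j - a * k t i j\<bar> * L (x j))"
        by (intro sum.cong refl) (simp only: L_scale x lessThan_iff of_int_abs)
      also have "\<dots> \<le> (\<Sum>j<n. (a * b * d) * L (x j))"
        by (intro sum_mono mult_right_mono co L_nonneg x) simp_all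
      also have "\<dots> = (a * b) * (d * M)" by (simp add: M_def sum_distrib_left mult.assoc)
      also have "\<dots> \<le> (a * b) * (e / 2)" using dM ab by (intro mult_left_mono) auto
      finally have "real_of_int (a * b) * L (\<phi> (x i)) \<le> real_of_int (a * b) * e"
        by (simp add: \<theta>_def field_simps)
      then show ?thesis using ab by (simp add: mult_le_cancel_left_pos del: of_int_mult)
    qed
    have \<phi>_bound: "L (\<phi> w) \<le> \<epsilon> * L w" if w: "w \<in> W" for w
    proof (rule field_le_epsilon)
      fix \<delta> :: real assume "\<delta> > 0"
      \<comment> \<open>The excess over \<open>\<epsilon> * L w\<close> is \<open>2 * \<eta>\<close>
        from the two images of the remainder \<open>y\<close>, and
        \<open>\<epsilon> * \<eta>\<close> from the coefficient sum.\<close>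
      define \<eta> where "\<eta> = \<delta> / (2 + \<epsilon>)"
      have \<eta>: "\<eta> > 0" using \<open>\<delta> > 0\<close> assms by (simp add: \<eta>_def)
      obtain a c where ac: "a > 0" "L (of_int a * w - (\<Sum>i<n. of_int (c i) * x i)) \<le> \<eta> * real_of_int a"
        "(\<Sum>i<n. \<bar>real_of_int (c i)\<bar>) \<le> (2 / \<kappa>) * (L w + \<eta>) * real_of_int a"
        using app[OF w \<eta>] by blast
      define y where "y = of_int a * w - (\<Sum>i<n. of_int (c i) * x i)"
      have y: "y \<in> W" unfolding y_def by (intro diff_mem scale_mem sum_mem w x) auto
      have "of_int a * \<phi> w = (T g y - T t y) + (\<Sum>i<n. of_int (c i) * \<phi> (x i))"
        by (simp only: y_def \<phi>_def T_diff T_sum T_scale right_diff_distrib sum_subtractf g t)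
          (simp add: algebra_simps)
      then have "a * L (\<phi> w) = L ((T g y - T t y) + (\<Sum>i<n. of_int (c i) * \<phi> (x i)))"
        using L_scale[OF \<phi>W[OF w], of a] ac(1) by simp
      also have "\<dots> \<le> L (T g y - T t y) + L (\<Sum>i<n. of_int (c i) * \<phi> (x i))"
        using g t y by (intro L_add diff_mem T_mem sum_mem scale_mem \<phi>W x) auto
      also have "L (T g y - T t y) \<le> L (T g y) + L (T t y)" using g t y by (intro L_diff T_mem) auto
      also have "\<dots> \<le> 2 * (\<eta> * a)" using g t y ac(2) by (simp add: L_T y_def[symmetric])
      also have "L (\<Sum>i<n. of_int (c i) * \<phi> (x i)) \<le> (\<Sum>i<n. L (of_int (c i) * \<phi> (x i)))"
        by (intro L_sum scale_mem \<phi>W x) auto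
      also have "\<dots> = (\<Sum>i<n. \<bar>real_of_int (c i)\<bar> * L (\<phi> (x i)))"
        by (intro sum.cong) (auto simp: L_scale \<phi>W x)
      also have "\<dots> \<le> (\<Sum>i<n. \<bar>real_of_int (c i)\<bar> * e)"
        by (intro sum_mono mult_left_mono small) auto
      also have "\<dots> = e * (\<Sum>i<n. \<bar>real_of_int (c i)\<bar>)" by (simp add: sum_distrib_left mult.commute)
      also have "\<dots> \<le> e * ((2 / \<kappa>) * (L w + \<eta>) * a)" using ac(3) e by (intro mult_left_mono) auto
      also have "\<dots> = \<epsilon> * (L w + \<eta>) * a" using \<kappa> by (simp add: e_def)
      finally have "a * L (\<phi> w) \<le> a * (\<epsilon> * L w + \<eta> * (2 + \<epsilon>))" by (simp add: algebra_simps)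
      then have "L (\<phi> w) \<le> \<epsilon> * L w + \<eta> * (2 + \<epsilon>)" using ac(1) by simp
      then show "L (\<phi> w) \<le> \<epsilon> * L w + \<delta>" using assms by (simp add: \<eta>_def)
    qed
    show ?thesis unfolding near_def
    proof (intro conjI ballI)
      show "g \<otimes> inv t \<in> carrier G" using g t by simp
      fix w assume w: "w \<in> W"
      have "T (g \<otimes> inv t) w - w = \<phi> (T (inv t) w)" using g t by (simp add: \<phi>_def T_mult T_inv)
      then show "L (T (g \<otimes> inv t) w - w) \<le> \<epsilon> * L w"
        using \<phi>_bound[of "T (inv t) w"] t w by (simp add: T_mem L_T)
    qed
  qed
  moreover have "\<exists>t\<in>R. code g = code t" if "g \<in> carrier G" for g
    using R(3) that by (metis image_iff)
  ultimately show ?thesis using R(1,2) by (intro exI[of _ R]) (meson subset_iff)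
qed

lemma cofinite_near:
  assumes "\<epsilon> > 0"
  shows "cofinite_in G (carrier G) (generate G {g. near \<epsilon> g})"
proof -
  obtain R where R: "finite R" "R \<subseteq> carrier G" "\<forall>g\<in>carrier G. \<exists>t\<in>R. near \<epsilon> (g \<otimes> inv t)"
    using near_cover[OF assms] by blast
  have "carrier G \<subseteq> (\<Union>t\<in>R. generate G {g. near \<epsilon> g} #> t)"
  proof
    fix g assume g: "g \<in> carrier G"
    then obtain t where t: "t \<in> R" "near \<epsilon> (g \<otimes> inv t)" using R by blast
    have "g \<otimes> inv t \<in> generate G {g. near \<epsilon> g}" using t by (intro generate.incl) simp
    moreover have "g = (g \<otimes> inv t) \<otimes> t" using g t R by (auto simp: m_assoc)
    ultimately show "g \<in> (\<Union>t\<in>R. generate G {g. near \<epsilon> g} #> t)" using t(1) unfolding r_coset_def by blast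
  qed
  with R show ?thesis unfolding cofinite_in_def by blast
qed

end

section \<open>Averages over a commuting family of isometries\<close>

locale commuting_lattice_action = lattice_action +
  fixes K
  assumes K: "subgroup K G" and commT_K: "\<And>x y. x \<in> K \<Longrightarrow> y \<in> K \<Longrightarrow> commT x y"
begin

lemma K_carrier: "x \<in> K \<Longrightarrow> x \<in> carrier G"
  using subgroup.mem_carrier[OF K] .

lemma K_pow: "x \<in> K \<Longrightarrow> x [^] (n::nat) \<in> K"
  by (induction n) (auto intro: subgroup.one_closed[OF K] subgroup.m_closed[OF K])

text \<open>A list allows repetitions: \<open>qs\<close> stands for an element of the monoid ring of
  \<open>K\<close> over the naturals, with its length as augmentation. Composing two averages
  therefore gives an average again, with the lengths multiplied.\<close>

definition orbit_sum :: "'b list \<Rightarrow> 'a \<Rightarrow> 'a" where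
  "orbit_sum qs v = (\<Sum>q\<leftarrow>qs. T q v)"

text \<open>Mean ergodic substitute: some averages of the orbit of a null vector tend to 0.\<close>

definition null :: "'a \<Rightarrow> bool" where
  "null v \<longleftrightarrow> v \<in> W \<and> (\<forall>\<eta>>0::real. \<exists>qs. qs \<noteq> [] \<and> set qs \<subseteq> K \<and> L (orbit_sum qs v) \<le> \<eta> * length qs)"

lemma orbit_sum_simps [simp]: "orbit_sum [] v = 0" "orbit_sum (q # qs) v = T q v + orbit_sum qs v"
  by (simp_all add: orbit_sum_def)

lemma orbit_sum_append: "orbit_sum (ps @ qs) v = orbit_sum ps v + orbit_sum qs v"
  by (simp add: orbit_sum_def)

lemma orbit_sum_mem: "set qs \<subseteq> K \<Longrightarrow> v \<in> W \<Longrightarrow> orbit_sum qs v \<in> W"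
  by (induction qs) (auto simp: zero_mem intro!: add_mem T_mem K_carrier)

lemma orbit_sum_add: "set qs \<subseteq> K \<Longrightarrow> orbit_sum qs (u + v) = orbit_sum qs u + orbit_sum qs v"
  by (induction qs) (auto simp: T_add K_carrier algebra_simps)

lemma orbit_sum_scale: "set qs \<subseteq> K \<Longrightarrow> orbit_sum qs (of_int k * v) = of_int k * orbit_sum qs v"
  by (induction qs) (auto simp: T_scale K_carrier distrib_left)

lemma L_orbit_sum: "set qs \<subseteq> K \<Longrightarrow> v \<in> W \<Longrightarrow> L (orbit_sum qs v) \<le> length qs * L v"
proof (induction qs)
  case (Cons q qs)
  then have "L (T q v + orbit_sum qs v) \<le> L (T q v) + L (orbit_sum qs v)"
    by (intro L_add T_mem orbit_sum_mem K_carrier) auto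
  with Cons show ?case by (simp add: L_T K_carrier algebra_simps)
qed (simp add: L_zero)

lemma T_orbit_sum: "p \<in> K \<Longrightarrow> set qs \<subseteq> K \<Longrightarrow> T p (orbit_sum qs v) = orbit_sum (map ((\<otimes>) p) qs) v"
  by (induction qs) (auto simp: T_zero T_add T_mult K_carrier)

lemma T_orbit_sum_commute:
  "p \<in> K \<Longrightarrow> set qs \<subseteq> K \<Longrightarrow> v \<in> W \<Longrightarrow> T p (orbit_sum qs v) = orbit_sum qs (T p v)"
  using commT_K by (induction qs) (auto simp: T_zero T_add K_carrier commT_def)

lemma orbit_sum_commute:
  "set ps \<subseteq> K \<Longrightarrow> set qs \<subseteq> K \<Longrightarrow> v \<in> W \<Longrightarrow> orbit_sum ps (orbit_sum qs v) = orbit_sum qs (orbit_sum ps v)"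
proof (induction ps)
  case Nil
  have "orbit_sum qs 0 = 0" using orbit_sum_scale[OF Nil(2), of 0 0] by simp
  then show ?case by simp
qed (auto simp: orbit_sum_add T_orbit_sum_commute)

lemma orbit_sum_compose:
  assumes "set ps \<subseteq> K" "set qs \<subseteq> K"
  obtains rs where "set rs \<subseteq> K" "length rs = length ps * length qs"
    "\<And>v. orbit_sum rs v = orbit_sum ps (orbit_sum qs v)"
proof -
  have "\<exists>rs. set rs \<subseteq> K \<and> length rs = length ps * length qs \<and>
    (\<forall>v. orbit_sum rs v = orbit_sum ps (orbit_sum qs v))"
    using assms(1)
  proof (induction ps)
    case (Cons p ps)
    then obtain rs where rs: "set rs \<subseteq> K" "length rs = length ps * length qs"
      "\<forall>v. orbit_sum rs v = orbit_sum ps (orbit_sum qs v)" by auto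
    then show ?case using Cons.prems assms(2)
      by (intro exI[of _ "map ((\<otimes>) p) qs @ rs"])
         (auto simp: orbit_sum_append T_orbit_sum intro: subgroup.m_closed[OF K])
  qed simp
  then show ?thesis using that by blast
qed

lemma null_mem: "null v \<Longrightarrow> v \<in> W"
  by (simp add: null_def)

lemma nullD: "null v \<Longrightarrow> \<eta> > (0::real) \<Longrightarrow> \<exists>qs. qs \<noteq> [] \<and> set qs \<subseteq> K \<and> L (orbit_sum qs v) \<le> \<eta> * length qs"
  by (simp add: null_def)

text \<open>An average good for \<open>u\<close> is composed with one good for \<open>v\<close>.
  Averaging does not increase \<open>L\<close>, and as the operators commute either average may be
  applied first, so the composition is good for both.\<close>

lemma null_add: assumes u: "null u" and v: "null v" shows "null (u + v)"
  unfolding null_def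
proof (intro conjI allI impI)
  have uW: "u \<in> W" and vW: "v \<in> W" using u v null_mem by auto
  then show "u + v \<in> W" by (rule add_mem)
  fix \<eta> :: real assume "\<eta> > 0"
  then have \<eta>: "\<eta> / 2 > 0" by simp
  obtain qs where qs: "qs \<noteq> []" "set qs \<subseteq> K" "L (orbit_sum qs u) \<le> \<eta> / 2 * length qs"
    using nullD[OF u \<eta>] by blast
  obtain ps where ps: "ps \<noteq> []" "set ps \<subseteq> K" "L (orbit_sum ps v) \<le> \<eta> / 2 * length ps"
    using nullD[OF v \<eta>] by blast
  obtain rs where rs: "set rs \<subseteq> K" "length rs = length ps * length qs"
    "\<And>v. orbit_sum rs v = orbit_sum ps (orbit_sum qs v)"
    using orbit_sum_compose[OF ps(2) qs(2)] by blast
  have "L (orbit_sum rs (u + v)) \<le> L (orbit_sum rs u) + L (orbit_sum rs v)"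
    unfolding orbit_sum_add[OF rs(1)] by (intro L_add orbit_sum_mem rs uW vW)
  also have "L (orbit_sum rs u) \<le> length ps * L (orbit_sum qs u)"
    unfolding rs(3) by (intro L_orbit_sum orbit_sum_mem ps qs uW)
  also have "\<dots> \<le> length ps * (\<eta> / 2 * length qs)" using qs(3) by (intro mult_left_mono) auto
  also have "L (orbit_sum rs v) \<le> length qs * L (orbit_sum ps v)"
    unfolding rs(3) orbit_sum_commute[OF ps(2) qs(2) vW] by (intro L_orbit_sum orbit_sum_mem ps qs vW)
  also have "\<dots> \<le> length qs * (\<eta> / 2 * length ps)" using ps(3) by (intro mult_left_mono) auto
  finally have "L (orbit_sum rs (u + v)) \<le> \<eta> * length rs" by (simp add: rs(2) algebra_simps)
  moreover have "rs \<noteq> []" using rs(2) ps(1) qs(1) by auto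
  ultimately show "\<exists>qs. qs \<noteq> [] \<and> set qs \<subseteq> K \<and> L (orbit_sum qs (u + v)) \<le> \<eta> * length qs"
    using rs(1) by blast
qed

lemma null_uminus: assumes "null v" shows "null (- v)"
proof -
  have "L (orbit_sum qs (- v)) = L (orbit_sum qs v)" if "set qs \<subseteq> K" for qs
    using orbit_sum_scale[OF that, of "-1" v] L_uminus[OF orbit_sum_mem[OF that null_mem[OF assms]]] by simp
  moreover have "- v \<in> W" using null_mem[OF assms] by (rule uminus_mem)
  ultimately show ?thesis using nullD[OF assms] unfolding null_def by metis
qed

lemma null_diff: "null u \<Longrightarrow> null v \<Longrightarrow> null (u - v)"
  using null_add[of u "- v"] null_uminus[of v] by simp

lemma null_scale_cancel:
  assumes "v \<in> W" "k \<noteq> 0" "null (of_int k * v)" shows "null v"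
  unfolding null_def
proof (intro conjI allI impI)
  fix \<eta> :: real assume "\<eta> > 0"
  then have k\<eta>: "\<bar>real_of_int k\<bar> * \<eta> > 0" using assms(2) by simp
  obtain qs where qs: "qs \<noteq> []" "set qs \<subseteq> K"
    "L (orbit_sum qs (of_int k * v)) \<le> (\<bar>real_of_int k\<bar> * \<eta>) * length qs"
    using nullD[OF assms(3) k\<eta>] by blast
  then have "\<bar>real_of_int k\<bar> * L (orbit_sum qs v) \<le> \<bar>real_of_int k\<bar> * (\<eta> * length qs)"
    using assms(1) by (simp add: orbit_sum_scale L_scale orbit_sum_mem mult.assoc)
  then have "L (orbit_sum qs v) \<le> \<eta> * length qs" using assms(2) by (simp add: mult_le_cancel_left)
  with qs show "\<exists>qs. qs \<noteq> [] \<and> set qs \<subseteq> K \<and> L (orbit_sum qs v) \<le> \<eta> * length qs" by blast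
qed (rule assms)

text \<open>Averaging over \<open>n + 1\<close> successive powers of \<open>g\<close> divides a
  bounded sum by \<open>n + 1\<close>; starting from \<open>Suc n\<close> terms keeps the list
  nonempty.\<close>

lemma null_of_bounded:
  assumes g: "g \<in> K" and v: "v \<in> W" and bd: "\<And>n::nat. L (\<Sum>i<n. T (g [^] i) v) \<le> C"
  shows "null v"
  unfolding null_def
proof (intro conjI allI impI)
  fix \<eta> :: real assume "\<eta> > 0"
  then obtain n :: nat where n: "C < real n * \<eta>" using reals_Archimedean3 by blast
  define qs where "qs = map (\<lambda>i::nat. g [^] i) [0..<Suc n]"
  have "orbit_sum qs v = (\<Sum>i<Suc n. T (g [^] i) v)"
    by (simp add: qs_def orbit_sum_def comp_def interv_sum_list_conv_sum_set_nat atLeast0LessThan del: upt_Suc sum.lessThan_Suc)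
  then have "L (orbit_sum qs v) \<le> C" using bd[of "Suc n"] by simp
  also have "\<dots> \<le> \<eta> * length qs" using n \<open>\<eta> > 0\<close> by (simp add: qs_def algebra_simps)
  finally show "\<exists>qs. qs \<noteq> [] \<and> set qs \<subseteq> K \<and> L (orbit_sum qs v) \<le> \<eta> * length qs"
    using K_pow[OF g] by (intro exI[of _ qs]) (auto simp: qs_def)
qed (rule v)

lemma telescope: "g \<in> K \<Longrightarrow> (\<Sum>i<n. T (g [^] (i::nat)) (T g w - w)) = T (g [^] n) w - w"
  by (induction n) (auto simp: T_one T_diff T_mult K_carrier)

text \<open>The sums over powers of \<open>g\<close> telescope to a difference of two vectors of
  length \<open>L w\<close>.\<close>

lemma null_move: assumes g: "g \<in> K" and w: "w \<in> W" shows "null (T g w - w)"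
proof (rule null_of_bounded[OF g])
  show "T g w - w \<in> W" using g w by (intro diff_mem T_mem K_carrier)
  fix n :: nat
  have "L (T (g [^] n) w - w) \<le> L (T (g [^] n) w) + L w" using g w by (intro L_diff T_mem nat_pow_closed K_carrier)
  also have "\<dots> = 2 * L w" using g w by (simp add: L_T K_carrier)
  finally show "L (\<Sum>i<n. T (g [^] i) (T g w - w)) \<le> 2 * L w" by (simp add: telescope[OF g])
qed

lemma null_zero: "null 0"
  using null_move[OF subgroup.one_closed[OF K] zero_mem] by (simp add: T_one)

lemma null_sum: "(\<And>i. i \<in> A \<Longrightarrow> null (f i)) \<Longrightarrow> null (sum f A)"
  by (induction A rule: infinite_finite_induct) (auto simp: null_zero null_add)

lemma null_fixed: assumes z: "null z" and fixed: "\<And>q. q \<in> K \<Longrightarrow> T q z = z" shows "z = 0"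
proof -
  have zW: "z \<in> W" using z by (rule null_mem)
  have "L z \<le> 0 + \<eta>" if \<eta>: "\<eta> > 0" for \<eta>
  proof -
    obtain qs where qs: "qs \<noteq> []" "set qs \<subseteq> K" "L (orbit_sum qs z) \<le> \<eta> * length qs"
      using nullD[OF z \<eta>] by blast
    have "orbit_sum qs z = of_int (int (length qs)) * z" using qs(2)
      by (induction qs) (auto simp: fixed algebra_simps)
    then have "real (length qs) * L z \<le> real (length qs) * \<eta>" using qs(3) L_scale[OF zW, of "int (length qs)"]
      by (simp add: mult.commute)
    then show ?thesis using qs(1) by (simp add: mult_le_cancel_left)
  qed
  then have "L z \<le> 0" by (rule field_le_epsilon)
  then have "L z = 0" using L_nonneg[OF zW] by simp
  then show ?thesis using L_eq_0[OF zW] by simp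
qed

text \<open>Over \<open>\<rat>\<close> the isometry \<open>h\<close> acts semisimply: kernel and image of \<open>h - 1\<close> are complementary.\<close>

lemma kernel_image_decomposition:
  assumes h: "h \<in> K" and v: "v \<in> W"
  defines "\<phi> \<equiv> \<lambda>u. T h u - u"
  obtains m w where "(m::nat) > 0" "w \<in> W" "\<phi> (of_nat m * v) = \<phi> (\<phi> w)"
proof -
  have hc: "h \<in> carrier G" using h by (rule K_carrier)
  have \<phi>W: "\<phi> u \<in> W" if "u \<in> W" for u using hc that by (simp add: \<phi>_def diff_mem T_mem)
  have \<phi>_add: "\<phi> (u + u') = \<phi> u + \<phi> u'" for u u' using hc by (simp add: \<phi>_def T_add)
  have \<phi>_scale: "\<phi> (of_int k * u) = of_int k * \<phi> u" for k u
    using hc by (simp add: \<phi>_def T_scale right_diff_distrib)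
  have \<phi>_uminus: "\<phi> (- u) = - \<phi> u" for u using hc by (simp add: \<phi>_def T_uminus)
  have \<phi>0: "\<phi> 0 = 0" using hc by (simp add: \<phi>_def T_zero)
  have \<phi>_sum: "\<phi> (sum f A) = (\<Sum>i\<in>A. \<phi> (f i))" for f :: "nat \<Rightarrow> 'a" and A
    by (induction A rule: infinite_finite_induct) (auto simp: \<phi>0 \<phi>_add)
  \<comment> \<open>No Jordan blocks: here \<open>h^n u = u + n \<phi> u\<close>, and this stays
    bounded in \<open>n\<close> only if \<open>\<phi> u = 0\<close>.\<close>
  have ss: "\<phi> u = 0" if u: "u \<in> W" "\<phi> (\<phi> u) = 0" for u
  proof -
    have fixed: "T h (\<phi> u) = \<phi> u" using u(2) by (simp add: \<phi>_def)
    have powfix: "T (h [^] i) (\<phi> u) = \<phi> u" for i :: nat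
      by (induction i) (use hc fixed in \<open>auto simp: T_one T_mult\<close>)
    have "L (\<phi> u) \<le> 0"
    proof (rule archimedean_nonpos)
      fix n :: nat
      have "of_int (int n) * \<phi> u = (\<Sum>i<n. T (h [^] i) (\<phi> u))" by (simp add: powfix)
      also have "\<dots> = T (h [^] n) u - u" unfolding \<phi>_def by (rule telescope[OF h])
      finally have "real n * L (\<phi> u) = L (T (h [^] n) u - u)" using L_scale[OF \<phi>W[OF u(1)], of "int n"] by simp
      also have "\<dots> \<le> L (T (h [^] n) u) + L u" using u hc by (intro L_diff T_mem) auto
      finally show "real n * L (\<phi> u) \<le> 2 * L u" using u hc by (simp add: L_T)
    qed
    then show ?thesis using L_nonneg[OF \<phi>W[OF u(1)]] L_eq_0[OF \<phi>W[OF u(1)]] by simp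
  qed
  have it: "(\<phi> ^^ i) v \<in> W" for i by (induction i) (use v \<phi>W in auto)
  \<comment> \<open>The relation is assumed only after applying \<open>\<phi>\<close>, a form that
    survives the induction: if the constant coefficient is 0, then \<open>ss\<close> cancels one
    factor \<open>\<phi>\<close> and the coefficients shift down. The first nonzero coefficient
    becomes \<open>m\<close>.\<close>
  have main: "\<exists>m w. m \<noteq> 0 \<and> w \<in> W \<and> \<phi> (of_int m * v) = \<phi> (\<phi> w)"
    if "\<exists>i\<le>n. a i \<noteq> 0" "\<phi> (\<Sum>i\<le>n. of_int (a i) * (\<phi> ^^ i) v) = 0" for n and a :: "nat \<Rightarrow> int"
    using that
  proof (induction n arbitrary: a)
    case 0
    then show ?case using zero_mem by (intro exI[of _ "a 0"] exI[of _ 0]) (simp add: \<phi>0)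
  next
    case (Suc n)
    define y where "y = (\<Sum>i\<le>n. of_int (a (Suc i)) * (\<phi> ^^ i) v)"
    have y: "y \<in> W" unfolding y_def by (intro sum_mem scale_mem it)
    have "(\<Sum>i\<le>Suc n. of_int (a i) * (\<phi> ^^ i) v) = of_int (a 0) * v + \<phi> y"
      unfolding sum.atMost_Suc_shift y_def \<phi>_sum by (simp add: \<phi>_scale)
    then have eq: "\<phi> (of_int (a 0) * v) + \<phi> (\<phi> y) = 0" using Suc.prems(2) by (simp only: \<phi>_add)
    show ?case
    proof (cases "a 0 = 0")
      case False
      have "\<phi> (of_int (a 0) * v) = \<phi> (\<phi> (- y))" using eq by (simp add: \<phi>_uminus eq_neg_iff_add_eq_0)
      with False y show ?thesis using uminus_mem by blast
    next
      case True
      then have "\<phi> y = 0" using eq ss[OF y] by (simp add: \<phi>0)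
      moreover have "\<exists>i\<le>n. a (Suc i) \<noteq> 0" using Suc.prems(1) True by (metis Suc_le_mono not0_implies_Suc)
      ultimately show ?thesis using Suc.IH[of "\<lambda>i. a (Suc i)"] by (simp only: y_def)
    qed
  qed
  obtain a :: "nat \<Rightarrow> int" where a: "\<exists>i\<le>r. a i \<noteq> 0" "(\<Sum>i\<le>r. of_int (a i) * (\<phi> ^^ i) v) = 0"
    using relation[of "\<lambda>i. (\<phi> ^^ i) v"] it by blast
  obtain m w where mw: "m \<noteq> 0" "w \<in> W" "\<phi> (of_int m * v) = \<phi> (\<phi> w)"
    using main[OF a(1)] a(2) \<phi>0 by metis
  show ?thesis
  proof (cases "m > 0")
    case True
    then show ?thesis using mw by (intro that[of "nat m" w]) auto
  next
    case False
    then have "of_nat (nat (- m)) * v = - (of_int m * v)" using mw(1) by simp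
    then have "\<phi> (of_nat (nat (- m)) * v) = \<phi> (\<phi> (- w))" using mw(3) by (simp only: \<phi>_uminus)
    then show ?thesis using mw False uminus_mem by (intro that[of "nat (- m)" "- w"]) auto
  qed
qed

text \<open>Pigeonhole on the partial sums modulo \<open>m W\<close>, of which there are finitely
  many classes by \<open>finite_mod\<close>. If the sums of \<open>i < j\<close> terms agree, their
  difference is \<open>T (g^i)\<close> of the sum of \<open>j - i\<close> terms, and the operators
  preserve \<open>m W\<close>. Passing from \<open>g\<close> to a power thus makes up for a missing
  division by \<open>m\<close>.\<close>

lemma orbit_sum_divisible:
  assumes g: "g \<in> K" and w: "w \<in> W" and m: "(m::nat) > 0"
  obtains k u where "(k::nat) > 0" "u \<in> W" "(\<Sum>i<k. T (g [^] i) w) = of_nat m * u"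
proof -
  have gc: "g \<in> carrier G" using g by (rule K_carrier)
  obtain S where S: "finite S" "\<And>w. w \<in> W \<Longrightarrow> \<exists>s\<in>S. \<exists>u\<in>W. w = s + of_nat m * u"
    using finite_mod[OF m] by blast
  define \<sigma> where "\<sigma> k = (\<Sum>i<k. T (g [^] i) w)" for k :: nat
  have \<sigma>: "\<sigma> k \<in> W" for k unfolding \<sigma>_def using gc w by (intro sum_mem T_mem) auto
  have "\<forall>k. \<exists>s u. s \<in> S \<and> u \<in> W \<and> \<sigma> k = s + of_nat m * u" using S(2)[OF \<sigma>] by blast
  then obtain s u where su: "\<And>k. s k \<in> S" "\<And>k. u k \<in> W" "\<And>k. \<sigma> k = s k + of_nat m * u k" by metis
  have "finite (range s)" using su(1) S(1) by (auto intro: finite_subset)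
  then have "\<not> inj s" using finite_imageD[of s UNIV] by auto
  then obtain i j where ij: "s i = s j" "i < j" unfolding inj_def by (metis linorder_neqE_nat)
  have split: "\<sigma> (i + d) = \<sigma> i + T (g [^] i) (\<sigma> d)" for d
    by (induction d) (use gc in \<open>auto simp: \<sigma>_def T_zero T_add T_mult[symmetric] nat_pow_mult\<close>)
  have "T (g [^] i) (\<sigma> (j - i)) = \<sigma> j - \<sigma> i" using split[of "j - i"] ij(2) by simp
  also have "\<dots> = of_nat m * (u j - u i)" using su(3) ij(1) by (simp add: right_diff_distrib)
  finally have "T (inv (g [^] i)) (T (g [^] i) (\<sigma> (j - i))) = T (inv (g [^] i)) (of_nat m * (u j - u i))"
    by simp
  then have "\<sigma> (j - i) = of_nat m * T (inv (g [^] i)) (u j - u i)" using gc by (simp add: T_inv T_scale_nat)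
  moreover have "T (inv (g [^] i)) (u j - u i) \<in> W" using gc su(2) by (intro T_mem diff_mem) auto
  ultimately show ?thesis using ij(2) that[of "j - i"] by (simp add: \<sigma>_def)
qed

end

section \<open>The Fitting subgroup of a group with a positive length function\<close>

text \<open>Torsion-freeness is contained in \<open>l_pos\<close>, since an element of finite order
  has length 0 by homogeneity.\<close>

locale torsion_free_length_group = group G for G :: "('a, 'b) monoid_scheme" (structure) +
  fixes l :: "'a \<Rightarrow> real"
  assumes length_function: "length_function G l"
    and l_pos: "\<And>g. g \<in> carrier G \<Longrightarrow> g \<noteq> \<one> \<Longrightarrow> l g > 0"
    and derived_trivial: "\<exists>n. (derived G ^^ n) (carrier G) = {\<one>}"
    and finite_rank: "\<And>A. subgroup A G \<Longrightarrow> abelian_set G A \<Longrightarrow> finite_Q_rank G A"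
begin

lemma l_nonneg: "g \<in> carrier G \<Longrightarrow> 0 \<le> l g"
  and l_int_pow: "g \<in> carrier G \<Longrightarrow> l (g [^] (k::int)) = \<bar>real_of_int k\<bar> * l g"
  and l_conj: "g \<in> carrier G \<Longrightarrow> h \<in> carrier G \<Longrightarrow> l (h \<otimes> g \<otimes> inv h) = l g"
  and l_mult: "a \<in> carrier G \<Longrightarrow> b \<in> carrier G \<Longrightarrow> a \<otimes> b = b \<otimes> a \<Longrightarrow> l (a \<otimes> b) \<le> l a + l b"
  using length_function unfolding length_function_def by blast+

lemma l_nat_pow: "g \<in> carrier G \<Longrightarrow> l (g [^] (n::nat)) = real n * l g"
  using l_int_pow[of g "int n"] by (simp add: int_pow_int)

lemma l_inv: "g \<in> carrier G \<Longrightarrow> l (inv g) = l g"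
  using l_int_pow[of g "-1"] by (simp add: int_pow_neg int_pow_1)

lemma l_eq_0: "g \<in> carrier G \<Longrightarrow> l g = 0 \<Longrightarrow> g = \<one>"
  using l_pos[of g] by force

lemma l_one: "l \<one> = 0"
  using l_nat_pow[of \<one> 0] by simp

lemma pow_eq_one: "g \<in> carrier G \<Longrightarrow> (m::nat) > 0 \<Longrightarrow> g [^] m = \<one> \<Longrightarrow> g = \<one>"
  using l_nat_pow[of g m] l_eq_0[of g] by (simp add: l_one)

text \<open>If \<open>z = [x, y]\<close> is central in \<open>\<langle>x, y\<rangle>\<close> then \<open>z\<^sup>n = (x\<^sup>n y x\<^sup>-\<^sup>n) y\<^sup>-\<^sup>1\<close> has length at most
  \<open>2 l(y)\<close>.\<close>

lemma commute_of_comm_central: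
  assumes x: "x \<in> carrier G" and y: "y \<in> carrier G"
    and zx: "x \<otimes> comm x y = comm x y \<otimes> x" and zy: "y \<otimes> comm x y = comm x y \<otimes> y"
  shows "x \<otimes> y = y \<otimes> x"
proof -
  define z where "z = comm x y"
  have z: "z \<in> carrier G" using x y by (simp add: z_def)
  have xy: "x \<otimes> y = z \<otimes> (y \<otimes> x)" using comm_mult[OF x y] by (simp add: z_def)
  have zx': "x \<otimes> z = z \<otimes> x" and zy': "y \<otimes> z = z \<otimes> y" using zx zy by (simp_all add: z_def)
  have xzn: "x \<otimes> z [^] n = z [^] n \<otimes> x" for n :: nat
    by (induction n) (use x z zx' in \<open>auto intro!: mult_commute\<close>)
  have yzn: "y \<otimes> z [^] n = z [^] n \<otimes> y" for n :: nat
    by (induction n) (use y z zy' in \<open>auto intro!: mult_commute\<close>)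
  have pow: "x [^] n \<otimes> y = z [^] n \<otimes> y \<otimes> x [^] n" for n :: nat
  proof (induction n)
    case (Suc n)
    have "x [^] Suc n \<otimes> y = x \<otimes> (x [^] n \<otimes> y)" using x y nat_pow_Suc2[OF x] by (simp add: m_assoc)
    also have "\<dots> = x \<otimes> z [^] n \<otimes> y \<otimes> x [^] n" using Suc x y z by (simp add: m_assoc)
    also have "\<dots> = z [^] n \<otimes> (x \<otimes> y) \<otimes> x [^] n" unfolding xzn using x y z by (simp add: m_assoc)
    also have "\<dots> = z [^] Suc n \<otimes> y \<otimes> (x \<otimes> x [^] n)" unfolding xy using x y z by (simp add: m_assoc)
    finally show ?case using nat_pow_Suc2[OF x] by simp
  qed (use x y z in auto)
  have "real n * l z \<le> 2 * l y" for n :: nat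
  proof -
    define p where "p = x [^] n \<otimes> y \<otimes> inv (x [^] n)"
    have p: "p \<in> carrier G" using x y by (simp add: p_def)
    have pz: "p = z [^] n \<otimes> y" unfolding p_def pow using x y z by (simp add: m_assoc)
    have "y \<otimes> p = p \<otimes> y" unfolding pz using y z yzn[of n] by (intro mult_commute) auto
    then have "p \<otimes> inv y = inv y \<otimes> p" using p y inv_commute[of p y] by simp
    then have "l (p \<otimes> inv y) \<le> l p + l (inv y)" using p y by (intro l_mult) auto
    moreover have "p \<otimes> inv y = z [^] n" unfolding pz using y z by (simp add: m_assoc)
    moreover have "l p = l y" unfolding p_def using x y by (simp add: l_conj)
    ultimately show ?thesis using y z by (simp add: l_nat_pow l_inv)
  qed
  then have "l z \<le> 0" by (rule archimedean_nonpos)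
  then have "z = \<one>" using l_nonneg[OF z] l_eq_0[OF z] by simp
  then show ?thesis using comm_eq_one_iff[OF x y] by (simp add: z_def)
qed

text \<open>As nilpotent subgroups are abelian, this is the Fitting subgroup.\<close>

definition Fit :: "'a set" where
  "Fit = {x \<in> carrier G. \<forall>g\<in>carrier G. x \<otimes> (g \<otimes> x \<otimes> inv g) = (g \<otimes> x \<otimes> inv g) \<otimes> x}"

lemma Fit_carrier: "x \<in> Fit \<Longrightarrow> x \<in> carrier G"
  by (simp add: Fit_def)

lemma conj_commute:
  assumes "g \<in> carrier G" "x \<in> carrier G" "y \<in> carrier G" "x \<otimes> y = y \<otimes> x"
  shows "(g \<otimes> x \<otimes> inv g) \<otimes> (g \<otimes> y \<otimes> inv g) = (g \<otimes> y \<otimes> inv g) \<otimes> (g \<otimes> x \<otimes> inv g)"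
proof -
  have "(g \<otimes> a \<otimes> inv g) \<otimes> (g \<otimes> b \<otimes> inv g) = g \<otimes> (a \<otimes> b) \<otimes> inv g"
    if "a \<in> carrier G" "b \<in> carrier G" for a b using that assms(1) by (simp add: m_assoc)
  then show ?thesis using assms by metis
qed

text \<open>\<open>[x, y]\<close> is \<open>x\<close> times the inverse of a conjugate of
  \<open>x\<close>, so it commutes with \<open>x\<close>; it is also a conjugate of \<open>y\<close>
  times \<open>y^-1\<close>, so it commutes with \<open>y\<close>. Such a commutator is
  trivial.\<close>

lemma Fit_commute: assumes "x \<in> Fit" "y \<in> Fit" shows "x \<otimes> y = y \<otimes> x"
proof -
  have x: "x \<in> carrier G" and y: "y \<in> carrier G" using assms Fit_carrier by auto
  have xc: "x \<otimes> (g \<otimes> x \<otimes> inv g) = (g \<otimes> x \<otimes> inv g) \<otimes> x" if "g \<in> carrier G" for g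
    using assms(1) that by (simp add: Fit_def)
  have yc: "y \<otimes> (g \<otimes> y \<otimes> inv g) = (g \<otimes> y \<otimes> inv g) \<otimes> y" if "g \<in> carrier G" for g
    using assms(2) that by (simp add: Fit_def)
  have eq: "comm x y = x \<otimes> inv (y \<otimes> x \<otimes> inv y)" using x y by (simp add: comm_def m_assoc inv_mult_group)
  show ?thesis
  proof (rule commute_of_comm_central[OF x y])
    show "x \<otimes> comm x y = comm x y \<otimes> x" unfolding eq
      using x y by (intro mult_commute[OF x x _ refl inv_commute[OF x _ xc[OF y]]]) auto
    show "y \<otimes> comm x y = comm x y \<otimes> y" unfolding comm_def
      using x y by (intro mult_commute[OF y _ _ yc[OF x] inv_commute[OF y y refl]]) auto
  qed
qed

lemma Fit_conj: assumes "x \<in> Fit" "h \<in> carrier G" shows "h \<otimes> x \<otimes> inv h \<in> Fit"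
proof -
  have x: "x \<in> carrier G" using assms Fit_carrier by auto
  have "(h \<otimes> x \<otimes> inv h) \<otimes> (g \<otimes> (h \<otimes> x \<otimes> inv h) \<otimes> inv g) = (g \<otimes> (h \<otimes> x \<otimes> inv h) \<otimes> inv g) \<otimes> (h \<otimes> x \<otimes> inv h)"
    if g: "g \<in> carrier G" for g
  proof -
    let ?k = "inv h \<otimes> g \<otimes> h"
    have k: "?k \<in> carrier G" using assms g by simp
    have "g \<otimes> (h \<otimes> x \<otimes> inv h) \<otimes> inv g = h \<otimes> (?k \<otimes> x \<otimes> inv ?k) \<otimes> inv h"
      using assms g x by (simp add: m_assoc inv_mult_group)
    moreover have "x \<otimes> (?k \<otimes> x \<otimes> inv ?k) = (?k \<otimes> x \<otimes> inv ?k) \<otimes> x"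
      using assms(1) k unfolding Fit_def by blast
    ultimately show ?thesis using conj_commute[of h x "?k \<otimes> x \<otimes> inv ?k"] assms x k by simp
  qed
  then show ?thesis using assms x by (simp add: Fit_def)
qed

lemma Fit_subgroup: "subgroup Fit G"
proof (rule subgroupI)
  show "Fit \<subseteq> carrier G" using Fit_carrier by auto
  have "\<one> \<in> Fit" by (simp add: Fit_def)
  then show "Fit \<noteq> {}" by auto
  show "inv x \<in> Fit" if "x \<in> Fit" for x
  proof -
    have x: "x \<in> carrier G" using that Fit_carrier by auto
    have "inv x \<otimes> (g \<otimes> inv x \<otimes> inv g) = (g \<otimes> inv x \<otimes> inv g) \<otimes> inv x" if g: "g \<in> carrier G" for g
    proof -
      let ?y = "g \<otimes> x \<otimes> inv g"
      have "x \<otimes> ?y = ?y \<otimes> x" using \<open>x \<in> Fit\<close> g by (simp add: Fit_def)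
      then have "inv (x \<otimes> ?y) = inv (?y \<otimes> x)" by simp
      then show ?thesis using x g by (simp add: inv_mult_group m_assoc)
    qed
    then show ?thesis using x by (simp add: Fit_def)
  qed
  show "x \<otimes> y \<in> Fit" if xy: "x \<in> Fit" "y \<in> Fit" for x y
  proof -
    have c: "x \<in> carrier G" "y \<in> carrier G" using xy Fit_carrier by auto
    have "(x \<otimes> y) \<otimes> (g \<otimes> (x \<otimes> y) \<otimes> inv g) = (g \<otimes> (x \<otimes> y) \<otimes> inv g) \<otimes> (x \<otimes> y)" if g: "g \<in> carrier G" for g
    proof -
      let ?x = "g \<otimes> x \<otimes> inv g" and ?y = "g \<otimes> y \<otimes> inv g"
      have xy': "?x \<in> Fit" "?y \<in> Fit" using xy g Fit_conj by auto
      have "g \<otimes> (x \<otimes> y) \<otimes> inv g = ?x \<otimes> ?y" using c g by (simp add: m_assoc)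
      moreover have "(x \<otimes> y) \<otimes> (?x \<otimes> ?y) = (?x \<otimes> ?y) \<otimes> (x \<otimes> y)"
      proof (rule mult_commute)
        have "?x \<otimes> (x \<otimes> y) = (x \<otimes> y) \<otimes> ?x" "?y \<otimes> (x \<otimes> y) = (x \<otimes> y) \<otimes> ?y"
          using xy xy' Fit_commute Fit_carrier by (auto intro!: mult_commute)
        then show "(x \<otimes> y) \<otimes> ?x = ?x \<otimes> (x \<otimes> y)" "(x \<otimes> y) \<otimes> ?y = ?y \<otimes> (x \<otimes> y)" by simp_all
      qed (use c g in auto)
      ultimately show ?thesis by simp
    qed
    then show ?thesis using c by (simp add: Fit_def)
  qed
qed

text \<open>Descending induction along the derived series. If \<open>x\<close> centralizes
  \<open>Fit\<close>, so does each conjugate \<open>y\<close> of \<open>x\<close>, and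
  \<open>z = [x, y]\<close> lies one term deeper and centralizes \<open>Fit\<close> as well. By
  induction \<open>z\<close> is in \<open>Fit\<close>, hence commutes with \<open>x\<close> and
  \<open>y\<close>, and \<open>commute_of_comm_central\<close> makes \<open>x\<close> and
  \<open>y\<close> commute.\<close>

lemma Fit_self_centralizing:
  assumes x: "x \<in> carrier G" and cent: "\<And>f. f \<in> Fit \<Longrightarrow> x \<otimes> f = f \<otimes> x"
  shows "x \<in> Fit"
proof -
  let ?D = "\<lambda>i. (derived G ^^ i) (carrier G)"
  obtain n where n: "?D n = {\<one>}" using derived_trivial by blast
  have "\<forall>x. x \<in> ?D (n - k) \<longrightarrow> (\<forall>f\<in>Fit. x \<otimes> f = f \<otimes> x) \<longrightarrow> x \<in> Fit" if "k \<le> n" for k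
    using that
  proof (induction k)
    case 0
    then show ?case using n subgroup.one_closed[OF Fit_subgroup] by simp
  next
    case (Suc k)
    then have k: "n - k = Suc (n - Suc k)" by simp
    show ?case
    proof (intro allI impI)
      fix x assume xD: "x \<in> ?D (n - Suc k)" and xF: "\<forall>f\<in>Fit. x \<otimes> f = f \<otimes> x"
      have x: "x \<in> carrier G" using xD exp_of_derived_in_carrier[of "carrier G"] by blast
      have "x \<otimes> (g \<otimes> x \<otimes> inv g) = (g \<otimes> x \<otimes> inv g) \<otimes> x" if g: "g \<in> carrier G" for g
      proof -
        define y where "y = g \<otimes> x \<otimes> inv g"
        have y: "y \<in> carrier G" using x g by (simp add: y_def)
        have norm: "?D i \<lhd> G" for i by (induction i) (auto simp: normal_self derived_is_normal)
        have yD: "y \<in> ?D (n - Suc k)" unfolding y_def using normal.inv_op_closed2[OF norm g xD] .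
        have yF: "y \<otimes> f = f \<otimes> y" if f: "f \<in> Fit" for f
        proof -
          let ?f = "inv g \<otimes> f \<otimes> g"
          have fc: "f \<in> carrier G" using f Fit_carrier by auto
          have "?f \<in> Fit" using Fit_conj[OF f, of "inv g"] g by simp
          then have "x \<otimes> ?f = ?f \<otimes> x" using xF by simp
          moreover have "g \<otimes> ?f \<otimes> inv g = f" using g fc by (simp add: m_assoc)
          ultimately show ?thesis using conj_commute[of g x ?f] g x fc by (simp add: y_def)
        qed
        define z where "z = comm x y"
        have z: "z \<in> carrier G" using x y by (simp add: z_def)
        have "z \<in> ?D (n - k)" unfolding k z_def comm_def using xD yD
          by (auto simp: derived_def intro!: generate.incl)
        moreover have "\<forall>f\<in>Fit. z \<otimes> f = f \<otimes> z"
        proof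
          fix f assume f: "f \<in> Fit"
          then have fc: "f \<in> carrier G" using Fit_carrier by auto
          have "f \<otimes> z = z \<otimes> f" unfolding z_def comm_def
            using x y fc xF yF f by (intro mult_commute inv_commute) auto
          then show "z \<otimes> f = f \<otimes> z" by simp
        qed
        ultimately have "z \<in> Fit" using Suc by simp
        then have "x \<otimes> y = y \<otimes> x"
          using xF yF[of z] by (intro commute_of_comm_central[OF x y]) (simp_all flip: z_def)
        then show ?thesis by (simp flip: y_def)
      qed
      then show "x \<in> Fit" using x by (simp add: Fit_def)
    qed
  qed
  from this[of n] show ?thesis using x cent by simp
qed

lemma abelian_set_Fit: "abelian_set G Fit"
  unfolding abelian_set_def using Fit_commute by blast

lemma comm_group_Fit: "comm_group (G\<lparr>carrier := Fit\<rparr>)"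
  by (rule group.group_comm_groupI[OF subgroup_imp_group[OF Fit_subgroup]]) (simp add: Fit_commute)

text \<open>A commutator that commutes with everything is trivial, so the lower central series cannot
  reach 1 properly.\<close>

lemma abelian_of_nilpotent:
  assumes K: "subgroup K G" and nil: "nilpotent_group (G\<lparr>carrier := K\<rparr>)"
  shows "abelian_set G K"
proof -
  let ?H = "G\<lparr>carrier := K\<rparr>"
  interpret H: group ?H by (rule subgroup_imp_group[OF K])
  have Kc: "x \<in> K \<Longrightarrow> x \<in> carrier G" for x using subgroup.mem_carrier[OF K] .
  let ?\<gamma> = "lower_central ?H"
  let ?S = "\<lambda>i. \<Union>h \<in> ?\<gamma> i. \<Union>g \<in> K. {comm h g}"
  have Suc_eq: "?\<gamma> (Suc i) = generate ?H (?S i)" if "?\<gamma> i \<subseteq> K" for i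
    using that by (auto simp: comm_def m_inv_consistent[OF K] subset_iff intro!: arg_cong[of _ _ "generate ?H"])
  have sub: "?\<gamma> i \<subseteq> K" for i
  proof (induction i)
    case (Suc i)
    have "?S i \<subseteq> K" using Suc
      by (auto simp: comm_def intro!: subgroup.m_closed[OF K] subgroup.m_inv_closed[OF K])
    then show ?case unfolding Suc_eq[OF Suc] using H.generate_incl[of "?S i"] by simp
  qed simp
  obtain i where "?\<gamma> i = {\<one>\<^bsub>?H\<^esub>}" using nil unfolding nilpotent_group_def by blast
  then have i: "?\<gamma> i = {\<one>}" by simp
  \<comment> \<open>The hypothesis makes the elements of \<open>?\<gamma> (Suc j)\<close> central in
    \<open>K\<close>. Its generators are commutators, and each of them commutes with its own two
    entries. The shift by \<open>Suc\<close> matters, as the elements of \<open>?\<gamma> 0\<close>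
    are not given as commutators.\<close>
  have down: "?\<gamma> (Suc j) = {\<one>}" if "?\<gamma> (Suc (Suc j)) = {\<one>}" for j
  proof -
    have cen: "comm h g = \<one>" if "h \<in> ?\<gamma> (Suc j)" "g \<in> K" for h g
    proof -
      have "comm h g \<in> ?\<gamma> (Suc (Suc j))" unfolding Suc_eq[OF sub[of "Suc j"]] using that by (intro generate.incl) blast
      with \<open>?\<gamma> (Suc (Suc j)) = {\<one>}\<close> show ?thesis by simp
    qed
    have "?S j \<subseteq> {\<one>}"
    proof
      fix z assume "z \<in> ?S j"
      then obtain h g where hg: "h \<in> ?\<gamma> j" "g \<in> K" "z = comm h g" by blast
      then have hK: "h \<in> K" using sub by auto
      have z: "z \<in> ?\<gamma> (Suc j)" unfolding Suc_eq[OF sub[of j]] using hg by (intro generate.incl) blast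
      have zc: "z \<in> carrier G" using z sub Kc by blast
      have "comm z h = \<one>" "comm z g = \<one>" using cen[OF z] hK hg by auto
      then have "h \<otimes> z = z \<otimes> h" "g \<otimes> z = z \<otimes> g"
        using comm_eq_one_iff[OF zc] Kc hK hg by auto
      then have "h \<otimes> g = g \<otimes> h" unfolding hg(3)
        by (rule commute_of_comm_central[OF Kc[OF hK] Kc[OF hg(2)]])
      then show "z \<in> {\<one>}" using hg comm_eq_one_iff[of h g] Kc hK by simp
    qed
    then have "generate ?H (?S j) \<subseteq> {\<one>}"
      using H.generate_subgroup_incl[of "?S j" "{\<one>}"] H.triv_subgroup by simp
    moreover have "\<one> \<in> generate ?H (?S j)" using generate.one[of ?H "?S j"] by simp
    ultimately show ?thesis unfolding Suc_eq[OF sub[of j]] by blast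
  qed
  have "?\<gamma> 1 = {\<one>}"
  proof (cases i)
    case 0
    then have "K = {\<one>}" using i by simp
    then show ?thesis using sub[of 1] generate.one[of ?H "?S 0"] Suc_eq[OF sub[of 0]] by auto
  next
    case (Suc j)
    have "?\<gamma> (Suc j) = {\<one>} \<Longrightarrow> ?\<gamma> 1 = {\<one>}" for j
      by (induction j) (use down in auto)
    with Suc i show ?thesis by blast
  qed
  then have "comm x y = \<one>" if "x \<in> K" "y \<in> K" for x y
    using Suc_eq[OF sub[of 0]] that generate.incl[of "comm x y" "?S 0" ?H] by auto
  then show ?thesis unfolding abelian_set_def using comm_eq_one_iff Kc by blast
qed

end

section \<open>Coordinates on the Fitting subgroup\<close>

lemma sum_fun_apply: "(sum f A) x = (\<Sum>a\<in>A. f a x)"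
  for f :: "'b \<Rightarrow> 'c \<Rightarrow> 'd::comm_monoid_add"
  by (induction A rule: infinite_finite_induct) auto

lemma of_nat_fun_apply: "(of_nat n :: 'c \<Rightarrow> 'd::semiring_1) x = of_nat n"
  by (induction n) auto

lemma of_int_fun_apply: "(of_int k :: 'c \<Rightarrow> 'd::ring_1) x = of_int k"
  by (cases k) (auto simp: of_nat_fun_apply)

text \<open>\<open>P\<close> parametrizes a maximal free abelian subgroup of \<open>Fit\<close>, and
  \<open>\<iota>\<close> gives rational coordinates with respect to it. Maximality in the form
  \<open>r_max\<close> will supply the relation among any \<open>r + 1\<close> elements.\<close>

locale fitting_coordinates = torsion_free_length_group +
  fixes r :: nat and P :: "(nat \<Rightarrow> int) \<Rightarrow> 'a" and \<iota> :: "'a \<Rightarrow> nat \<Rightarrow> rat"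
  assumes P_hom: "P \<in> hom (Zn r) (G\<lparr>carrier := Fit\<rparr>)"
    and r_max: "\<And>n P. P \<in> hom (Zn n) (G\<lparr>carrier := Fit\<rparr>) \<Longrightarrow> inj_on P (carrier (Zn n)) \<Longrightarrow> n \<le> r"
    and pow_ex: "\<And>f. f \<in> Fit \<Longrightarrow> \<exists>m e. (m::nat) > 0 \<and> e \<in> carrier (Zn r) \<and> f [^] m = P e"
    and \<iota>_eq: "\<And>f m e. f \<in> Fit \<Longrightarrow> (m::nat) > 0 \<Longrightarrow> e \<in> carrier (Zn r) \<Longrightarrow> f [^] m = P e \<Longrightarrow>
       \<iota> f = (\<lambda>i. of_int (e i) / of_nat m)"
    and \<iota>_mult: "\<And>f f'. f \<in> Fit \<Longrightarrow> f' \<in> Fit \<Longrightarrow> \<iota> (f \<otimes> f') = \<iota> f + \<iota> f'"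
    and \<iota>_inj: "inj_on \<iota> Fit"

lemma (in torsion_free_length_group) fitting_coordinates_exist:
  obtains r P \<iota> where "fitting_coordinates G l r P \<iota>"
proof -
  interpret F: comm_group "G\<lparr>carrier := Fit\<rparr>" by (rule comm_group_Fit)
  have pow: "f [^]\<^bsub>G\<lparr>carrier := Fit\<rparr>\<^esub> (m::nat) = f [^] m" for f m
    by (rule nat_pow_consistent[symmetric])
  obtain B where B: "\<And>n P. P \<in> hom (Zn n) (G\<lparr>carrier := Fit\<rparr>) \<Longrightarrow> inj_on P (carrier (Zn n)) \<Longrightarrow> n \<le> B"
    using finite_Q_rank_hom_bound[OF Fit_subgroup finite_rank[OF Fit_subgroup abelian_set_Fit]] by blast
  have tf: "a = \<one>\<^bsub>G\<lparr>carrier := Fit\<rparr>\<^esub>" if "a \<in> carrier (G\<lparr>carrier := Fit\<rparr>)" "(m::nat) > 0"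
    "a [^]\<^bsub>G\<lparr>carrier := Fit\<rparr>\<^esub> m = \<one>\<^bsub>G\<lparr>carrier := Fit\<rparr>\<^esub>" for a m
    using that pow_eq_one[of a m] Fit_carrier by (simp add: pow)
  show ?thesis
  proof (rule F.rational_coordinates[OF tf B])
    fix r P and \<iota> :: "'a \<Rightarrow> nat \<Rightarrow> rat"
    assume coords: "P \<in> hom (Zn r) (G\<lparr>carrier := Fit\<rparr>)"
      "\<And>n P. P \<in> hom (Zn n) (G\<lparr>carrier := Fit\<rparr>) \<Longrightarrow> inj_on P (carrier (Zn n)) \<Longrightarrow> n \<le> r"
      "\<And>a. a \<in> carrier (G\<lparr>carrier := Fit\<rparr>) \<Longrightarrow>
         \<exists>m e. (m::nat) > 0 \<and> e \<in> carrier (Zn r) \<and> a [^]\<^bsub>G\<lparr>carrier := Fit\<rparr>\<^esub> m = P e"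
      "\<And>a m e. a \<in> carrier (G\<lparr>carrier := Fit\<rparr>) \<Longrightarrow> (m::nat) > 0 \<Longrightarrow> e \<in> carrier (Zn r) \<Longrightarrow>
         a [^]\<^bsub>G\<lparr>carrier := Fit\<rparr>\<^esub> m = P e \<Longrightarrow> \<iota> a = (\<lambda>i. of_int (e i) / of_nat m)"
      "\<And>a b. a \<in> carrier (G\<lparr>carrier := Fit\<rparr>) \<Longrightarrow> b \<in> carrier (G\<lparr>carrier := Fit\<rparr>) \<Longrightarrow>
         \<iota> (a \<otimes>\<^bsub>G\<lparr>carrier := Fit\<rparr>\<^esub> b) = \<iota> a + \<iota> b"
      "inj_on \<iota> (carrier (G\<lparr>carrier := Fit\<rparr>))"
    have "fitting_coordinates G l r P \<iota>"
    proof unfold_locales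
      show "P \<in> hom (Zn r) (G\<lparr>carrier := Fit\<rparr>)" by (rule coords(1))
      show "n \<le> r" if "P \<in> hom (Zn n) (G\<lparr>carrier := Fit\<rparr>)" "inj_on P (carrier (Zn n))" for n P
        using that by (rule coords(2))
      show "\<exists>m e. (m::nat) > 0 \<and> e \<in> carrier (Zn r) \<and> f [^] m = P e" if "f \<in> Fit" for f
        using coords(3)[of f] that by (simp add: pow)
      show "\<iota> f = (\<lambda>i. of_int (e i) / of_nat m)"
        if "f \<in> Fit" "(m::nat) > 0" "e \<in> carrier (Zn r)" "f [^] m = P e" for f m e
        using coords(4)[of f m e] that by (simp add: pow)
      show "\<iota> (f \<otimes> f') = \<iota> f + \<iota> f'" if "f \<in> Fit" "f' \<in> Fit" for f f'
        using coords(5)[of f f'] that by simp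
      show "inj_on \<iota> Fit" using coords(6) by simp
    qed
    then show ?thesis by (rule that)
  qed
qed

context fitting_coordinates
begin

lemma Fit_closed [simp]: "\<one> \<in> Fit" "f \<in> Fit \<Longrightarrow> f' \<in> Fit \<Longrightarrow> f \<otimes> f' \<in> Fit" "f \<in> Fit \<Longrightarrow> inv f \<in> Fit"
  using Fit_subgroup by (auto simp: subgroup.one_closed subgroup.m_closed subgroup.m_inv_closed)

lemma Fit_nat_pow [simp]: "f \<in> Fit \<Longrightarrow> f [^] (n::nat) \<in> Fit"
  by (induction n) auto

lemma Fit_int_pow [simp]: "f \<in> Fit \<Longrightarrow> f [^] (n::int) \<in> Fit"
  by (cases n rule: int_cases2) (simp_all add: int_pow_int int_pow_neg_int Fit_carrier)

lemma additive_one: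
  fixes \<phi> :: "'a \<Rightarrow> 'v::ab_group_add"
  assumes "\<And>f f'. f \<in> Fit \<Longrightarrow> f' \<in> Fit \<Longrightarrow> \<phi> (f \<otimes> f') = \<phi> f + \<phi> f'"
  shows "\<phi> \<one> = 0"
  using assms[of \<one> \<one>] by simp

lemma additive_inv:
  fixes \<phi> :: "'a \<Rightarrow> 'v::ab_group_add"
  assumes "\<And>f f'. f \<in> Fit \<Longrightarrow> f' \<in> Fit \<Longrightarrow> \<phi> (f \<otimes> f') = \<phi> f + \<phi> f'" and "f \<in> Fit"
  shows "\<phi> (inv f) = - \<phi> f"
  using assms(1)[of "inv f" f] assms(2) additive_one[of \<phi>] assms(1) Fit_carrier
  by (simp add: eq_neg_iff_add_eq_0)

lemma additive_nat_pow:
  fixes \<phi> :: "'a \<Rightarrow> 'v::ring_1"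
  assumes "\<And>f f'. f \<in> Fit \<Longrightarrow> f' \<in> Fit \<Longrightarrow> \<phi> (f \<otimes> f') = \<phi> f + \<phi> f'" and "f \<in> Fit"
  shows "\<phi> (f [^] (n::nat)) = of_nat n * \<phi> f"
  using assms(2) by (induction n) (auto simp: assms(1) additive_one[OF assms(1)] algebra_simps)

lemma additive_int_pow:
  fixes \<phi> :: "'a \<Rightarrow> 'v::ring_1"
  assumes "\<And>f f'. f \<in> Fit \<Longrightarrow> f' \<in> Fit \<Longrightarrow> \<phi> (f \<otimes> f') = \<phi> f + \<phi> f'" and "f \<in> Fit"
  shows "\<phi> (f [^] (n::int)) = of_int n * \<phi> f"
  using assms(2) Fit_carrier additive_nat_pow[of \<phi>, OF assms(1), of f] additive_inv[of \<phi>, OF assms(1)]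
  by (cases n rule: int_cases2) (simp_all add: int_pow_int int_pow_neg_int)

lemma \<iota>_one: "\<iota> \<one> = 0" using additive_one[of \<iota>, OF \<iota>_mult] by simp

lemma \<iota>_inv: "f \<in> Fit \<Longrightarrow> \<iota> (inv f) = - \<iota> f" using additive_inv[of \<iota>, OF \<iota>_mult] by simp

lemma \<iota>_int_pow: "f \<in> Fit \<Longrightarrow> \<iota> (f [^] (n::int)) = of_int n * \<iota> f"
  using additive_int_pow[of \<iota>, OF \<iota>_mult] by simp

lemma \<iota>_eq_iff: "f \<in> Fit \<Longrightarrow> f' \<in> Fit \<Longrightarrow> \<iota> f = \<iota> f' \<longleftrightarrow> f = f'"
  using \<iota>_inj by (auto dest: inj_onD)

lemma \<iota>_eq_0: "f \<in> Fit \<Longrightarrow> \<iota> f = 0 \<longleftrightarrow> f = \<one>"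
  using \<iota>_eq_iff[of f \<one>] by (simp add: \<iota>_one)

lemma P_Fit: "e \<in> carrier (Zn r) \<Longrightarrow> P e \<in> Fit"
  using hom_in_carrier[OF P_hom] by simp

lemma P_hom_G: "P \<in> hom (Zn r) G"
  using P_hom Fit_carrier by (auto simp: hom_def Pi_iff simp del: Zn_simps)

lemma \<iota>_support: "f \<in> Fit \<Longrightarrow> i \<ge> r \<Longrightarrow> \<iota> f i = 0"
  using pow_ex[of f] \<iota>_eq[of f] by fastforce

definition basis :: "nat \<Rightarrow> 'a" where "basis j = P (Zn_unit j)"

lemma unit_mem: "j < r \<Longrightarrow> Zn_unit j \<in> carrier (Zn r)"
  by (auto simp: Zn_unit_def)

lemma basis_Fit: "j < r \<Longrightarrow> basis j \<in> Fit"
  unfolding basis_def by (intro P_Fit unit_mem)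

lemma \<iota>_basis: "j < r \<Longrightarrow> \<iota> (basis j) = (\<lambda>i. if i = j then 1 else 0)"
  using \<iota>_eq[of "basis j" 1 "Zn_unit j"] unit_mem[of j] basis_Fit[of j] Fit_carrier[of "basis j"]
  by (auto simp: basis_def Zn_unit_def fun_eq_iff)

text \<open>Some power of \<open>f\<close> is an integer combination of the basis, and a
  homomorphism into a rational vector space is determined by its value on that power. Applied to
  conjugation by \<open>g\<close> this gives the matrix \<open>M g\<close>.\<close>

lemma additive_expansion:
  fixes \<phi> :: "'a \<Rightarrow> nat \<Rightarrow> rat"
  assumes \<phi>: "\<And>f f'. f \<in> Fit \<Longrightarrow> f' \<in> Fit \<Longrightarrow> \<phi> (f \<otimes> f') = \<phi> f + \<phi> f'" and f: "f \<in> Fit"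
  shows "\<phi> f i = (\<Sum>j<r. \<iota> f j * \<phi> (basis j) i)"
proof -
  obtain m e where me: "(m::nat) > 0" "e \<in> carrier (Zn r)" "f [^] m = P e" using pow_ex[OF f] by blast
  have "n \<le> r \<Longrightarrow> \<phi> (P (Zn_restrict n e)) = (\<Sum>j<n. of_int (e j) * \<phi> (basis j))" for n
  proof (induction n)
    case 0
    have "Zn_restrict 0 e = (\<lambda>_. 0)" by (simp add: Zn_restrict_def)
    then show ?case using hom_Zn_zero[OF P_hom_G] additive_one[of \<phi>, OF \<phi>] by simp
  next
    case (Suc n)
    then have n: "n < r" by simp
    have m1: "Zn_restrict n e \<in> carrier (Zn r)" "(\<lambda>i. e n * Zn_unit n i) \<in> carrier (Zn r)"
      using n by (auto simp: Zn_restrict_def Zn_unit_def)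
    have "Zn_restrict (Suc n) e = (\<lambda>i. Zn_restrict n e i + e n * Zn_unit n i)"
      by (rule ext) (auto simp: Zn_restrict_def Zn_unit_def less_Suc_eq)
    then have "P (Zn_restrict (Suc n) e) = P (Zn_restrict n e) \<otimes> P (\<lambda>i. e n * Zn_unit n i)"
      using hom_Zn_add[OF P_hom_G m1] by simp
    also have "P (\<lambda>i. e n * Zn_unit n i) = basis n [^] e n"
      using hom_Zn_scale[OF P_hom_G unit_mem[OF n]] by (simp add: basis_def)
    finally show ?case using Suc \<phi>[OF P_Fit[OF m1(1)], of "basis n [^] e n"] basis_Fit[OF n]
      by (simp add: additive_int_pow[OF \<phi>])
  qed
  from this[of r] have "\<phi> (P (Zn_restrict r e)) = (\<Sum>j<r. of_int (e j) * \<phi> (basis j))" by simp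
  moreover have "Zn_restrict r e = e" using me(2) by (auto simp: Zn_restrict_def)
  ultimately have "of_nat m * \<phi> f = (\<Sum>j<r. of_int (e j) * \<phi> (basis j))"
    using additive_nat_pow[of \<phi>, OF \<phi> f, of m] me(3) by simp
  then have "(of_nat m * \<phi> f) i = (\<Sum>j<r. of_int (e j) * \<phi> (basis j)) i" by simp
  then have "of_nat m * \<phi> f i = (\<Sum>j<r. of_int (e j) * \<phi> (basis j) i)"
    by (simp add: sum_fun_apply of_nat_fun_apply of_int_fun_apply)
  moreover have "\<iota> f = (\<lambda>i. of_int (e i) / of_nat m)" by (rule \<iota>_eq[OF f me])
  ultimately show ?thesis using me(1) by (simp add: field_simps sum_divide_distrib[symmetric] eq_divide_eq)
qed

definition W :: "(nat \<Rightarrow> rat) set" where "W = \<iota> ` Fit"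

definition L :: "(nat \<Rightarrow> rat) \<Rightarrow> real" where "L w = l (the_inv_into Fit \<iota> w)"

definition M :: "'a \<Rightarrow> nat \<Rightarrow> nat \<Rightarrow> rat" where "M g i j = \<iota> (g \<otimes> basis j \<otimes> inv g) i"

text \<open>Coordinates from \<open>r\<close> on are left alone, so that \<open>T \<one>\<close> is
  the identity on all functions, not only on those supported below \<open>r\<close>.\<close>

definition T :: "'a \<Rightarrow> (nat \<Rightarrow> rat) \<Rightarrow> nat \<Rightarrow> rat" where
  "T g w = (\<lambda>i. if i < r then \<Sum>j<r. M g i j * w j else w i)"

lemma \<iota>_mem [simp]: "f \<in> Fit \<Longrightarrow> \<iota> f \<in> W"
  by (simp add: W_def)

lemma WE: assumes "w \<in> W" obtains f where "f \<in> Fit" "w = \<iota> f"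
  using assms by (auto simp: W_def)

lemma L_\<iota> [simp]: "f \<in> Fit \<Longrightarrow> L (\<iota> f) = l f"
  by (simp add: L_def the_inv_into_f_f[OF \<iota>_inj])

lemma conj_additive:
  assumes "g \<in> carrier G" "f \<in> Fit" "f' \<in> Fit"
  shows "\<iota> (g \<otimes> (f \<otimes> f') \<otimes> inv g) = \<iota> (g \<otimes> f \<otimes> inv g) + \<iota> (g \<otimes> f' \<otimes> inv g)"
proof -
  have "g \<otimes> (f \<otimes> f') \<otimes> inv g = (g \<otimes> f \<otimes> inv g) \<otimes> (g \<otimes> f' \<otimes> inv g)"
    using assms Fit_carrier by (simp add: m_assoc)
  then show ?thesis using assms by (simp add: \<iota>_mult Fit_conj)
qed

lemma T_\<iota>: assumes "g \<in> carrier G" "f \<in> Fit" shows "T g (\<iota> f) = \<iota> (g \<otimes> f \<otimes> inv g)"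
proof
  fix i
  show "T g (\<iota> f) i = \<iota> (g \<otimes> f \<otimes> inv g) i"
    using additive_expansion[of "\<lambda>f. \<iota> (g \<otimes> f \<otimes> inv g)" f i] conj_additive[OF assms(1)] assms
    by (auto simp: T_def M_def \<iota>_support Fit_conj mult.commute)
qed

lemma M_mult:
  assumes "g \<in> carrier G" "h \<in> carrier G" "j < r"
  shows "M (g \<otimes> h) i j = (\<Sum>k<r. M g i k * M h k j)"
proof -
  let ?f = "h \<otimes> basis j \<otimes> inv h"
  have f: "?f \<in> Fit" using assms by (intro Fit_conj basis_Fit)
  have "(g \<otimes> h) \<otimes> basis j \<otimes> inv (g \<otimes> h) = g \<otimes> ?f \<otimes> inv g"
    using assms Fit_carrier[OF basis_Fit[OF assms(3)]] by (simp add: m_assoc inv_mult_group)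
  then have "M (g \<otimes> h) i j = \<iota> (g \<otimes> ?f \<otimes> inv g) i" by (simp add: M_def)
  also have "\<dots> = (\<Sum>k<r. \<iota> ?f k * \<iota> (g \<otimes> basis k \<otimes> inv g) i)"
    using additive_expansion[of "\<lambda>f. \<iota> (g \<otimes> f \<otimes> inv g)" ?f i] conj_additive[OF assms(1)] f by simp
  finally show ?thesis by (simp add: M_def mult.commute)
qed

lemma M_one: "j < r \<Longrightarrow> M \<one> i j = (if i = j then 1 else 0)"
  using Fit_carrier[OF basis_Fit[of j]] by (simp add: M_def \<iota>_basis)

lemma T_M_eq_1: "g \<in> carrier G \<Longrightarrow> (\<And>i j. i < r \<Longrightarrow> j < r \<Longrightarrow> M g i j = (if i = j then 1 else 0)) \<Longrightarrow> T g w = w"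
  by (auto simp: T_def fun_eq_iff sum.delta if_distrib[of "\<lambda>x. x * _"] cong: if_cong)

text \<open>Without a relation the product map \<open>Q\<close> would embed
  \<open>Zn (Suc r)\<close> into \<open>Fit\<close>, against \<open>r_max\<close>.\<close>

lemma relation_W:
  assumes w: "\<And>i::nat. i \<le> r \<Longrightarrow> w i \<in> W"
  shows "\<exists>a::nat \<Rightarrow> int. (\<exists>i\<le>r. a i \<noteq> 0) \<and> (\<Sum>i\<le>r. of_int (a i) * w i) = 0"
proof (rule ccontr)
  assume no: "\<not> ?thesis"
  interpret F: comm_group "G\<lparr>carrier := Fit\<rparr>" by (rule comm_group_Fit)
  have "\<forall>i. \<exists>f. i \<le> r \<longrightarrow> f \<in> Fit \<and> \<iota> f = w i" using w WE by metis
  then obtain f where f: "\<And>i. i \<le> r \<Longrightarrow> f i \<in> Fit \<and> \<iota> (f i) = w i" by metis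
  define Q where "Q e = finprod (G\<lparr>carrier := Fit\<rparr>) (\<lambda>i. f i [^] (e i :: int)) {..r}" for e
  have c: "(\<lambda>i. f i [^] (e i :: int)) \<in> {..r} \<rightarrow> carrier (G\<lparr>carrier := Fit\<rparr>)" for e using f by auto
  have hom: "Q \<in> hom (Zn (Suc r)) (G\<lparr>carrier := Fit\<rparr>)"
  proof (rule homI)
    show "Q e \<in> carrier (G\<lparr>carrier := Fit\<rparr>)" for e unfolding Q_def by (rule F.finprod_closed[OF c])
    fix x y
    have "Q x \<otimes>\<^bsub>G\<lparr>carrier := Fit\<rparr>\<^esub> Q y
        = finprod (G\<lparr>carrier := Fit\<rparr>) (\<lambda>i. f i [^] x i \<otimes>\<^bsub>G\<lparr>carrier := Fit\<rparr>\<^esub> f i [^] y i) {..r}"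
      unfolding Q_def by (rule F.finprod_multf[OF c c, symmetric])
    also have "\<dots> = Q (x \<otimes>\<^bsub>Zn (Suc r)\<^esub> y)" unfolding Q_def
      using f Fit_carrier by (intro F.finprod_cong') (auto simp: int_pow_mult)
    finally show "Q (x \<otimes>\<^bsub>Zn (Suc r)\<^esub> y) = Q x \<otimes>\<^bsub>G\<lparr>carrier := Fit\<rparr>\<^esub> Q y" ..
  qed
  have \<iota>Q: "\<iota> (Q e) = (\<Sum>i\<le>r. of_int (e i) * w i)" for e
  proof -
    have "n \<le> r \<Longrightarrow> finprod (G\<lparr>carrier := Fit\<rparr>) (\<lambda>i. f i [^] e i) {..n} \<in> Fit \<and>
        \<iota> (finprod (G\<lparr>carrier := Fit\<rparr>) (\<lambda>i. f i [^] e i) {..n}) = (\<Sum>i\<le>n. of_int (e i) * w i)" for n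
    proof (induction n)
      case 0
      have "finprod (G\<lparr>carrier := Fit\<rparr>) (\<lambda>i. f i [^] e i) {..0} = f 0 [^] e 0"
        using f[of 0] F.finprod_insert[of "{}" 0 "\<lambda>i. f i [^] e i"] Fit_carrier by (simp add: atMost_0)
      then show ?case using f[of 0] by (simp add: \<iota>_int_pow)
    next
      case (Suc n)
      have "finprod (G\<lparr>carrier := Fit\<rparr>) (\<lambda>i. f i [^] e i) {..Suc n}
         = f (Suc n) [^] e (Suc n) \<otimes> finprod (G\<lparr>carrier := Fit\<rparr>) (\<lambda>i. f i [^] e i) {..n}"
        using f Suc.prems F.finprod_insert[of "{..n}" "Suc n" "\<lambda>i. f i [^] e i"] by (auto simp: atMost_Suc)
      moreover have "f (Suc n) [^] e (Suc n) \<in> Fit"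
        "\<iota> (f (Suc n) [^] e (Suc n)) = of_int (e (Suc n)) * w (Suc n)"
        using f[OF Suc.prems] by (simp_all add: \<iota>_int_pow)
      ultimately show ?case using Suc.IH Suc.prems by (simp only: \<iota>_mult Fit_closed sum.atMost_Suc add.commute)
    qed
    then show ?thesis unfolding Q_def by blast
  qed
  have "inj_on Q (carrier (Zn (Suc r)))"
    unfolding F.hom_Zn_inj_iff[OF hom]
  proof (intro ballI impI)
    fix e assume e: "e \<in> carrier (Zn (Suc r))" and "Q e = \<one>\<^bsub>G\<lparr>carrier := Fit\<rparr>\<^esub>"
    then have "(\<Sum>i\<le>r. of_int (e i) * w i) = 0" using \<iota>Q[of e] by (simp add: \<iota>_one)
    then have "\<forall>i\<le>r. e i = 0" using no by blast
    with e show "e = (\<lambda>_. 0)" by (intro ext) (metis Zn_simps(1) not_less_eq_eq)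
  qed
  from r_max[OF hom this] show False by simp
qed

sublocale lattice_action W L r G T
proof unfold_locales
  show "0 \<in> W" using \<iota>_mem[of \<one>] by (simp add: \<iota>_one)
  fix u v assume "u \<in> W" "v \<in> W"
  then obtain f f' where f: "f \<in> Fit" "u = \<iota> f" "f' \<in> Fit" "v = \<iota> f'" by (auto elim!: WE)
  then have eq: "u + v = \<iota> (f \<otimes> f')" by (simp add: \<iota>_mult)
  then show "u + v \<in> W" using f by simp
  show "L (u + v) \<le> L u + L v"
    unfolding eq using f l_mult[of f f'] Fit_commute[of f f'] Fit_carrier by simp
next
  fix u assume "u \<in> W"
  then obtain f where f: "f \<in> Fit" "u = \<iota> f" by (auto elim!: WE)
  then have "- u = \<iota> (inv f)" by (simp add: \<iota>_inv)
  then show "- u \<in> W" using f by simp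
  have "of_int k * u = \<iota> (f [^] k)" for k using f by (simp add: \<iota>_int_pow)
  then show "L (of_int k * u) = \<bar>real_of_int k\<bar> * L u" for k using f Fit_carrier by (simp add: l_int_pow)
  show "L u = 0 \<Longrightarrow> u = 0" using f l_eq_0[of f] Fit_carrier by (simp add: \<iota>_one)
  fix g assume g: "g \<in> carrier G"
  show "T g u \<in> W" "L (T g u) = L u" using f g Fit_carrier by (simp_all add: T_\<iota> Fit_conj l_conj)
next
  fix w :: "nat \<Rightarrow> nat \<Rightarrow> rat" assume "\<And>i. i \<le> r \<Longrightarrow> w i \<in> W"
  then show "\<exists>a::nat \<Rightarrow> int. (\<exists>i\<le>r. a i \<noteq> 0) \<and> (\<Sum>i\<le>r. of_int (a i) * w i) = 0" by (rule relation_W)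
next
  fix g u v assume "g \<in> carrier G"
  show "T g (u + v) = T g u + T g v" by (auto simp: T_def fun_eq_iff distrib_left sum.distrib)
next
  fix g h u assume gh: "g \<in> carrier G" "h \<in> carrier G"
  have "(\<Sum>j<r. M (g \<otimes> h) i j * u j) = (\<Sum>j<r. M g i j * (\<Sum>k<r. M h j k * u k))" for i
  proof -
    have "(\<Sum>j<r. M (g \<otimes> h) i j * u j) = (\<Sum>j<r. \<Sum>k<r. M g i k * M h k j * u j)"
      using gh by (simp add: M_mult sum_distrib_right)
    also have "\<dots> = (\<Sum>k<r. \<Sum>j<r. M g i k * M h k j * u j)" by (rule sum.swap)
    finally show ?thesis by (simp add: sum_distrib_left mult.assoc)
  qed
  then show "T (g \<otimes> h) u = T g (T h u)" by (auto simp: T_def fun_eq_iff)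
next
  show "T \<one> u = u" for u by (rule T_M_eq_1) (simp_all add: M_one)
qed

lemma T_Fit: assumes "f \<in> Fit" "w \<in> W" shows "T f w = w"
proof -
  obtain f' where f': "f' \<in> Fit" "w = \<iota> f'" using assms by (auto elim!: WE)
  have "f \<otimes> f' \<otimes> inv f = f'" using assms f' Fit_commute[of f f'] Fit_carrier by (simp add: m_assoc)
  then show ?thesis using assms f' by (simp add: T_\<iota> Fit_carrier)
qed

lemma T_\<iota>_fixed_iff:
  assumes "g \<in> carrier G" "f \<in> Fit" shows "T g (\<iota> f) = \<iota> f \<longleftrightarrow> g \<otimes> f = f \<otimes> g"
proof -
  have f: "f \<in> carrier G" using assms Fit_carrier by simp
  have "T g (\<iota> f) = \<iota> f \<longleftrightarrow> g \<otimes> f \<otimes> inv g = f" using assms by (simp add: T_\<iota> \<iota>_eq_iff Fit_conj)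
  also have "\<dots> \<longleftrightarrow> g \<otimes> f = f \<otimes> g" using assms f inv_solve_right'[of f "g \<otimes> f" g] by auto
  finally show ?thesis .
qed

text \<open>Together with \<open>T_Fit\<close> this identifies the kernel of the action as
  \<open>Fit\<close>. So \<open>G\<close> modulo \<open>Fit\<close> acts faithfully, and statements
  about operators become statements modulo \<open>Fit\<close>.\<close>

lemma Fit_of_T_trivial:
  assumes "g \<in> carrier G" "\<And>w. w \<in> W \<Longrightarrow> T g w = w" shows "g \<in> Fit"
  using assms T_\<iota>_fixed_iff[OF assms(1)] by (intro Fit_self_centralizing) auto

lemma comm_Fit_iff: "x \<in> carrier G \<Longrightarrow> y \<in> carrier G \<Longrightarrow> comm x y \<in> Fit \<longleftrightarrow> commT x y"
  using commT_comm_trivial[of x y] T_Fit Fit_of_T_trivial[OF comm_closed[of x y]] by blast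

lemma Fit_subset_near: "0 < \<epsilon> \<Longrightarrow> f \<in> Fit \<Longrightarrow> near \<epsilon> f"
  by (auto simp: near_def Fit_carrier T_Fit L_zero L_nonneg)

end

section \<open>Metabelian subgroups\<close>

locale metabelian_subgroup = fitting_coordinates +
  fixes K
  assumes K_subgroup: "subgroup K G" and Fit_K: "Fit \<subseteq> K"
    and comm_K: "\<And>x y. x \<in> K \<Longrightarrow> y \<in> K \<Longrightarrow> comm x y \<in> Fit"

context metabelian_subgroup
begin

lemma commT_of_K: "x \<in> K \<Longrightarrow> y \<in> K \<Longrightarrow> commT x y"
  using comm_K comm_Fit_iff subgroup.mem_carrier[OF K_subgroup] by blast

sublocale commuting_lattice_action W L r G T K
  by (intro commuting_lattice_action.intro commuting_lattice_action_axioms.intro lattice_action_axioms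
      K_subgroup commT_of_K)

text \<open>As a function of \<open>g\<close> on \<open>K\<close> this is a derivation for the
  action \<open>T\<close>; on \<open>Fit\<close> it is the operator \<open>T h - 1\<close>.\<close>

definition c :: "'a \<Rightarrow> 'a \<Rightarrow> nat \<Rightarrow> rat" where "c h g = \<iota> (comm h g)"

lemma c_mem: "h \<in> K \<Longrightarrow> g \<in> K \<Longrightarrow> c h g \<in> W"
  by (simp add: c_def comm_K)

lemma c_mult:
  assumes "h \<in> K" "g \<in> K" "g' \<in> K"
  shows "c h (g \<otimes> g') = c h g + T g (c h g')"
proof -
  have k: "h \<in> carrier G" "g \<in> carrier G" "g' \<in> carrier G" using assms K_carrier by auto
  have "comm h (g \<otimes> g') = comm h g \<otimes> (g \<otimes> comm h g' \<otimes> inv g)"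
    using k by (simp add: comm_def m_assoc inv_mult_group)
  then show ?thesis using assms k by (simp add: c_def \<iota>_mult T_\<iota> comm_K Fit_conj)
qed

lemma c_Fit:
  assumes "h \<in> K" "f \<in> Fit"
  shows "c h f = T h (\<iota> f) - \<iota> f"
  using assms K_carrier[of h] by (simp add: c_def comm_def \<iota>_mult \<iota>_inv T_\<iota> Fit_conj)

lemma c_pow:
  assumes "h \<in> K" "g \<in> K"
  shows "c h (g [^] (n::nat)) = (\<Sum>i<n. T (g [^] i) (c h g))"
proof (induction n)
  case 0
  then show ?case using assms K_carrier[of h] by (simp add: c_def comm_def \<iota>_one)
next
  case (Suc n)
  then show ?case using assms K_pow[of g] by (simp add: c_mult)
qed

text \<open>The length of \<open>[h, y\<^sup>n] = h (y\<^sup>n h\<^sup>-\<^sup>1 y\<^sup>-\<^sup>n)\<close> is bounded as soon as both factors commute.\<close>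

lemma null_comm_of_fixed:
  assumes h: "h \<in> K" and y: "y \<in> K" and fixed: "T h (c h y) = c h y"
  shows "null (c h y)"
proof (rule null_of_bounded[OF y])
  have hc: "h \<in> carrier G" and yc: "y \<in> carrier G" using h y K_carrier by auto
  show W: "c h y \<in> W" using h y by (rule c_mem)
  fix n :: nat
  define z where "z = comm h (y [^] n)"
  have zF: "z \<in> Fit" unfolding z_def using h y by (intro comm_K K_pow)
  have zc: "z \<in> carrier G" using zF by (rule Fit_carrier)
  have sum: "(\<Sum>i<n. T (y [^] i) (c h y)) = \<iota> z" using c_pow[OF h y, of n] by (simp add: z_def c_def)
  have "T h (\<iota> z) = (\<Sum>i<n. T h (T (y [^] i) (c h y)))" unfolding sum[symmetric] by (rule T_sum[OF hc])
  also have "\<dots> = (\<Sum>i<n. T (y [^] i) (T h (c h y)))"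
    using commT_K[OF h K_pow[OF y]] W by (simp add: commT_def)
  finally have "T h (\<iota> z) = \<iota> z" by (simp add: fixed sum)
  then have hz: "h \<otimes> z = z \<otimes> h" using T_\<iota>_fixed_iff[OF hc zF] by simp
  define p where "p = y [^] n \<otimes> inv h \<otimes> inv (y [^] n)"
  have p: "p \<in> carrier G" using hc yc by (simp add: p_def)
  have z: "z = h \<otimes> p" using hc yc by (simp add: z_def p_def comm_def m_assoc)
  have "h \<otimes> p = p \<otimes> h" using hz hc p unfolding z by (simp add: m_assoc)
  then have "l z \<le> l h + l p" unfolding z by (intro l_mult hc p)
  moreover have "l p = l h" unfolding p_def using hc yc by (simp add: l_conj l_inv)
  ultimately show "L (\<Sum>i<n. T (y [^] i) (c h y)) \<le> 2 * l h" using zF by (simp add: sum)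
qed

text \<open>Modulo null vectors, \<open>g \<mapsto> [h, g]\<close> is additive, and some power of \<open>g\<close> can be corrected by an
  element of the Fitting subgroup so that its commutator with \<open>h\<close> commutes with \<open>h\<close>.\<close>

lemma null_c:
  assumes h: "h \<in> K" and g: "g \<in> K"
  shows "null (c h g)"
proof -
  have hc: "h \<in> carrier G" and gc: "g \<in> carrier G" using h g K_carrier by auto
  define \<phi> where "\<phi> u = T h u - u" for u
  have \<phi>W: "\<phi> u \<in> W" if "u \<in> W" for u using hc that by (simp add: \<phi>_def diff_mem T_mem)
  have \<phi>_diff: "\<phi> (u - u') = \<phi> u - \<phi> u'" for u u' using hc by (simp add: \<phi>_def T_diff)
  have \<phi>_scale: "\<phi> (of_nat k * u) = of_nat k * \<phi> u" for k u
    using hc by (simp add: \<phi>_def T_scale_nat right_diff_distrib)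
  have cW: "c h g \<in> W" using h g by (rule c_mem)
  obtain m w where mw: "(m::nat) > 0" "w \<in> W" "\<phi> (of_nat m * c h g) = \<phi> (\<phi> w)"
    using kernel_image_decomposition[OF h cW] unfolding \<phi>_def by blast
  \<comment> \<open>The correction of \<open>g\<close> would call for \<open>w / m\<close>, which
    may be missing from \<open>W\<close>. For \<open>g^k\<close> the vector required is the orbit
    sum of \<open>w\<close> divided by \<open>m\<close>, and \<open>k\<close> is chosen so that it
    exists.\<close>
  obtain k u where k: "(k::nat) > 0" "u \<in> W" "(\<Sum>i<k. T (g [^] i) w) = of_nat m * u"
    using orbit_sum_divisible[OF g mw(2,1)] by blast
  obtain f where f: "f \<in> Fit" "u = \<iota> f" using k(2) by (rule WE)
  define \<sigma> where "\<sigma> v = (\<Sum>i<k. T (g [^] i) v)" for v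
  have \<sigma>\<phi>: "\<sigma> (\<phi> v) = \<phi> (\<sigma> v)" if "v \<in> W" for v
    using commT_K[OF h K_pow[OF g]] hc gc that
    by (simp add: \<sigma>_def \<phi>_def T_sum T_diff sum_subtractf commT_def)
  have \<sigma>_scale: "\<sigma> (of_nat n * v) = of_nat n * \<sigma> v" for n v
    using gc by (simp add: \<sigma>_def T_scale_nat sum_distrib_left)
  have \<sigma>W: "\<sigma> v \<in> W" if "v \<in> W" for v unfolding \<sigma>_def using gc that by (intro sum_mem T_mem) auto
  \<comment> \<open>The factor \<open>inv f\<close> subtracts \<open>\<phi> u\<close> from
    \<open>\<sigma> (c h g)\<close>. Then \<open>m\<close> times \<open>\<phi> (c h y)\<close> is
    \<open>\<sigma> (\<phi> (\<phi> w)) - \<phi> (\<phi> (\<sigma> w))\<close>, which is 0 because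
    the operators of \<open>K\<close> commute.\<close>
  define y where "y = inv f \<otimes> g [^] k"
  have fK: "inv f \<in> K" using f Fit_K by auto
  have y: "y \<in> K" unfolding y_def using fK g by (intro subgroup.m_closed[OF K] K_pow)
  have "c h y = c h (inv f) + T (inv f) (c h (g [^] k))"
    unfolding y_def using h fK K_pow[OF g] by (rule c_mult)
  also have "T (inv f) (c h (g [^] k)) = c h (g [^] k)"
    using f h g by (intro T_Fit c_mem K_pow) auto
  also have "c h (inv f) = - \<phi> u" using c_Fit[OF h, of "inv f"] f hc by (simp add: \<iota>_inv T_uminus \<phi>_def)
  also have "c h (g [^] k) = \<sigma> (c h g)" unfolding \<sigma>_def by (rule c_pow[OF h g])
  finally have chy: "c h y = \<sigma> (c h g) - \<phi> u" by (simp only: uminus_add_conv_diff)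
  have "of_nat m * \<phi> (c h y) = \<phi> (\<sigma> (of_nat m * c h g)) - \<phi> (\<phi> (of_nat m * u))"
    by (simp add: chy \<phi>_diff \<phi>_scale \<sigma>_scale right_diff_distrib)
  also have "\<phi> (\<sigma> (of_nat m * c h g)) = \<sigma> (\<phi> (\<phi> w))"
    using cW mw by (simp add: \<sigma>\<phi>[symmetric] scale_nat_mem)
  also have "\<dots> = \<phi> (\<phi> (\<sigma> w))" using mw(2) by (simp add: \<sigma>\<phi> \<phi>W)
  also have "\<sigma> w = of_nat m * u" using k(3) by (simp add: \<sigma>_def)
  finally have "of_int (int m) * \<phi> (c h y) = 0" by (simp only: diff_self of_int_of_nat_eq)
  then have "\<phi> (c h y) = 0" using scale_eq_0[OF \<phi>W[OF c_mem[OF h y]], of "int m"] mw(1) by simp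
  then have "null (c h y)" using null_comm_of_fixed[OF h y] by (simp add: \<phi>_def)
  moreover have "null (\<phi> u)" unfolding \<phi>_def using h k(2) by (rule null_move)
  ultimately have "null (\<sigma> (c h g))" using null_add[of "c h y" "\<phi> u"] by (simp add: chy)
  \<comment> \<open>Modulo null vectors the operators of \<open>K\<close> are trivial, so the orbit
    sum of \<open>c h g\<close> may be replaced by \<open>k\<close> times
    \<open>c h g\<close>.\<close>
  moreover have "null (\<Sum>i<k. T (g [^] i) (c h g) - c h g)"
    by (intro null_sum null_move K_pow g cW)
  ultimately have "null (\<sigma> (c h g) - (\<Sum>i<k. T (g [^] i) (c h g) - c h g))" by (rule null_diff)
  moreover have "\<sigma> (c h g) - (\<Sum>i<k. T (g [^] i) (c h g) - c h g) = of_int (int k) * c h g"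
    by (simp add: \<sigma>_def sum_subtractf)
  ultimately show ?thesis using null_scale_cancel[OF cW, of "int k"] k(1) by simp
qed

lemma derived_K: "derived G K \<subseteq> Fit" "x \<in> derived G K \<Longrightarrow> null (\<iota> x)"
proof -
  have K_c: "K \<subseteq> carrier G" using K_carrier by auto
  define N where "N x \<longleftrightarrow> x \<in> Fit \<and> null (\<iota> x)" for x
  have N_comm: "N x" "N (inv x)" if x: "x \<in> derived_set G K" for x
  proof -
    obtain h g where hg: "h \<in> K" "g \<in> K" "x = comm h g" using x by (auto simp: comm_def)
    then have "x \<in> Fit" "null (\<iota> x)" using null_c[OF hg(1,2)] comm_K by (simp_all add: c_def)
    then show "N x" "N (inv x)" using null_uminus by (simp_all add: N_def \<iota>_inv)
  qed
  have "N x" if "x \<in> derived G K" for x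
    using that unfolding derived_def
  proof (induction rule: generate.induct)
    case one
    show ?case using null_zero by (simp add: N_def \<iota>_one)
  next
    case (eng x y)
    then show ?case using null_add by (simp add: N_def \<iota>_mult)
  qed (rule N_comm; assumption)+
  then show "derived G K \<subseteq> Fit" "x \<in> derived G K \<Longrightarrow> null (\<iota> x)"
    by (auto simp: N_def)
qed

text \<open>The power in \<open>derived G K\<close> is null, and being central it is fixed by all of
  \<open>K\<close>; the only null fixed vector is 0.\<close>

lemma central_torsion_mod_derived:
  assumes z: "z \<in> Fit" and cent: "\<And>x. x \<in> K \<Longrightarrow> x \<otimes> z = z \<otimes> x"
    and pow: "(N::nat) > 0" "z [^] N \<in> derived G K"
  shows "z = \<one>"
proof -
  have zc: "z \<in> carrier G" using z by (rule Fit_carrier)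
  have "T x (\<iota> (z [^] N)) = \<iota> (z [^] N)" if x: "x \<in> K" for x
  proof -
    have xc: "x \<in> carrier G" using x by (rule K_carrier)
    have "x \<otimes> z [^] n = z [^] n \<otimes> x" for n :: nat
      by (induction n) (use xc zc cent[OF x] in \<open>auto intro!: mult_commute\<close>)
    then show ?thesis using T_\<iota>_fixed_iff[OF xc] z by simp
  qed
  then have "\<iota> (z [^] N) = 0" using null_fixed derived_K(2)[OF pow(2)] by blast
  then have "z [^] N = \<one>" using z by (simp add: \<iota>_eq_0)
  then show ?thesis using pow_eq_one[OF zc pow(1)] by simp
qed

end

section \<open>Passing to finitely generated abelian quotients\<close>

context group
begin

text \<open>The quotient is handed over as an abstract group with a projection, to which the facts
  on finitely generated abelian groups apply. It is used twice, with \<open>Fit\<close> and with the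
  derived subgroup as kernel.\<close>

lemma abelian_quotient:
  assumes H: "subgroup H G" and F: "subgroup F G" and FH: "F \<subseteq> H"
    and comm: "\<And>x y. x \<in> H \<Longrightarrow> y \<in> H \<Longrightarrow> comm x y \<in> F" and fg: "fg_subgroup G H"
  obtains A :: "'a set monoid" and \<pi> where "comm_group A" "\<pi> \<in> hom (G\<lparr>carrier := H\<rparr>) A"
    "\<pi> ` H = carrier A" "\<And>x. x \<in> H \<Longrightarrow> \<pi> x = \<one>\<^bsub>A\<^esub> \<longleftrightarrow> x \<in> F"
    "\<exists>S. finite S \<and> S \<subseteq> carrier A \<and> generate A S = carrier A"
proof -
  interpret H: subgroup H G by (rule H)
  let ?H = "G\<lparr>carrier := H\<rparr>"
  interpret Hg: group ?H by (rule subgroup_imp_group[OF H])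
  have Fsub: "subgroup F ?H" by (rule subgroup_incl[OF F H FH])
  have norm: "F \<lhd> ?H"
    unfolding Hg.normal_inv_iff
  proof (intro conjI Fsub ballI)
    fix x f assume x: "x \<in> carrier ?H" and f: "f \<in> F"
    then have xH: "x \<in> H" "x \<in> carrier G" "f \<in> carrier G" "f \<in> H" using FH by auto
    have "comm x f \<otimes> f \<in> F" using comm[OF xH(1,4)] f by (rule subgroup.m_closed[OF F])
    then have "x \<otimes> f \<otimes> inv x \<in> F" using xH by (simp add: comm_def m_assoc)
    then show "x \<otimes>\<^bsub>?H\<^esub> f \<otimes>\<^bsub>?H\<^esub> inv\<^bsub>?H\<^esub> x \<in> F" using xH by (simp add: m_inv_consistent[OF H])
  qed
  interpret N: normal F ?H by (rule norm)
  let ?A = "?H Mod F"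
  let ?\<pi> = "\<lambda>x. F #>\<^bsub>?H\<^esub> x"
  have hom: "?\<pi> \<in> hom ?H ?A" by (rule N.r_coset_hom_Mod)
  have img: "?\<pi> ` H = carrier ?A" using carrier_FactGroup[of ?H F] by simp
  interpret A: group ?A by (rule N.factorgroup_is_group)
  interpret \<pi>: group_hom ?H ?A ?\<pi>
    by (intro group_hom.intro group_hom_axioms.intro hom Hg.is_group A.is_group)
  have ker: "?\<pi> x = \<one>\<^bsub>?A\<^esub> \<longleftrightarrow> x \<in> F" if "x \<in> H" for x
    using that Hg.coset_join1[OF _ _ Fsub, of x] Hg.coset_join2[OF _ Fsub, of x] FH by auto
  have "comm_group ?A"
  proof (rule A.group_comm_groupI)
    fix a b assume ab: "a \<in> carrier ?A" "b \<in> carrier ?A"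
    obtain x where x: "a = ?\<pi> x" "x \<in> H" using ab(1) unfolding img[symmetric] by (rule imageE)
    obtain y where y: "b = ?\<pi> y" "y \<in> H" using ab(2) unfolding img[symmetric] by (rule imageE)
    note xy = x(2) y(2) x(1) y(1)
    have "x \<otimes> y = comm x y \<otimes> (y \<otimes> x)" using xy by (simp add: comm_mult)
    then have "?\<pi> (x \<otimes> y) = ?\<pi> (comm x y) \<otimes>\<^bsub>?A\<^esub> ?\<pi> (y \<otimes> x)"
      using \<pi>.hom_mult[of "comm x y" "y \<otimes> x"] xy FH comm[OF xy(1,2)] by auto
    also have "?\<pi> (comm x y) = \<one>\<^bsub>?A\<^esub>" using ker[of "comm x y"] comm[OF xy(1,2)] FH by auto
    also have "\<one>\<^bsub>?A\<^esub> \<otimes>\<^bsub>?A\<^esub> ?\<pi> (y \<otimes> x) = ?\<pi> (y \<otimes> x)"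
      by (rule A.l_one, rule \<pi>.hom_closed) (use xy in simp)
    finally have "?\<pi> (x \<otimes> y) = ?\<pi> (y \<otimes> x)" .
    then show "a \<otimes>\<^bsub>?A\<^esub> b = b \<otimes>\<^bsub>?A\<^esub> a"
      using \<pi>.hom_mult[of x y] \<pi>.hom_mult[of y x] xy by simp
  qed
  moreover have "\<exists>S. finite S \<and> S \<subseteq> carrier ?A \<and> generate ?A S = carrier ?A"
  proof -
    obtain S where S: "finite S" "S \<subseteq> H" "generate G S = H" using fg unfolding fg_subgroup_def by blast
    have "generate ?H S = H" using generate_consistent[OF S(2) H] S(3) by simp
    then have "generate ?A (?\<pi> ` S) = carrier ?A" using \<pi>.generate_img[of S] S(2) img by simp
    moreover have "?\<pi> ` S \<subseteq> carrier ?A" using S(2) img by blast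
    ultimately show ?thesis using S(1) by blast
  qed
  ultimately show ?thesis using hom img ker by (intro that[of ?A ?\<pi>]) auto
qed

lemma cofinite_preimage:
  assumes H: "subgroup H G" and A: "group A" and \<pi>: "\<pi> \<in> hom (G\<lparr>carrier := H\<rparr>) A"
    and img: "\<pi> ` H = carrier A" and B: "subgroup B A" and co: "cofinite_in A (carrier A) B"
  shows "cofinite_in G H {x \<in> H. \<pi> x \<in> B}"
proof -
  interpret A: group A by (rule A)
  interpret H: subgroup H G by (rule H)
  have mult: "\<pi> (x \<otimes> y) = \<pi> x \<otimes>\<^bsub>A\<^esub> \<pi> y" if "x \<in> H" "y \<in> H" for x y
    using hom_mult[OF \<pi>] that by simp
  have closed: "\<pi> x \<in> carrier A" if "x \<in> H" for x using img that by blast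
  obtain R where R: "finite R" "R \<subseteq> carrier A" "carrier A \<subseteq> (\<Union>t\<in>R. B #>\<^bsub>A\<^esub> t)"
    using co unfolding cofinite_in_def by blast
  obtain R' where R': "R' \<subseteq> H" "finite R'" "R = \<pi> ` R'"
    using finite_subset_image[OF R(1), of \<pi> H] R(2) img by auto
  show ?thesis unfolding cofinite_in_def
  proof (intro exI[of _ R'] conjI subsetI)
    fix x assume x: "x \<in> H"
    then obtain t where t: "t \<in> R'" "\<pi> x \<in> B #>\<^bsub>A\<^esub> \<pi> t" using R(3) R'(3) closed[OF x] by blast
    then obtain b where b: "b \<in> B" "\<pi> x = b \<otimes>\<^bsub>A\<^esub> \<pi> t" unfolding r_coset_def by blast
    have tH: "t \<in> H" using t R' by auto
    have bA: "b \<in> carrier A" using b subgroup.mem_carrier[OF B] by auto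
    have "x = (x \<otimes> inv t) \<otimes> t" using x tH by (simp add: m_assoc)
    moreover have "\<pi> (x \<otimes> inv t) = b"
    proof -
      have "\<pi> (x \<otimes> inv t) \<otimes>\<^bsub>A\<^esub> \<pi> t = b \<otimes>\<^bsub>A\<^esub> \<pi> t"
        using mult[of "x \<otimes> inv t" t] x tH b(2) by (simp add: m_assoc)
      then show ?thesis using A.r_cancel[of "\<pi> (x \<otimes> inv t)" "\<pi> t" b] closed x tH bA by simp
    qed
    ultimately show "x \<in> (\<Union>t\<in>R'. {x \<in> H. \<pi> x \<in> B} #> t)"
      using t(1) x tH b(1) unfolding r_coset_def by auto
  qed (use R' in auto)
qed

end

section \<open>A subgroup of finite index with free abelian quotient by \<open>Fit\<close>\<close>

context fitting_coordinates
begin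

text \<open>Every positive radius gives finite index; 1/4 is the one for which
  \<open>near_commT_of_solvable\<close> makes the generators commute as operators.\<close>

definition \<Delta> :: "'a set" where "\<Delta> = generate G {g. near (1/4) g}"

lemma \<Delta>_subgroup: "subgroup \<Delta> G"
  unfolding \<Delta>_def by (intro generate_is_subgroup) (auto dest: near_closed)

lemma Fit_\<Delta>: "Fit \<subseteq> \<Delta>"
  unfolding \<Delta>_def using Fit_subset_near[of "1/4"] by (auto intro: generate.incl)

lemma comm_\<Delta>: assumes "x \<in> \<Delta>" "y \<in> \<Delta>" shows "comm x y \<in> Fit"
proof -
  obtain n where n: "(derived G ^^ n) (carrier G) = {\<one>}" using derived_trivial by blast
  have "commT x y"
  proof (rule commT_generate)
    show "{g. near (1/4) g} \<subseteq> carrier G" using near_closed by blast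
    show "commT x y" if "x \<in> {g. near (1/4) g}" "y \<in> {g. near (1/4) g}" for x y
      using near_commT_of_solvable[OF n] that by blast
  qed (use assms in \<open>simp_all add: \<Delta>_def\<close>)
  then show ?thesis using assms comm_Fit_iff subgroup.mem_carrier[OF \<Delta>_subgroup] by blast
qed

lemma cofinite_\<Delta>: "cofinite_in G (carrier G) \<Delta>"
  unfolding \<Delta>_def by (rule cofinite_near) simp

text \<open>\<open>\<Delta>\<close> modulo \<open>Fit\<close> is a finitely generated abelian group.
  \<open>K\<close> is the preimage of a free subgroup of finite index in it, and
  \<open>\<chi>\<close> reads off the coordinates in that free group.\<close>

lemma free_abelian_by_abelian:
  assumes fg: "fg_subgroup G (carrier G)"
  obtains K n \<chi> where "metabelian_subgroup G l r P \<iota> K" "cofinite_in G (carrier G) K" "fg_subgroup G K"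
    "\<chi> \<in> hom (G\<lparr>carrier := K\<rparr>) (Zn n)" "\<chi> ` K = carrier (Zn n)"
    "\<And>x. x \<in> K \<Longrightarrow> \<chi> x = (\<lambda>_. 0) \<longleftrightarrow> x \<in> Fit"
proof -
  have \<Delta>c: "\<Delta> \<subseteq> carrier G" by (rule subgroup.subset[OF \<Delta>_subgroup])
  have fg\<Delta>: "fg_subgroup G \<Delta>"
    by (rule fg_subgroup_cofinite[OF \<Delta>_subgroup subgroup_self \<Delta>c fg cofinite_\<Delta>])
  obtain A :: "'a set monoid" and \<pi> where A: "comm_group A" "\<pi> \<in> hom (G\<lparr>carrier := \<Delta>\<rparr>) A"
    "\<pi> ` \<Delta> = carrier A" "\<And>x. x \<in> \<Delta> \<Longrightarrow> \<pi> x = \<one>\<^bsub>A\<^esub> \<longleftrightarrow> x \<in> Fit"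
    "\<exists>S. finite S \<and> S \<subseteq> carrier A \<and> generate A S = carrier A"
    using abelian_quotient[OF \<Delta>_subgroup Fit_subgroup Fit_\<Delta> comm_\<Delta> fg\<Delta>] by blast
  interpret A: comm_group A by (rule A(1))
  interpret \<pi>: group_hom "G\<lparr>carrier := \<Delta>\<rparr>" A \<pi>
    by (simp add: group_hom_def group_hom_axioms_def A(2) A.is_group subgroup_imp_group[OF \<Delta>_subgroup])
  obtain S where S: "finite S" "S \<subseteq> carrier A" "generate A S = carrier A" using A(5) by blast
  obtain n Q N where Q: "Q \<in> hom (Zn n) A" "inj_on Q (carrier (Zn n))" "(N::nat) > 0"
    "\<forall>a\<in>generate A S. a [^]\<^bsub>A\<^esub> N \<in> Q ` carrier (Zn n)"
    using A.free_part[OF S(1,2)] by blast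
  define B where "B = Q ` carrier (Zn n)"
  have B: "subgroup B A" unfolding B_def by (rule A.image_subgroup_Zn[OF Q(1)])
  define K where "K = {x \<in> \<Delta>. \<pi> x \<in> B}"
  have Kc: "K \<subseteq> \<Delta>" by (auto simp: K_def)
  have mult: "\<pi> (x \<otimes> y) = \<pi> x \<otimes>\<^bsub>A\<^esub> \<pi> y" if "x \<in> \<Delta>" "y \<in> \<Delta>" for x y
    using \<pi>.hom_mult that by simp
  have KG: "subgroup K G"
  proof (rule subgroupI)
    show "K \<subseteq> carrier G" using Kc \<Delta>c by auto
    have "\<one> \<in> K" using \<pi>.hom_one subgroup.one_closed[OF B] subgroup.one_closed[OF \<Delta>_subgroup]
      by (simp add: K_def)
    then show "K \<noteq> {}" by auto
    show "inv x \<in> K" if "x \<in> K" for x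
      using that \<pi>.hom_inv[of x] subgroup.m_inv_closed[OF B] subgroup.m_inv_closed[OF \<Delta>_subgroup]
      by (auto simp: K_def m_inv_consistent[OF \<Delta>_subgroup])
    show "x \<otimes> y \<in> K" if "x \<in> K" "y \<in> K" for x y
      using that mult subgroup.m_closed[OF B] subgroup.m_closed[OF \<Delta>_subgroup] by (auto simp: K_def)
  qed
  have "cofinite_in A (carrier A) B"
    using A.cofinite_of_torsion[OF S B Q(3)] Q(4) S(3) by (simp add: B_def)
  then have co: "cofinite_in G \<Delta> K"
    unfolding K_def by (rule cofinite_preimage[OF \<Delta>_subgroup A.is_group A(2,3) B])
  have coG: "cofinite_in G (carrier G) K"
    by (rule cofinite_in_trans[OF order_refl \<Delta>c Kc subgroup_self cofinite_\<Delta> co])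
  have fgK: "fg_subgroup G K" by (rule fg_subgroup_cofinite[OF KG \<Delta>_subgroup Kc fg\<Delta> co])
  have FK: "Fit \<subseteq> K"
  proof
    fix x assume x: "x \<in> Fit"
    then have "x \<in> \<Delta>" using Fit_\<Delta> by blast
    moreover from this x have "\<pi> x = \<one>\<^bsub>A\<^esub>" using A(4) by blast
    ultimately show "x \<in> K" using subgroup.one_closed[OF B] by (simp add: K_def)
  qed
  define \<chi> where "\<chi> x = the_inv_into (carrier (Zn n)) Q (\<pi> x)" for x
  have \<chi>: "\<chi> x \<in> carrier (Zn n)" "Q (\<chi> x) = \<pi> x" if "x \<in> K" for x
    using that the_inv_into_into[OF Q(2), of "\<pi> x" "carrier (Zn n)"] f_the_inv_into_f[OF Q(2), of "\<pi> x"]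
    unfolding \<chi>_def K_def B_def by blast+
  have \<chi>_eq: "\<chi> x = e" if "x \<in> K" "e \<in> carrier (Zn n)" "Q e = \<pi> x" for x e
    using inj_onD[OF Q(2), of "\<chi> x" e] \<chi>[OF that(1)] that by metis
  have "metabelian_subgroup G l r P \<iota> K"
    using KG FK comm_\<Delta> Kc
    by (intro metabelian_subgroup.intro metabelian_subgroup_axioms.intro fitting_coordinates_axioms) blast+
  moreover have "\<chi> \<in> hom (G\<lparr>carrier := K\<rparr>) (Zn n)"
  proof (rule homI)
    show "\<chi> x \<in> carrier (Zn n)" if "x \<in> carrier (G\<lparr>carrier := K\<rparr>)" for x using \<chi>(1) that by simp
    fix x y assume "x \<in> carrier (G\<lparr>carrier := K\<rparr>)" "y \<in> carrier (G\<lparr>carrier := K\<rparr>)"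
    then have xy: "x \<in> K" "y \<in> K" by auto
    have "Q (\<chi> x \<otimes>\<^bsub>Zn n\<^esub> \<chi> y) = \<pi> (x \<otimes> y)"
      using hom_mult[OF Q(1) \<chi>(1)[OF xy(1)] \<chi>(1)[OF xy(2)]] \<chi>(2) mult[of x y] xy Kc by auto
    then show "\<chi> (x \<otimes>\<^bsub>G\<lparr>carrier := K\<rparr>\<^esub> y) = \<chi> x \<otimes>\<^bsub>Zn n\<^esub> \<chi> y"
      using \<chi>(1)[OF xy(1)] \<chi>(1)[OF xy(2)] subgroup.m_closed[OF KG xy] by (intro \<chi>_eq) simp_all
  qed
  moreover have "\<chi> ` K = carrier (Zn n)"
  proof
    show "\<chi> ` K \<subseteq> carrier (Zn n)" using \<chi>(1) by blast
    show "carrier (Zn n) \<subseteq> \<chi> ` K"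
    proof
      fix e assume e: "e \<in> carrier (Zn n)"
      then have "Q e \<in> carrier A" using hom_in_carrier[OF Q(1)] by blast
      then obtain x where x: "x \<in> \<Delta>" "\<pi> x = Q e" using A(3) by (metis imageE)
      then have "x \<in> K" using e by (simp add: K_def B_def del: Zn_simps)
      then have "\<chi> x = e" using e x by (intro \<chi>_eq) auto
      with \<open>x \<in> K\<close> show "e \<in> \<chi> ` K" by blast
    qed
  qed
  moreover have "\<chi> x = (\<lambda>_. 0) \<longleftrightarrow> x \<in> Fit" if x: "x \<in> K" for x
  proof -
    have Q0: "Q (\<lambda>_. 0) = \<one>\<^bsub>A\<^esub>" using A.hom_Zn_zero[OF Q(1)] .
    have "\<chi> x = (\<lambda>_. 0) \<longleftrightarrow> \<pi> x = \<one>\<^bsub>A\<^esub>"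
      using \<chi>(2)[OF x] Q0 \<chi>_eq[OF x, of "\<lambda>_. 0"] by auto
    then show ?thesis using A(4)[of x] x Kc by auto
  qed
  ultimately show ?thesis using coG fgK by (intro that[of K \<chi> n])
qed

end

text \<open>\<open>\<psi>\<close> projects to \<open>K\<close> modulo its derived subgroup, takes
  the \<open>N\<close>-th power and reads off coordinates in a free subgroup. So
  \<open>\<psi> z = 0\<close> puts \<open>z^N\<close> into the derived subgroup, which
  \<open>central_torsion_mod_derived\<close> forbids for nontrivial central \<open>z\<close> in
  \<open>Fit\<close>.\<close>

lemma (in metabelian_subgroup) central_separating_hom:
  assumes fg: "fg_subgroup G K"
  obtains t \<psi> where "\<psi> \<in> hom (G\<lparr>carrier := K\<rparr>) (Zn t)"
    "\<And>z. z \<in> Fit \<Longrightarrow> (\<And>x. x \<in> K \<Longrightarrow> x \<otimes> z = z \<otimes> x) \<Longrightarrow> \<psi> z = (\<lambda>_. 0) \<Longrightarrow> z = \<one>"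
proof -
  have Kc: "K \<subseteq> carrier G" using K_carrier by auto
  have D: "subgroup (derived G K) G" by (rule derived_is_subgroup[OF Kc])
  have DK: "derived G K \<subseteq> K" by (rule derived_incl[OF _ K]) simp
  have cD: "comm x y \<in> derived G K" if "x \<in> K" "y \<in> K" for x y
    unfolding derived_def comm_def using that by (intro generate.incl) blast
  obtain A :: "'a set monoid" and \<pi> where A: "comm_group A" "\<pi> \<in> hom (G\<lparr>carrier := K\<rparr>) A"
    "\<pi> ` K = carrier A" "\<And>x. x \<in> K \<Longrightarrow> \<pi> x = \<one>\<^bsub>A\<^esub> \<longleftrightarrow> x \<in> derived G K"
    "\<exists>S. finite S \<and> S \<subseteq> carrier A \<and> generate A S = carrier A"
    using abelian_quotient[OF K D DK cD fg] by blast
  interpret A: comm_group A by (rule A(1))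
  interpret \<pi>: group_hom "G\<lparr>carrier := K\<rparr>" A \<pi>
    by (simp add: group_hom_def group_hom_axioms_def A(2) A.is_group subgroup_imp_group[OF K])
  obtain S where S: "finite S" "S \<subseteq> carrier A" "generate A S = carrier A" using A(5) by blast
  obtain n Q N where Q: "Q \<in> hom (Zn n) A" "inj_on Q (carrier (Zn n))" "(N::nat) > 0"
    "\<forall>a\<in>generate A S. a [^]\<^bsub>A\<^esub> N \<in> Q ` carrier (Zn n)"
    using A.free_part[OF S(1,2)] by blast
  define \<psi> where "\<psi> x = the_inv_into (carrier (Zn n)) Q (\<pi> x [^]\<^bsub>A\<^esub> N)" for x
  have \<pi>c: "\<pi> x \<in> carrier A" if "x \<in> K" for x using A(3) that by blast
  have img: "\<pi> x [^]\<^bsub>A\<^esub> N \<in> Q ` carrier (Zn n)" if "x \<in> K" for x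
    using \<pi>c[OF that] Q(4) S(3) by blast
  have \<psi>: "\<psi> x \<in> carrier (Zn n)" "Q (\<psi> x) = \<pi> x [^]\<^bsub>A\<^esub> N" if "x \<in> K" for x
    using img[OF that] the_inv_into_into[OF Q(2), of "\<pi> x [^]\<^bsub>A\<^esub> N" "carrier (Zn n)"]
      f_the_inv_into_f[OF Q(2), of "\<pi> x [^]\<^bsub>A\<^esub> N"]
    unfolding \<psi>_def by blast+
  have "\<psi> \<in> hom (G\<lparr>carrier := K\<rparr>) (Zn n)"
  proof (rule homI)
    show "\<psi> x \<in> carrier (Zn n)" if "x \<in> carrier (G\<lparr>carrier := K\<rparr>)" for x using \<psi>(1) that by simp
    fix x y assume "x \<in> carrier (G\<lparr>carrier := K\<rparr>)" "y \<in> carrier (G\<lparr>carrier := K\<rparr>)"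
    then have xy: "x \<in> K" "y \<in> K" "x \<otimes> y \<in> K" using subgroup.m_closed[OF K] by auto
    have "Q (\<psi> x \<otimes>\<^bsub>Zn n\<^esub> \<psi> y) = \<pi> x [^]\<^bsub>A\<^esub> N \<otimes>\<^bsub>A\<^esub> \<pi> y [^]\<^bsub>A\<^esub> N"
      using hom_mult[OF Q(1) \<psi>(1)[OF xy(1)] \<psi>(1)[OF xy(2)]] \<psi>(2) xy by simp
    also have "\<dots> = \<pi> (x \<otimes> y) [^]\<^bsub>A\<^esub> N"
      using \<pi>.hom_mult[of x y] \<pi>c xy by (simp add: A.nat_pow_distrib)
    also have "\<dots> = Q (\<psi> (x \<otimes> y))" using \<psi>(2)[OF xy(3)] by simp
    finally show "\<psi> (x \<otimes>\<^bsub>G\<lparr>carrier := K\<rparr>\<^esub> y) = \<psi> x \<otimes>\<^bsub>Zn n\<^esub> \<psi> y"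
      using inj_onD[OF Q(2), of "\<psi> x \<otimes>\<^bsub>Zn n\<^esub> \<psi> y" "\<psi> (x \<otimes> y)"] \<psi>(1)[OF xy(1)] \<psi>(1)[OF xy(2)] \<psi>(1)[OF xy(3)]
      by simp
  qed
  moreover have "z = \<one>" if z: "z \<in> Fit" "\<And>x. x \<in> K \<Longrightarrow> x \<otimes> z = z \<otimes> x" "\<psi> z = (\<lambda>_. 0)" for z
  proof -
    have zK: "z \<in> K" using z Fit_K by auto
    have "\<pi> (z [^] N) = \<pi> z [^]\<^bsub>A\<^esub> N"
      using \<pi>.hom_nat_pow[of z N] zK nat_pow_consistent[of z N] by simp
    also have "\<dots> = \<one>\<^bsub>A\<^esub>" using \<psi>(2)[OF zK] z(3) A.hom_Zn_zero[OF Q(1)] by simp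
    finally have "z [^] N \<in> derived G K" using A(4) K_pow[OF zK] by blast
    then show ?thesis using central_torsion_mod_derived[OF z(1) z(2) Q(3)] by blast
  qed
  ultimately show ?thesis by (rule that)
qed

section \<open>Embeddings into semidirect products and linear groups\<close>

text \<open>A derivation \<open>\<delta>\<close> over \<open>\<chi>\<close> is the same as a
  homomorphism from \<open>g\<close> to \<open>(\<delta> g, \<chi> g)\<close>. \<open>V\<close> need
  not be finitely generated, so it is cut down to the submodule \<open>H0\<close> generated by the
  values of \<open>\<delta>\<close> on the generators; the derivation rule keeps all values inside.
  Countability allows the module to be moved to the type \<open>nat\<close>.\<close>

lemma semidirect_embedding:
  fixes K :: "('k, 'e) monoid_scheme" and V :: "'v monoid"
  assumes K: "group K" and S: "finite S" "S \<subseteq> carrier K" "generate K S = carrier K"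
    and V: "comm_group V" and countable: "countable (carrier V)"
    and act_hom: "\<And>v. v \<in> carrier (Zn d) \<Longrightarrow> act v \<in> hom V V"
    and act_zero: "\<And>x. x \<in> carrier V \<Longrightarrow> act (\<lambda>_. 0) x = x"
    and act_add: "\<And>v w x. v \<in> carrier (Zn d) \<Longrightarrow> w \<in> carrier (Zn d) \<Longrightarrow> x \<in> carrier V \<Longrightarrow>
      act (\<lambda>i. v i + w i) x = act v (act w x)"
    and \<chi>: "\<chi> \<in> hom K (Zn d)"
    and \<delta>_closed: "\<And>g. g \<in> carrier K \<Longrightarrow> \<delta> g \<in> carrier V"
    and \<delta>_mult: "\<And>g h. g \<in> carrier K \<Longrightarrow> h \<in> carrier K \<Longrightarrow>
      \<delta> (g \<otimes>\<^bsub>K\<^esub> h) = \<delta> g \<otimes>\<^bsub>V\<^esub> act (\<chi> g) (\<delta> h)"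
    and inj: "\<And>g. g \<in> carrier K \<Longrightarrow> \<chi> g = (\<lambda>_. 0) \<Longrightarrow> \<delta> g = \<one>\<^bsub>V\<^esub> \<Longrightarrow> g = \<one>\<^bsub>K\<^esub>"
  shows "\<exists>(H :: nat monoid) rho. fg_ZZn_module d H rho \<and> embeds_into K (semidirect d H rho)"
proof -
  interpret K: group K by (rule K)
  interpret V: comm_group V by (rule V)
  interpret \<chi>: group_hom K "Zn d" \<chi>
    by (intro group_hom.intro group_hom_axioms.intro \<chi> K group_Zn)
  have act_gh: "group_hom V V (act v)" if "v \<in> carrier (Zn d)" for v
    using act_hom[OF that] by (intro group_hom.intro group_hom_axioms.intro V.is_group)
  have act_closed: "act v x \<in> carrier V" if "v \<in> carrier (Zn d)" "x \<in> carrier V" for v x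
    using hom_in_carrier[OF act_hom[OF that(1)] that(2)] .
  have zero: "(\<lambda>_. 0) \<in> carrier (Zn d)" by simp
  have \<chi>c: "\<chi> g \<in> carrier (Zn d)" if "g \<in> carrier K" for g using \<chi>.hom_closed[OF that] .
  define U where "U = (\<Union>v\<in>carrier (Zn d). act v ` \<delta> ` S)"
  have U: "U \<subseteq> carrier V" unfolding U_def using S(2) \<delta>_closed act_closed by blast
  define H0 where "H0 = generate V U"
  have H0: "subgroup H0 V" unfolding H0_def by (rule V.generate_is_subgroup[OF U])
  have H0c: "x \<in> carrier V" if "x \<in> H0" for x using subgroup.mem_carrier[OF H0 that] .
  have actU: "act v ` U \<subseteq> U" if v: "v \<in> carrier (Zn d)" for v
  proof
    fix y assume "y \<in> act v ` U"
    then obtain w s where ws: "w \<in> carrier (Zn d)" "s \<in> S" "y = act v (act w (\<delta> s))"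
      unfolding U_def by blast
    then have "y = act (\<lambda>i. v i + w i) (\<delta> s)" using act_add[OF v ws(1)] \<delta>_closed S(2) by auto
    moreover have "(\<lambda>i. v i + w i) \<in> carrier (Zn d)" using v ws(1) by simp
    ultimately show "y \<in> U" unfolding U_def using ws(2) by blast
  qed
  have actH0: "act v x \<in> H0" if "v \<in> carrier (Zn d)" "x \<in> H0" for v x
  proof -
    have "act v ` H0 = generate V (act v ` U)"
      unfolding H0_def by (rule group_hom.generate_img[OF act_gh[OF that(1)] U, symmetric])
    also have "\<dots> \<subseteq> H0" unfolding H0_def by (rule V.mono_generate[OF actU[OF that(1)]])
    finally show ?thesis using that(2) by blast
  qed
  define \<eta> where "\<eta> = to_nat_on (carrier V)"
  have \<eta>_inj: "inj_on \<eta> (carrier V)" unfolding \<eta>_def by (rule inj_on_to_nat_on[OF countable])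
  define \<theta> where "\<theta> = the_inv_into (carrier V) \<eta>"
  have \<theta>\<eta>: "\<theta> (\<eta> x) = x" if "x \<in> carrier V" for x
    unfolding \<theta>_def by (rule the_inv_into_f_f[OF \<eta>_inj that])
  define H where "H = \<lparr>carrier = \<eta> ` H0, monoid.mult = (\<lambda>a b. \<eta> (\<theta> a \<otimes>\<^bsub>V\<^esub> \<theta> b)), one = \<eta> \<one>\<^bsub>V\<^esub>\<rparr>"
  have carH: "carrier H = \<eta> ` H0" by (simp add: H_def)
  have multH: "\<eta> x \<otimes>\<^bsub>H\<^esub> \<eta> y = \<eta> (x \<otimes>\<^bsub>V\<^esub> y)" if "x \<in> H0" "y \<in> H0" for x y
    using that H0c by (simp add: H_def \<theta>\<eta>)
  let ?V0 = "V\<lparr>carrier := H0\<rparr>"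
  have V0: "comm_group ?V0"
    using V.subgroup_imp_group[OF H0] H0c by (intro group.group_comm_groupI) (auto simp: V.m_comm)
  have iso: "\<eta> \<in> iso ?V0 H"
    unfolding Group.iso_def bij_betw_def
    using multH inj_on_subset[OF \<eta>_inj, of H0] H0c by (auto simp: hom_def carH)
  have "comm_group (H\<lparr>one := \<eta> \<one>\<^bsub>?V0\<^esub>\<rparr>)" by (rule comm_group.iso_imp_img_comm_group[OF V0 iso])
  then have Hcomm: "comm_group H" by (simp add: H_def)
  \<comment> \<open>Elements of \<open>AutoGroup H\<close> are extensional functions, hence the
    restriction.\<close>
  define rho where "rho v = restrict (\<lambda>a. \<eta> (act v (\<theta> a))) (carrier H)" for v
  have rho_\<eta>: "rho v (\<eta> x) = \<eta> (act v x)" if "x \<in> H0" for v x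
    using that H0c by (simp add: rho_def carH \<theta>\<eta>)
  have rho_auto: "rho v \<in> auto H" if v: "v \<in> carrier (Zn d)" for v
  proof -
    have "rho v \<in> hom H H"
    proof (rule homI)
      fix a assume "a \<in> carrier H"
      then show "rho v a \<in> carrier H" using actH0[OF v] by (auto simp: carH rho_\<eta>)
    next
      fix a b assume "a \<in> carrier H" "b \<in> carrier H"
      then obtain x y where xy: "x \<in> H0" "y \<in> H0" "a = \<eta> x" "b = \<eta> y" by (auto simp: carH)
      have "act v (x \<otimes>\<^bsub>V\<^esub> y) = act v x \<otimes>\<^bsub>V\<^esub> act v y"
        using hom_mult[OF act_hom[OF v]] xy H0c by simp
      then show "rho v (a \<otimes>\<^bsub>H\<^esub> b) = rho v a \<otimes>\<^bsub>H\<^esub> rho v b"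
        using xy actH0[OF v] subgroup.m_closed[OF H0 xy(1,2)] by (simp add: multH rho_\<eta>)
    qed
    moreover have "bij_betw (rho v) (carrier H) (carrier H)"
    proof (rule bij_betw_byWitness[where f' = "rho (\<lambda>i. - v i)"])
      have v': "(\<lambda>i. - v i) \<in> carrier (Zn d)" using v by simp
      have inv1: "act (\<lambda>i. - v i) (act v x) = x" if "x \<in> H0" for x
        using act_add[OF v' v H0c[OF that]] act_zero[OF H0c[OF that]] by simp
      have inv2: "act v (act (\<lambda>i. - v i) x) = x" if "x \<in> H0" for x
        using act_add[OF v v' H0c[OF that]] act_zero[OF H0c[OF that]] by simp
      show "\<forall>a\<in>carrier H. rho (\<lambda>i. - v i) (rho v a) = a"
        using inv1 actH0[OF v] by (auto simp: carH rho_\<eta>)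
      show "\<forall>a\<in>carrier H. rho v (rho (\<lambda>i. - v i) a) = a"
        using inv2 actH0[OF v'] by (auto simp: carH rho_\<eta>)
      show "rho v ` carrier H \<subseteq> carrier H" using actH0[OF v] by (auto simp: carH rho_\<eta>)
      show "rho (\<lambda>i. - v i) ` carrier H \<subseteq> carrier H" using actH0[OF v'] by (auto simp: carH rho_\<eta>)
    qed
    moreover have "rho v \<in> extensional (carrier H)" by (simp add: rho_def)
    ultimately show ?thesis by (simp add: auto_def Bij_def)
  qed
  have rho_hom: "rho \<in> hom (Zn d) (AutoGroup H)"
  proof (rule homI)
    show "rho v \<in> carrier (AutoGroup H)" if "v \<in> carrier (Zn d)" for v
      using rho_auto[OF that] by (simp add: AutoGroup_def)
    fix v w assume vw: "v \<in> carrier (Zn d)" "w \<in> carrier (Zn d)"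
    have "rho v \<in> Bij (carrier H)" "rho w \<in> Bij (carrier H)" using rho_auto vw by (auto simp: auto_def)
    then have "rho v \<otimes>\<^bsub>AutoGroup H\<^esub> rho w = compose (carrier H) (rho v) (rho w)"
      by (simp add: AutoGroup_def BijGroup_def)
    also have "\<dots> = rho (v \<otimes>\<^bsub>Zn d\<^esub> w)"
    proof
      fix a
      show "compose (carrier H) (rho v) (rho w) a = rho (v \<otimes>\<^bsub>Zn d\<^esub> w) a"
      proof (cases "a \<in> carrier H")
        case True
        then obtain x where x: "x \<in> H0" "a = \<eta> x" by (auto simp: carH)
        then show ?thesis using True actH0[OF vw(2)] act_add[OF vw] H0c by (simp add: compose_def rho_\<eta>)
      qed (simp add: compose_def rho_def)
    qed
    finally show "rho (v \<otimes>\<^bsub>Zn d\<^esub> w) = rho v \<otimes>\<^bsub>AutoGroup H\<^esub> rho w" ..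
  qed
  have UH0: "U \<subseteq> H0" unfolding H0_def by (auto intro: generate.incl)
  have \<delta>SU: "\<delta> s \<in> U" if "s \<in> S" for s
    unfolding U_def using that act_zero[OF \<delta>_closed[of s]] S(2) zero by (metis UN_I imageI subsetD)
  have "generate H (\<Union>v\<in>carrier (Zn d). rho v ` (\<eta> ` \<delta> ` S)) = carrier H"
  proof -
    have "rho v ` (\<eta> ` \<delta> ` S) = \<eta> ` (act v ` \<delta> ` S)" for v
      using \<delta>SU UH0 by (auto simp: image_image rho_\<eta> subset_iff)
    then have "(\<Union>v\<in>carrier (Zn d). rho v ` (\<eta> ` \<delta> ` S)) = \<eta> ` U"
      unfolding U_def by (simp add: image_UN)
    moreover have "group_hom ?V0 H \<eta>"
      using iso Hcomm V0 by (intro group_hom.intro group_hom_axioms.intro)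
        (auto simp: Group.iso_def comm_group_def)
    then have "generate H (\<eta> ` U) = \<eta> ` generate ?V0 U"
      by (rule group_hom.generate_img) (simp add: UH0)
    moreover have "generate ?V0 U = H0"
      unfolding V.generate_consistent[OF UH0 H0] by (simp add: H0_def)
    ultimately show ?thesis by (simp add: carH)
  qed
  moreover have "\<eta> ` \<delta> ` S \<subseteq> carrier H" using \<delta>SU UH0 by (auto simp: carH)
  ultimately have "fg_ZZn_module d H rho"
    unfolding fg_ZZn_module_def using S(1)
    by (intro conjI exI[of _ "\<eta> ` \<delta> ` S"] Hcomm rho_hom finite_imageI)
  moreover have "embeds_into K (semidirect d H rho)"
  proof -
    have \<delta>1: "\<delta> \<one>\<^bsub>K\<^esub> = \<one>\<^bsub>V\<^esub>"
      using \<delta>_mult[of "\<one>\<^bsub>K\<^esub>" "\<one>\<^bsub>K\<^esub>"] \<delta>_closed[of "\<one>\<^bsub>K\<^esub>"] act_zero[of "\<delta> \<one>\<^bsub>K\<^esub>"] \<chi>.hom_one by simp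
    have \<delta>H0: "\<delta> g \<in> H0" if g: "g \<in> generate K S" for g
      using g
    proof (induction rule: generate.induct)
      case one
      then show ?case using \<delta>1 subgroup.one_closed[OF H0] by simp
    next
      case (incl s)
      then show ?case using \<delta>SU UH0 by blast
    next
      case (inv s)
      then have s: "s \<in> carrier K" using S(2) by auto
      have e: "\<chi> (inv\<^bsub>K\<^esub> s) \<in> carrier (Zn d)" using s by (intro \<chi>c) simp
      have x: "act (\<chi> (inv\<^bsub>K\<^esub> s)) (\<delta> s) \<in> H0" using \<delta>SU[OF inv] UH0 by (intro actH0[OF e]) auto
      have "\<delta> (inv\<^bsub>K\<^esub> s) \<otimes>\<^bsub>V\<^esub> act (\<chi> (inv\<^bsub>K\<^esub> s)) (\<delta> s) = \<one>\<^bsub>V\<^esub>"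
        using \<delta>_mult[of "inv\<^bsub>K\<^esub> s" s] s \<delta>1 by simp
      then have "\<delta> (inv\<^bsub>K\<^esub> s) = inv\<^bsub>V\<^esub> (act (\<chi> (inv\<^bsub>K\<^esub> s)) (\<delta> s))"
        using V.inv_equality[of "\<delta> (inv\<^bsub>K\<^esub> s)"] \<delta>_closed s H0c[OF x] by simp
      then show ?case using subgroup.m_inv_closed[OF H0 x] by simp
    next
      case (eng g h)
      then have "g \<in> carrier K" "h \<in> carrier K" using K.generate_in_carrier[OF S(2)] by auto
      then show ?case using eng \<chi>c by (simp add: \<delta>_mult actH0 subgroup.m_closed[OF H0] del: Zn_simps)
    qed
    define f where "f g = (\<eta> (\<delta> g), \<chi> g)" for g
    have "f \<in> hom K (semidirect d H rho)"
    proof (rule homI)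
      show "f g \<in> carrier (semidirect d H rho)" if "g \<in> carrier K" for g
        using \<delta>H0[of g] \<chi>c[OF that] that S(3) by (simp add: f_def semidirect_def carH del: Zn_simps)
      fix g h assume gh: "g \<in> carrier K" "h \<in> carrier K"
      have "\<delta> g \<in> H0" "\<delta> h \<in> H0" using \<delta>H0 gh S(3) by auto
      then show "f (g \<otimes>\<^bsub>K\<^esub> h) = f g \<otimes>\<^bsub>semidirect d H rho\<^esub> f h"
        using gh actH0[OF \<chi>c[OF gh(1)]] \<chi>.hom_mult[OF gh]
        by (simp add: f_def semidirect_def \<delta>_mult multH rho_\<eta>)
    qed
    moreover have "inj_on f (carrier K)"
    proof (rule inj_onI)
      fix g h assume gh: "g \<in> carrier K" "h \<in> carrier K" "f g = f h"
      then have eq: "\<delta> g = \<delta> h" "\<chi> g = \<chi> h"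
        using inj_onD[OF \<eta>_inj] \<delta>_closed by (auto simp: f_def)
      define k where "k = inv\<^bsub>K\<^esub> h \<otimes>\<^bsub>K\<^esub> g"
      have k: "k \<in> carrier K" "g = h \<otimes>\<^bsub>K\<^esub> k" using gh by (auto simp: k_def K.m_assoc[symmetric])
      have "\<chi> g = (\<lambda>i. \<chi> h i + \<chi> k i)" using \<chi>.hom_mult[OF gh(2) k(1)] k(2) by simp
      then have "\<chi> k i = 0" for i using eq(2) by (simp add: fun_eq_iff)
      then have \<chi>k: "\<chi> k = (\<lambda>_. 0)" by (simp add: fun_eq_iff)
      have e: "(\<lambda>i. - \<chi> h i) \<in> carrier (Zn d)" using \<chi>c[OF gh(2)] by simp
      have "\<delta> h \<otimes>\<^bsub>V\<^esub> act (\<chi> h) (\<delta> k) = \<delta> h \<otimes>\<^bsub>V\<^esub> \<one>\<^bsub>V\<^esub>"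
        using \<delta>_mult[OF gh(2) k(1)] k(2) eq(1) \<delta>_closed[OF gh(2)] by simp
      then have 1: "act (\<chi> h) (\<delta> k) = \<one>\<^bsub>V\<^esub>"
        using \<delta>_closed gh k act_closed[OF \<chi>c[OF gh(2)]] by simp
      have "\<delta> k = act (\<lambda>i. - \<chi> h i + \<chi> h i) (\<delta> k)" using act_zero \<delta>_closed[OF k(1)] by simp
      also have "\<dots> = act (\<lambda>i. - \<chi> h i) \<one>\<^bsub>V\<^esub>"
        using act_add[OF e \<chi>c[OF gh(2)] \<delta>_closed[OF k(1)]] 1 by simp
      also have "\<dots> = \<one>\<^bsub>V\<^esub>" by (rule group_hom.hom_one[OF act_gh[OF e]])
      finally have "k = \<one>\<^bsub>K\<^esub>" using inj[OF k(1) \<chi>k] by simp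
      then show "g = h" using k gh by simp
    qed
    ultimately show ?thesis unfolding embeds_into_def by blast
  qed
  ultimately show ?thesis by blast
qed

section \<open>Linear representations\<close>

lemma GL_carrier_iff:
  "A \<in> carrier (GL N) \<longleftrightarrow> A \<in> carrier_mat N N \<and> (\<exists>B\<in>carrier_mat N N. A * B = 1\<^sub>m N \<and> B * A = 1\<^sub>m N)"
proof
  assume "A \<in> carrier (GL N)"
  then have A: "A \<in> carrier_mat N N" "invertible_mat A" by (auto simp: GL_def)
  then obtain B where B: "A * B = 1\<^sub>m (dim_row A)" "B * A = 1\<^sub>m (dim_row B)"
    unfolding invertible_mat_def inverts_mat_def by blast
  have "dim_col B = N" using arg_cong[OF B(1), of dim_col] A(1) by simp
  moreover have "dim_row B = N" using arg_cong[OF B(2), of dim_col] A(1) by simp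
  ultimately show "A \<in> carrier_mat N N \<and> (\<exists>B\<in>carrier_mat N N. A * B = 1\<^sub>m N \<and> B * A = 1\<^sub>m N)"
    using A(1) B by (intro conjI bexI[of _ B]) auto
next
  assume "A \<in> carrier_mat N N \<and> (\<exists>B\<in>carrier_mat N N. A * B = 1\<^sub>m N \<and> B * A = 1\<^sub>m N)"
  then show "A \<in> carrier (GL N)"
    by (auto simp: GL_def invertible_mat_def inverts_mat_def)
qed

lemma GL_simps [simp]: "A \<otimes>\<^bsub>GL N\<^esub> B = A * B" "\<one>\<^bsub>GL N\<^esub> = 1\<^sub>m N"
  by (simp_all add: GL_def)

lemma group_GL: "group (GL N)"
proof (rule groupI)
  fix A B assume "A \<in> carrier (GL N)" "B \<in> carrier (GL N)"
  then obtain A' B' where AB: "A \<in> carrier_mat N N" "B \<in> carrier_mat N N"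
    "A' \<in> carrier_mat N N" "B' \<in> carrier_mat N N"
    "A * A' = 1\<^sub>m N" "A' * A = 1\<^sub>m N" "B * B' = 1\<^sub>m N" "B' * B = 1\<^sub>m N"
    by (auto simp: GL_carrier_iff)
  have e1: "(A * B) * (B' * A') = A * ((B * B') * A')"
    using AB(1-4) by (simp add: assoc_mult_mat[of _ N N _ N _ N])
  have 1: "(A * B) * (B' * A') = 1\<^sub>m N" unfolding e1 using AB by simp
  have e2: "(B' * A') * (A * B) = B' * ((A' * A) * B)"
    using AB(1-4) by (simp add: assoc_mult_mat[of _ N N _ N _ N])
  have 2: "(B' * A') * (A * B) = 1\<^sub>m N" unfolding e2 using AB by simp
  show "A \<otimes>\<^bsub>GL N\<^esub> B \<in> carrier (GL N)"
    unfolding GL_carrier_iff GL_simps using AB 1 2 by (intro conjI bexI[of _ "B' * A'"]) auto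
next
  fix A assume "A \<in> carrier (GL N)"
  then obtain B where B: "A \<in> carrier_mat N N" "B \<in> carrier_mat N N" "A * B = 1\<^sub>m N" "B * A = 1\<^sub>m N"
    by (auto simp: GL_carrier_iff)
  then have "B \<in> carrier (GL N)" unfolding GL_carrier_iff by blast
  with B(4) show "\<exists>B\<in>carrier (GL N). B \<otimes>\<^bsub>GL N\<^esub> A = \<one>\<^bsub>GL N\<^esub>" by auto
qed (auto simp: GL_carrier_iff assoc_mult_mat[of _ N N _ N _ N])

lemma GL_homI:
  assumes K: "group K" and closed: "\<And>g. g \<in> carrier K \<Longrightarrow> f g \<in> carrier_mat N N"
    and mult: "\<And>g h. g \<in> carrier K \<Longrightarrow> h \<in> carrier K \<Longrightarrow> f (g \<otimes>\<^bsub>K\<^esub> h) = f g * f h"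
    and one: "f \<one>\<^bsub>K\<^esub> = 1\<^sub>m N"
  shows "f \<in> hom K (GL N)"
proof (rule homI)
  interpret K: group K by (rule K)
  fix g assume g: "g \<in> carrier K"
  then show "f g \<in> carrier (GL N)"
    unfolding GL_carrier_iff using closed mult[of g "inv\<^bsub>K\<^esub> g"] mult[of "inv\<^bsub>K\<^esub> g" g] one
    by (intro conjI bexI[of _ "f (inv\<^bsub>K\<^esub> g)"]) simp_all
qed (use mult in simp)

text \<open>Some complex representation has its kernel inside \<open>Q\<close>. Block sums intersect
  kernels, so a faithful representation can be assembled from several that are not faithful.\<close>

definition linearly_detected :: "('k, 'e) monoid_scheme \<Rightarrow> ('k \<Rightarrow> bool) \<Rightarrow> bool" where
  "linearly_detected K Q \<longleftrightarrow> (\<exists>N f. f \<in> hom K (GL N) \<and> (\<forall>g\<in>carrier K. f g = 1\<^sub>m N \<longrightarrow> Q g))"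

lemma linearly_detected_conj:
  assumes K: "group K" and Q: "linearly_detected K Q" and R: "linearly_detected K R"
  shows "linearly_detected K (\<lambda>g. Q g \<and> R g)"
proof -
  interpret K: group K by (rule K)
  obtain N f where f: "f \<in> hom K (GL N)" "\<forall>g\<in>carrier K. f g = 1\<^sub>m N \<longrightarrow> Q g"
    using Q unfolding linearly_detected_def by blast
  obtain N' f' where f': "f' \<in> hom K (GL N')" "\<forall>g\<in>carrier K. f' g = 1\<^sub>m N' \<longrightarrow> R g"
    using R unfolding linearly_detected_def by blast
  have c: "f g \<in> carrier_mat N N" "f' g \<in> carrier_mat N' N'" if "g \<in> carrier K" for g
    using hom_in_carrier[OF f(1) that] hom_in_carrier[OF f'(1) that] by (auto simp: GL_carrier_iff)
  define F where "F g = four_block_mat (f g) (0\<^sub>m N N') (0\<^sub>m N' N) (f' g)" for g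
  have "F \<in> hom K (GL (N + N'))"
  proof (rule GL_homI[OF K])
    show "F g \<in> carrier_mat (N + N') (N + N')" if "g \<in> carrier K" for g
      unfolding F_def using c[OF that] by (intro four_block_carrier_mat)
    show "F \<one>\<^bsub>K\<^esub> = 1\<^sub>m (N + N')"
      using hom_one[OF f(1) K group_GL] hom_one[OF f'(1) K group_GL] by (simp add: F_def)
    fix g h assume gh: "g \<in> carrier K" "h \<in> carrier K"
    have "F g * F h = four_block_mat (f g * f h + 0\<^sub>m N N' * 0\<^sub>m N' N) (f g * 0\<^sub>m N N' + 0\<^sub>m N N' * f' h)
        (0\<^sub>m N' N * f h + f' g * 0\<^sub>m N' N) (0\<^sub>m N' N * 0\<^sub>m N N' + f' g * f' h)"
      unfolding F_def by (rule mult_four_block_mat[where ?nr1.0 = N and ?nr2.0 = N' and ?n1.0 = N and ?n2.0 = N' and ?nc1.0 = N and ?nc2.0 = N'])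
        (use c gh in auto)
    also have "\<dots> = four_block_mat (f g * f h) (0\<^sub>m N N') (0\<^sub>m N' N) (f' g * f' h)"
      using c[OF gh(1)] c[OF gh(2)] by simp
    finally show "F (g \<otimes>\<^bsub>K\<^esub> h) = F g * F h"
      using hom_mult[OF f(1) gh] hom_mult[OF f'(1) gh] by (simp add: F_def)
  qed
  moreover have "Q g \<and> R g" if g: "g \<in> carrier K" and 1: "F g = 1\<^sub>m (N + N')" for g
  proof -
    have "f g = 1\<^sub>m N"
    proof (rule eq_matI)
      fix i j assume "i < dim_row (1\<^sub>m N :: complex mat)" "j < dim_col (1\<^sub>m N :: complex mat)"
      then have ij: "i < N" "j < N" by auto
      have "F g $$ (i, j) = f g $$ (i, j)" using ij c[OF g] by (simp add: F_def)
      then show "f g $$ (i, j) = 1\<^sub>m N $$ (i, j)" using ij by (simp add: 1)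
    qed (use c[OF g] in auto)
    moreover have "f' g = 1\<^sub>m N'"
    proof (rule eq_matI)
      fix i j assume "i < dim_row (1\<^sub>m N' :: complex mat)" "j < dim_col (1\<^sub>m N' :: complex mat)"
      then have ij: "i < N'" "j < N'" by auto
      have "F g $$ (N + i, N + j) = f' g $$ (i, j)" using ij c[OF g] by (simp add: F_def)
      then show "f' g $$ (i, j) = 1\<^sub>m N' $$ (i, j)" using ij by (simp add: 1)
    qed (use c[OF g] in auto)
    ultimately show ?thesis using f(2) f'(2) g by blast
  qed
  ultimately show ?thesis unfolding linearly_detected_def by blast
qed

lemma linearly_detected_all:
  assumes K: "group K" and Q: "\<And>j::nat. j < p \<Longrightarrow> linearly_detected K (Q j)"
  shows "linearly_detected K (\<lambda>g. \<forall>j<p. Q j g)"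
  using Q
proof (induction p)
  case 0
  have "(\<lambda>_. 1\<^sub>m 0) \<in> hom K (GL 0)" by (rule GL_homI[OF K]) auto
  then show ?case unfolding linearly_detected_def by auto
next
  case (Suc p)
  then have "linearly_detected K (\<lambda>g. (\<forall>j<p. Q j g) \<and> Q p g)"
    by (intro linearly_detected_conj[OF K]) auto
  then show ?case by (simp add: less_Suc_eq all_conj_distrib imp_conjL conj_commute)
qed

text \<open>A derivation \<open>\<delta>\<close> with values in a linear representation \<open>M\<close> is an affine representation
  \<open>(M, \<delta>; 0, 1)\<close>.\<close>

lemma linearly_detected_affine:
  fixes M :: "'k \<Rightarrow> nat \<Rightarrow> nat \<Rightarrow> rat" and \<delta> :: "'k \<Rightarrow> nat \<Rightarrow> rat"
  assumes K: "group K"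
    and M_mult: "\<And>g h i j. g \<in> carrier K \<Longrightarrow> h \<in> carrier K \<Longrightarrow> i < r \<Longrightarrow> j < r \<Longrightarrow>
      M (g \<otimes>\<^bsub>K\<^esub> h) i j = (\<Sum>k<r. M g i k * M h k j)"
    and M_one: "\<And>i j. i < r \<Longrightarrow> j < r \<Longrightarrow> M \<one>\<^bsub>K\<^esub> i j = (if i = j then 1 else 0)"
    and \<delta>_mult: "\<And>g h i. g \<in> carrier K \<Longrightarrow> h \<in> carrier K \<Longrightarrow> i < r \<Longrightarrow>
      \<delta> (g \<otimes>\<^bsub>K\<^esub> h) i = \<delta> g i + (\<Sum>k<r. M g i k * \<delta> h k)"
  shows "linearly_detected K (\<lambda>g. (\<forall>i<r. \<forall>j<r. M g i j = (if i = j then 1 else 0)) \<and> (\<forall>i<r. \<delta> g i = 0))"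
proof -
  interpret K: group K by (rule K)
  have \<delta>_one: "\<delta> \<one>\<^bsub>K\<^esub> i = 0" if i: "i < r" for i
  proof -
    have "(\<Sum>k<r. M \<one>\<^bsub>K\<^esub> i k * \<delta> \<one>\<^bsub>K\<^esub> k) = (\<Sum>k<r. if i = k then \<delta> \<one>\<^bsub>K\<^esub> k else 0)"
      using i by (intro sum.cong) (auto simp: M_one)
    also have "\<dots> = \<delta> \<one>\<^bsub>K\<^esub> i" using i by simp
    finally show ?thesis using \<delta>_mult[of "\<one>\<^bsub>K\<^esub>" "\<one>\<^bsub>K\<^esub>" i] i by simp
  qed
  define E :: "'k \<Rightarrow> nat \<Rightarrow> nat \<Rightarrow> complex" where
    "E g i j = (if i < r then (if j < r then of_rat (M g i j) else of_rat (\<delta> g i)) else (if j < r then 0 else 1))" for g i j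
  define F where "F g = mat (Suc r) (Suc r) (\<lambda>(i, j). E g i j)" for g
  have Emult: "E (g \<otimes>\<^bsub>K\<^esub> h) i j = (\<Sum>k<Suc r. E g i k * E h k j)"
    if gh: "g \<in> carrier K" "h \<in> carrier K" for g h i j
    using gh by (auto simp: E_def M_mult \<delta>_mult of_rat_add of_rat_sum of_rat_mult)
  have "F \<in> hom K (GL (Suc r))"
  proof (rule GL_homI[OF K])
    show "F g \<in> carrier_mat (Suc r) (Suc r)" for g by (simp add: F_def)
    show "F \<one>\<^bsub>K\<^esub> = 1\<^sub>m (Suc r)"
      by (rule eq_matI) (auto simp: F_def E_def M_one \<delta>_one)
    show "F (g \<otimes>\<^bsub>K\<^esub> h) = F g * F h" if "g \<in> carrier K" "h \<in> carrier K" for g h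
      by (rule eq_matI)
        (simp_all add: F_def Emult[OF that] scalar_prod_def atLeast0LessThan del: sum.lessThan_Suc)
  qed
  moreover have "(\<forall>i<r. \<forall>j<r. M g i j = (if i = j then 1 else 0)) \<and> (\<forall>i<r. \<delta> g i = 0)"
    if g: "g \<in> carrier K" and 1: "F g = 1\<^sub>m (Suc r)" for g
  proof -
    have E: "E g i j = (if i = j then 1 else 0)" if "i < Suc r" "j < Suc r" for i j
      using arg_cong[OF 1, of "\<lambda>A. A $$ (i, j)"] that by (simp add: F_def)
    have "M g i j = (if i = j then 1 else 0)" if "i < r" "j < r" for i j
      using E[of i j] that by (simp add: E_def split: if_splits)
    moreover have "\<delta> g i = 0" if "i < r" for i using E[of i r] that by (simp add: E_def)
    ultimately show ?thesis by blast
  qed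
  ultimately show ?thesis unfolding linearly_detected_def by blast
qed

section \<open>The main theorem\<close>

lemma linearly_detected_mono:
  "linearly_detected K Q \<Longrightarrow> (\<And>g. g \<in> carrier K \<Longrightarrow> Q g \<Longrightarrow> R g) \<Longrightarrow> linearly_detected K R"
  unfolding linearly_detected_def by blast

text \<open>Needed on two levels: for rational vectors supported below \<open>r\<close>, and for
  \<open>p\<close>-tuples of such vectors.\<close>

lemma countable_finite_support:
  fixes C :: "'c::zero set"
  assumes "countable C"
  shows "countable {u :: nat \<Rightarrow> 'c. (\<forall>j<p. u j \<in> C) \<and> (\<forall>j\<ge>p. u j = 0)}"
  (is "countable ?U")
proof (rule countable_image_inj_on)
  let ?f = "\<lambda>u. map u [0..<p]"
  have "?f ` ?U \<subseteq> lists C" by auto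
  then show "countable (?f ` ?U)" using countable_lists[OF assms] by (rule countable_subset)
  show "inj_on ?f ?U"
  proof (rule inj_onI)
    fix u v :: "nat \<Rightarrow> 'c"
    assume uv: "u \<in> ?U" "v \<in> ?U" "?f u = ?f v"
    show "u = v"
    proof
      fix j show "u j = v j" using uv by (cases "j < p") auto
    qed
  qed
qed

context metabelian_subgroup
begin

lemma group_K: "group (G\<lparr>carrier := K\<rparr>)"
  by (rule subgroup_imp_group[OF K])

lemma c_eq_0_iff: "h \<in> K \<Longrightarrow> g \<in> K \<Longrightarrow> c h g = 0 \<longleftrightarrow> h \<otimes> g = g \<otimes> h"
  using \<iota>_eq_0[OF comm_K[of h g]] comm_eq_one_iff[of h g] K_carrier by (simp add: c_def)

lemma centralizes_generate:
  assumes S: "S \<subseteq> carrier G" and g: "g \<in> carrier G" and comm: "\<And>s. s \<in> S \<Longrightarrow> s \<otimes> g = g \<otimes> s"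
    and x: "x \<in> generate G S"
  shows "x \<otimes> g = g \<otimes> x"
proof -
  have "g \<otimes> x = x \<otimes> g"
    using x
  proof (induction rule: generate.induct)
    case (incl h) then show ?case using comm by simp
  next
    case (inv h) then show ?case using comm S g by (intro inv_commute) auto
  next
    case (eng h1 h2) then show ?case using g generate_in_carrier[OF S] by (intro mult_commute) auto
  qed (use g in simp)
  then show ?thesis by simp
qed

text \<open>Both parts rest on \<open>sep\<close>. An element of \<open>Fit\<close> on which all
  derivations \<open>c (s j)\<close> vanish commutes with the generators, hence with
  \<open>K\<close>, and \<open>\<psi>\<close> detects such elements. Membership in
  \<open>Fit\<close> is detected by the linear action in the first part and by \<open>\<chi>\<close>
  in the second.\<close>

lemma embeddings:
  assumes fg: "fg_subgroup G K" and \<chi>: "\<chi> \<in> hom (G\<lparr>carrier := K\<rparr>) (Zn n)"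
    and \<chi>_surj: "\<chi> ` K = carrier (Zn n)" and \<chi>_ker: "\<And>x. x \<in> K \<Longrightarrow> \<chi> x = (\<lambda>_. 0) \<longleftrightarrow> x \<in> Fit"
  shows "linearly_detected (G\<lparr>carrier := K\<rparr>) (\<lambda>g. g = \<one>)"
    and "\<exists>d (H :: nat monoid) rho. fg_ZZn_module d H rho \<and> embeds_into (G\<lparr>carrier := K\<rparr>) (semidirect d H rho)"
proof -
  let ?K = "G\<lparr>carrier := K\<rparr>"
  interpret Kg: group ?K by (rule group_K)
  interpret \<chi>: group_hom ?K "Zn n" \<chi>
    by (intro group_hom.intro group_hom_axioms.intro \<chi> group_K group_Zn)
  have K_mult: "x \<otimes> y \<in> K" if "x \<in> K" "y \<in> K" for x y using subgroup.m_closed[OF K that] .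
  have K_inv: "inv x \<in> K" if "x \<in> K" for x using subgroup.m_inv_closed[OF K that] .
  obtain S where S: "finite S" "S \<subseteq> K" "generate G S = K" using fg unfolding fg_subgroup_def by blast
  obtain ss where ss: "set ss = S" using finite_list[OF S(1)] by blast
  define p where "p = length ss"
  define s where "s j = ss ! j" for j
  have sK: "s j \<in> K" if "j < p" for j using that ss S(2) by (auto simp: s_def p_def)
  have sS: "\<exists>j<p. x = s j" if "x \<in> S" for x using that ss by (auto simp: s_def p_def in_set_conv_nth)
  obtain t \<psi> where \<psi>: "\<psi> \<in> hom ?K (Zn t)"
    and \<psi>_sep: "\<And>z. z \<in> Fit \<Longrightarrow> (\<And>x. x \<in> K \<Longrightarrow> x \<otimes> z = z \<otimes> x) \<Longrightarrow> \<psi> z = (\<lambda>_. 0) \<Longrightarrow> z = \<one>"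
    using central_separating_hom[OF fg] by blast
  interpret \<psi>: group_hom ?K "Zn t" \<psi>
    by (intro group_hom.intro group_hom_axioms.intro \<psi> group_K group_Zn)
  have \<psi>_mult: "\<psi> (g \<otimes> h) = (\<lambda>i. \<psi> g i + \<psi> h i)" if "g \<in> K" "h \<in> K" for g h
    using \<psi>.hom_mult[of g h] that by simp
  have \<chi>_mult: "\<chi> (g \<otimes> h) = (\<lambda>i. \<chi> g i + \<chi> h i)" if "g \<in> K" "h \<in> K" for g h
    using \<chi>.hom_mult[of g h] that by simp
  have \<chi>c: "\<chi> g \<in> carrier (Zn n)" and \<psi>c: "\<psi> g \<in> carrier (Zn t)" if "g \<in> K" for g
    using \<chi>.hom_closed[of g] \<psi>.hom_closed[of g] that by simp_all
  have sep: "g = \<one>" if g: "g \<in> Fit" and c0: "\<And>j. j < p \<Longrightarrow> c (s j) g = 0" and \<psi>0: "\<psi> g = (\<lambda>_. 0)" for g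
  proof (rule \<psi>_sep[OF g _ \<psi>0])
    fix x assume x: "x \<in> K"
    have gK: "g \<in> K" using g Fit_K by blast
    show "x \<otimes> g = g \<otimes> x"
    proof (rule centralizes_generate)
      show "S \<subseteq> carrier G" using S(2) K_carrier by blast
      show "g \<in> carrier G" using gK by (rule K_carrier)
      show "y \<otimes> g = g \<otimes> y" if y: "y \<in> S" for y
      proof -
        obtain j where "j < p" "y = s j" using sS[OF y] by blast
        then show ?thesis using c0[of j] c_eq_0_iff[OF sK gK, of j] by simp
      qed
      show "x \<in> generate G S" using x S(3) by simp
    qed
  qed

  show "linearly_detected ?K (\<lambda>g. g = \<one>)"
  proof -
    define I where "I g \<longleftrightarrow> (\<forall>i<r. \<forall>j<r. M g i j = (if i = j then 1 else 0))" for g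
    have Mm: "M (g \<otimes>\<^bsub>?K\<^esub> h) i j = (\<Sum>k<r. M g i k * M h k j)"
      if "g \<in> carrier ?K" "h \<in> carrier ?K" "i < r" "j < r" for g h i j
      using that M_mult[of g h j i] K_carrier by simp
    have M1: "M \<one>\<^bsub>?K\<^esub> i j = (if i = j then 1 else 0)" if "i < r" "j < r" for i j
      using M_one[OF that(2)] by simp
    have cm: "c (s j) (g \<otimes>\<^bsub>?K\<^esub> h) i = c (s j) g i + (\<Sum>k<r. M g i k * c (s j) h k)"
      if "j < p" "g \<in> carrier ?K" "h \<in> carrier ?K" "i < r" for j g h i
      using c_mult[OF sK[OF that(1)], of g h] that by (simp add: T_def)
    have A: "linearly_detected ?K (\<lambda>g. I g \<and> (\<forall>i<r. c (s j) g i = 0))" if "j < p" for j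
      unfolding I_def by (rule linearly_detected_affine[OF group_K Mm M1 cm[OF that]])
    \<comment> \<open>The zero derivation: it detects the linear part \<open>I\<close> also when the
      list of generators is empty and \<open>A\<close> says nothing.\<close>
    have B: "linearly_detected ?K (\<lambda>g. I g \<and> (\<forall>i<r. (0::rat) = 0))"
      unfolding I_def by (rule linearly_detected_affine[OF group_K Mm M1]) simp_all
    \<comment> \<open>A homomorphism to the integers is a derivation for the trivial one-dimensional
      action, that is, a unipotent 2 by 2 representation.\<close>
    have C: "linearly_detected ?K (\<lambda>g. \<psi> g i = 0)" for i
      by (rule linearly_detected_mono[OF linearly_detected_affine[where r = 1 and M = "\<lambda>_ _ _. 1"
            and \<delta> = "\<lambda>g _. of_int (\<psi> g i)", OF group_K]]) (auto simp: \<psi>_mult)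
    have "linearly_detected ?K (\<lambda>g. ((\<forall>j<p. I g \<and> (\<forall>i<r. c (s j) g i = 0)) \<and> (I g \<and> (\<forall>i<r. (0::rat) = 0)))
        \<and> (\<forall>i<t. \<psi> g i = 0))"
      by (intro linearly_detected_conj linearly_detected_all group_K A B C)
    then show ?thesis
    proof (rule linearly_detected_mono)
      fix g assume "g \<in> carrier ?K"
        and g: "((\<forall>j<p. I g \<and> (\<forall>i<r. c (s j) g i = 0)) \<and> (I g \<and> (\<forall>i<r. (0::rat) = 0))) \<and> (\<forall>i<t. \<psi> g i = 0)"
      then have gK: "g \<in> K" by simp
      have "g \<in> Fit"
        by (rule Fit_of_T_trivial[OF K_carrier[OF gK]], rule T_M_eq_1[OF K_carrier[OF gK]])
          (use g in \<open>simp add: I_def\<close>)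
      moreover have "c (s j) g = 0" if j: "j < p" for j
      proof
        fix i
        show "c (s j) g i = 0 i"
          using g j \<iota>_support[OF comm_K[OF sK[OF j] gK], of i] by (cases "i < r") (auto simp: c_def)
      qed
      moreover have "\<psi> g = (\<lambda>_. 0)"
      proof
        fix i show "\<psi> g i = 0" using g \<psi>c[OF gK] by (cases "i < t") auto
      qed
      ultimately show "g = \<one>" by (rule sep)
    qed
  qed

  show "\<exists>d (H :: nat monoid) rho. fg_ZZn_module d H rho \<and> embeds_into ?K (semidirect d H rho)"
  proof -
    define d where "d = n + t"
    define \<chi>' where "\<chi>' g = (\<lambda>i. if i < n then \<chi> g i else \<psi> g (i - n))" for g
    have \<chi>': "\<chi>' \<in> hom ?K (Zn d)"
    proof (rule homI)
      show "\<chi>' g \<in> carrier (Zn d)" if "g \<in> carrier ?K" for g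
        using \<psi>c[of g] that by (auto simp: \<chi>'_def d_def)
      show "\<chi>' (g \<otimes>\<^bsub>?K\<^esub> h) = \<chi>' g \<otimes>\<^bsub>Zn d\<^esub> \<chi>' h" if "g \<in> carrier ?K" "h \<in> carrier ?K" for g h
        using that by (auto simp: \<chi>'_def \<chi>_mult \<psi>_mult)
    qed
    have "\<forall>e\<in>carrier (Zn n). \<exists>x. x \<in> K \<and> \<chi> x = e" unfolding \<chi>_surj[symmetric] by blast
    then obtain lift where lift: "\<And>e. e \<in> carrier (Zn n) \<Longrightarrow> lift e \<in> K \<and> \<chi> (lift e) = e"
      unfolding Ball_def by metis
    \<comment> \<open>\<open>K\<close> acts on \<open>W\<close> through its quotient by
      \<open>Fit\<close>, which \<open>\<chi>\<close> identifies with \<open>Zn n\<close>; so the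
      choice of lifts is immaterial, and they compose on \<open>W\<close> as if \<open>lift\<close>
      were a homomorphism.\<close>
    have T_dep: "T x w = T y w" if x: "x \<in> K" and y: "y \<in> K" and eq: "\<chi> x = \<chi> y" and w: "w \<in> W" for x y w
    proof -
      let ?z = "inv x \<otimes> y"
      have xy: "x \<in> carrier G" "y \<in> carrier G" using x y K_carrier by auto
      have z: "?z \<in> K" using x y K_mult K_inv by blast
      have xz: "x \<otimes> ?z = y" using xy by simp
      have "\<chi> y = (\<lambda>i. \<chi> x i + \<chi> ?z i)" using \<chi>_mult[OF x z] xy by simp
      then have "\<chi> ?z i = 0" for i using eq by (simp add: fun_eq_iff)
      then have "\<chi> ?z = (\<lambda>_. 0)" by (simp add: fun_eq_iff)
      then have "?z \<in> Fit" using \<chi>_ker[OF z] by simp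
      then have "T ?z w = w" using w by (rule T_Fit)
      moreover have "T (x \<otimes> ?z) w = T x (T ?z w)" using xy by (intro T_mult) simp_all
      ultimately show ?thesis unfolding xz by simp
    qed
    \<comment> \<open>Only the first \<open>n\<close> coordinates act. The last \<open>t\<close>,
      which carry \<open>\<psi>\<close>, act trivially and merely separate central elements.\<close>
    define act where "act v u = (\<lambda>j. T (lift (Zn_restrict n v)) (u j))" for v and u :: "nat \<Rightarrow> nat \<Rightarrow> rat"
    define V :: "(nat \<Rightarrow> nat \<Rightarrow> rat) monoid" where "V = \<lparr>carrier = {u :: nat \<Rightarrow> nat \<Rightarrow> rat. (\<forall>j<p. u j \<in> W) \<and> (\<forall>j\<ge>p. u j = 0)},
      monoid.mult = (+), one = 0\<rparr>"
    have V_carrier: "u \<in> carrier V \<longleftrightarrow> (\<forall>j<p. u j \<in> W) \<and> (\<forall>j\<ge>p. u j = 0)" for u by (simp add: V_def)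
    have V_ops: "u \<otimes>\<^bsub>V\<^esub> u' = u + u'" "\<one>\<^bsub>V\<^esub> = 0" for u u' by (simp_all add: V_def)
    have res: "Zn_restrict n v \<in> carrier (Zn n)" for v by (simp add: Zn_restrict_def)
    have lK: "lift (Zn_restrict n v) \<in> K" "lift (Zn_restrict n v) \<in> carrier G"
      "\<chi> (lift (Zn_restrict n v)) = Zn_restrict n v" for v
      using lift[OF res] K_carrier by auto
    define \<delta> where "\<delta> g = (\<lambda>j. if j < p then c (s j) g else 0)" for g
    have "\<exists>(H :: nat monoid) rho. fg_ZZn_module d H rho \<and> embeds_into ?K (semidirect d H rho)"
    proof (rule semidirect_embedding[where act = act and \<delta> = \<delta> and V = V, OF group_K S(1) _ _ _ _ _ _ _ \<chi>'])
      show "S \<subseteq> carrier ?K" using S(2) by simp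
      show "generate ?K S = carrier ?K" using generate_consistent[OF S(2) K] S(3) by simp
      show "comm_group V"
      proof (rule comm_groupI)
        fix u assume u: "u \<in> carrier V"
        then have "- u \<in> carrier V" unfolding V_carrier using uminus_mem by simp
        then show "\<exists>y\<in>carrier V. y \<otimes>\<^bsub>V\<^esub> u = \<one>\<^bsub>V\<^esub>" by (rule rev_bexI) (simp add: V_ops)
      qed (simp_all add: V_carrier V_ops add_mem zero_mem add.assoc add.commute)
      have "W \<subseteq> {w :: nat \<Rightarrow> rat. (\<forall>i<r. w i \<in> UNIV) \<and> (\<forall>i\<ge>r. w i = 0)}"
        using \<iota>_support by (auto elim!: WE)
      then have "countable W" by (rule countable_subset) (rule countable_finite_support, simp)
      then show "countable (carrier V)" unfolding V_def by (simp add: countable_finite_support)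
      show "act v \<in> hom V V" if "v \<in> carrier (Zn d)" for v
      proof (rule homI)
        show "act v u \<in> carrier V" if "u \<in> carrier V" for u
          using that lK(2) unfolding V_carrier act_def by (auto simp: T_mem T_zero)
        show "act v (u \<otimes>\<^bsub>V\<^esub> u') = act v u \<otimes>\<^bsub>V\<^esub> act v u'" for u u'
          by (rule ext) (simp add: V_ops act_def T_add[OF lK(2)])
      qed
      show "act (\<lambda>_. 0) u = u" if "u \<in> carrier V" for u
      proof
        fix j
        have "Zn_restrict n (\<lambda>_. 0) = (\<lambda>_. 0)" by (simp add: Zn_restrict_def)
        then have F: "lift (Zn_restrict n (\<lambda>_. 0)) \<in> Fit" using \<chi>_ker[OF lK(1)] lK(3) by metis
        show "act (\<lambda>_. 0) u j = u j"
          using that T_Fit[OF F, of "u j"] T_zero[OF lK(2)] unfolding V_carrier act_def by (cases "j < p") simp_all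
      qed
      show "act (\<lambda>i. v i + w i) u = act v (act w u)" if u: "u \<in> carrier V" for v w u
      proof
        fix j
        let ?x = "lift (Zn_restrict n (\<lambda>i. v i + w i))" and ?y = "lift (Zn_restrict n v)" and ?z = "lift (Zn_restrict n w)"
        have "u j \<in> W" using u zero_mem unfolding V_carrier by (cases "j < p") simp_all
        moreover have "\<chi> ?x = \<chi> (?y \<otimes> ?z)"
          unfolding \<chi>_mult[OF lK(1) lK(1)] lK(3) by (auto simp: Zn_restrict_def)
        ultimately have "T ?x (u j) = T (?y \<otimes> ?z) (u j)" by (intro T_dep lK(1) K_mult)
        then show "act (\<lambda>i. v i + w i) u j = act v (act w u) j"
          unfolding act_def using T_mult[OF lK(2) lK(2)] by simp
      qed
      show "\<delta> g \<in> carrier V" if "g \<in> carrier ?K" for g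
        using that c_mem[OF sK] unfolding V_carrier \<delta>_def by simp
      show "\<delta> (g \<otimes>\<^bsub>?K\<^esub> h) = \<delta> g \<otimes>\<^bsub>V\<^esub> act (\<chi>' g) (\<delta> h)" if "g \<in> carrier ?K" "h \<in> carrier ?K" for g h
      proof
        fix j
        have gh: "g \<in> K" "h \<in> K" using that by auto
        show "\<delta> (g \<otimes>\<^bsub>?K\<^esub> h) j = (\<delta> g \<otimes>\<^bsub>V\<^esub> act (\<chi>' g) (\<delta> h)) j"
        proof (cases "j < p")
          case True
          have "Zn_restrict n (\<chi>' g) = \<chi> g" using \<chi>c[OF gh(1)] by (auto simp: Zn_restrict_def \<chi>'_def)
          then have "T (lift (Zn_restrict n (\<chi>' g))) (c (s j) h) = T g (c (s j) h)"
            using lK(3)[of "\<chi>' g"] by (intro T_dep lK(1) gh c_mem sK True) simp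
          then show ?thesis using True c_mult[OF sK[OF True] gh] by (simp add: \<delta>_def act_def V_ops)
        qed (simp add: \<delta>_def act_def V_ops T_zero[OF lK(2)])
      qed
      fix g assume g: "g \<in> carrier ?K" "\<chi>' g = (\<lambda>_. 0)" "\<delta> g = \<one>\<^bsub>V\<^esub>"
      then have gK: "g \<in> K" by simp
      have z: "\<chi>' g i = 0" for i using g(2) by simp
      have "\<chi> g = (\<lambda>_. 0)"
      proof
        fix i show "\<chi> g i = 0" using z[of i] \<chi>c[OF gK] by (cases "i < n") (auto simp: \<chi>'_def)
      qed
      then have "g \<in> Fit" using \<chi>_ker[OF gK] by simp
      moreover have "c (s j) g = 0" if "j < p" for j
        using fun_cong[OF g(3), of j] that by (simp add: \<delta>_def V_ops)
      moreover have "\<psi> g = (\<lambda>_. 0)"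
      proof
        fix i show "\<psi> g i = 0" using z[of "n + i"] by (simp add: \<chi>'_def)
      qed
      ultimately show "g = \<one>\<^bsub>?K\<^esub>" using sep by simp
    qed
    then show ?thesis by blast
  qed
qed

end

section \<open>Nilpotency under isomorphism and conclusion\<close>

lemma lower_central_image:
  assumes G: "group G" and H: "group H" and f: "f \<in> hom G H" and surj: "f ` carrier G = carrier H"
  shows "lower_central G i \<subseteq> carrier G \<and> f ` lower_central G i = lower_central H i"
proof (induction i)
  case 0
  then show ?case using surj by simp
next
  case (Suc i)
  interpret f: group_hom G H f by (intro group_hom.intro group_hom_axioms.intro G H f)
  define S where "S = (\<Union>h \<in> lower_central G i. \<Union>g \<in> carrier G.
        {h \<otimes>\<^bsub>G\<^esub> g \<otimes>\<^bsub>G\<^esub> inv\<^bsub>G\<^esub> h \<otimes>\<^bsub>G\<^esub> inv\<^bsub>G\<^esub> g})"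
  have Sc: "S \<subseteq> carrier G" using Suc by (auto simp: S_def)
  have img: "f (h \<otimes>\<^bsub>G\<^esub> g \<otimes>\<^bsub>G\<^esub> inv\<^bsub>G\<^esub> h \<otimes>\<^bsub>G\<^esub> inv\<^bsub>G\<^esub> g) = f h \<otimes>\<^bsub>H\<^esub> f g \<otimes>\<^bsub>H\<^esub> inv\<^bsub>H\<^esub> (f h) \<otimes>\<^bsub>H\<^esub> inv\<^bsub>H\<^esub> (f g)"
    if "h \<in> lower_central G i" "g \<in> carrier G" for h g
    using that Suc by (auto simp: subset_iff)
  have "f ` S = (\<Union>h \<in> lower_central G i. \<Union>g \<in> carrier G.
      {f h \<otimes>\<^bsub>H\<^esub> f g \<otimes>\<^bsub>H\<^esub> inv\<^bsub>H\<^esub> (f h) \<otimes>\<^bsub>H\<^esub> inv\<^bsub>H\<^esub> (f g)})"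
    unfolding S_def image_UN using img by simp
  also have "\<dots> = (\<Union>h \<in> f ` lower_central G i. \<Union>g \<in> f ` carrier G.
      {h \<otimes>\<^bsub>H\<^esub> g \<otimes>\<^bsub>H\<^esub> inv\<^bsub>H\<^esub> h \<otimes>\<^bsub>H\<^esub> inv\<^bsub>H\<^esub> g})"
    by simp
  finally have "generate H (f ` S) = lower_central H (Suc i)" using Suc surj by simp
  moreover have "lower_central G (Suc i) = generate G S" by (simp add: S_def)
  moreover have "generate G S \<subseteq> carrier G" using f.G.generate_incl[OF Sc] .
  ultimately show ?case using f.generate_img[OF Sc] by simp
qed

lemma nilpotent_iso:
  assumes G: "group G" and H: "group H" and f: "f \<in> iso G H" and nil: "nilpotent_group H"
  shows "nilpotent_group G"
proof -
  have hom: "f \<in> hom G H" and bij: "f ` carrier G = carrier H" and inj: "inj_on f (carrier G)"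
    using f by (auto simp: Group.iso_def bij_betw_def)
  obtain i where i: "lower_central H i = {\<one>\<^bsub>H\<^esub>}" using nil unfolding nilpotent_group_def by blast
  have sub: "lower_central G i \<subseteq> carrier G" and img: "f ` lower_central G i = {\<one>\<^bsub>H\<^esub>}"
    using lower_central_image[OF G H hom bij, of i] i by auto
  have one: "\<one>\<^bsub>G\<^esub> \<in> carrier G" "f \<one>\<^bsub>G\<^esub> = \<one>\<^bsub>H\<^esub>"
    using hom_one[OF hom G H] group.is_monoid[OF G] by (auto simp: monoid.one_closed)
  have "lower_central G i = {\<one>\<^bsub>G\<^esub>}"
  proof
    show "lower_central G i \<subseteq> {\<one>\<^bsub>G\<^esub>}"
    proof
      fix x assume x: "x \<in> lower_central G i"
      then have "f x = f \<one>\<^bsub>G\<^esub>" using img one(2) by (metis imageI singletonD)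
      then show "x \<in> {\<one>\<^bsub>G\<^esub>}" using inj_onD[OF inj, of x "\<one>\<^bsub>G\<^esub>"] x sub one(1) by blast
    qed
    have "lower_central G i \<noteq> {}" using img by auto
    with \<open>lower_central G i \<subseteq> {\<one>\<^bsub>G\<^esub>}\<close> show "{\<one>\<^bsub>G\<^esub>} \<subseteq> lower_central G i" by blast
  qed
  then show ?thesis unfolding nilpotent_group_def by blast
qed

text \<open>The same \<open>K\<close> serves in both cases. If it is not abelian, then it is not
  nilpotent by \<open>abelian_of_nilpotent\<close>, and this passes to its isomorphic image in
  \<open>GL N\<close>.\<close>

lemma (in torsion_free_length_group) linear_or_abelian:
  assumes fg: "fg_subgroup G (carrier G)"
  obtains K where "subgroup K G" "cofinite_in G (carrier G) K"
    "abelian_set G K \<or>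
            (\<exists>N L. subgroup L (GL N) \<and>
                   \<not> nilpotent_group ((GL N)\<lparr>carrier := L\<rparr>) \<and>
                   G\<lparr>carrier := K\<rparr> \<cong> (GL N)\<lparr>carrier := L\<rparr> \<and>
                   (\<exists>n (H :: nat monoid) rho. fg_ZZn_module n H rho \<and>
                      embeds_into ((GL N)\<lparr>carrier := L\<rparr>) (semidirect n H rho)))"
proof -
  obtain r P \<iota> where fc: "fitting_coordinates G l r P \<iota>" by (rule fitting_coordinates_exist)
  interpret fitting_coordinates G l r P \<iota> by (rule fc)
  obtain K n \<chi> where props: "metabelian_subgroup G l r P \<iota> K" "cofinite_in G (carrier G) K" "fg_subgroup G K"
    "\<chi> \<in> hom (G\<lparr>carrier := K\<rparr>) (Zn n)" "\<chi> ` K = carrier (Zn n)"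
    "\<And>x. x \<in> K \<Longrightarrow> \<chi> x = (\<lambda>_. 0) \<longleftrightarrow> x \<in> Fit"
    by (rule free_abelian_by_abelian[OF fg]) blast
  interpret metabelian_subgroup G l r P \<iota> K by (rule props(1))
  let ?K = "G\<lparr>carrier := K\<rparr>"
  show ?thesis
  proof (rule that[OF K_subgroup props(2)])
    show "abelian_set G K \<or>
            (\<exists>N L. subgroup L (GL N) \<and>
                   \<not> nilpotent_group ((GL N)\<lparr>carrier := L\<rparr>) \<and>
                   G\<lparr>carrier := K\<rparr> \<cong> (GL N)\<lparr>carrier := L\<rparr> \<and>
                   (\<exists>n (H :: nat monoid) rho. fg_ZZn_module n H rho \<and>
                      embeds_into ((GL N)\<lparr>carrier := L\<rparr>) (semidirect n H rho)))"
    proof (cases "abelian_set G K")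
      case False
      obtain N f where f: "f \<in> hom ?K (GL N)" "\<And>g. g \<in> K \<Longrightarrow> f g = 1\<^sub>m N \<Longrightarrow> g = \<one>"
        using embeddings(1)[OF props(3-6)] unfolding linearly_detected_def by auto
      obtain d H rho where H: "fg_ZZn_module d (H :: nat monoid) rho" "embeds_into ?K (semidirect d H rho)"
        using embeddings(2)[OF props(3-6)] by blast
      interpret f: group_hom ?K "GL N" f
        by (intro group_hom.intro group_hom_axioms.intro group_K group_GL f(1))
      define J where "J = f ` K"
      let ?J = "(GL N)\<lparr>carrier := J\<rparr>"
      have J: "subgroup J (GL N)" unfolding J_def using f.img_is_subgroup by simp
      have gJ: "group ?J" by (rule group.subgroup_imp_group[OF group_GL J])
      have "inj_on f (carrier ?K)" unfolding f.inj_on_one_iff using f(2) by simp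
      then have iso: "f \<in> iso ?K ?J"
        using f(1) by (auto simp: Group.iso_def bij_betw_def hom_def J_def)
      have "\<not> nilpotent_group ?J"
        using nilpotent_iso[OF group_K gJ iso] abelian_of_nilpotent[OF K_subgroup] False by blast
      moreover have "embeds_into ?J (semidirect d H rho)"
      proof -
        obtain h where h: "h \<in> hom ?K (semidirect d H rho)" "inj_on h (carrier ?K)"
          using H(2) unfolding embeds_into_def by blast
        define k where "k = inv_into (carrier ?K) f"
        have k: "k \<in> iso ?J ?K" unfolding k_def by (rule group.iso_set_sym[OF group_K iso])
        then have "h \<circ> k \<in> hom ?J (semidirect d H rho)"
          using h(1) by (auto simp: Group.iso_def hom_def Pi_iff)
        moreover have "inj_on (h \<circ> k) (carrier ?J)"
          using k h(2) by (intro comp_inj_on) (auto simp: Group.iso_def bij_betw_def)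
        ultimately show ?thesis unfolding embeds_into_def by blast
      qed
      ultimately show ?thesis using J is_isoI[OF iso] H(1) by blast
    qed simp
  qed
qed

theorem theorem2:
  fixes G :: "('a, 'b) monoid_scheme" and l :: "'a \<Rightarrow> real"
  assumes "group G"
    and "finitely_generated_group G"
    and "solvable G"
    and "purely_positive G l"
    and "virtually_torsion_free G"
    and "\<And>A. subgroup A G \<Longrightarrow> abelian_set G A \<Longrightarrow> finite_Q_rank G A"
  shows "\<exists>K. finite_index G K \<and>
           (abelian_set G K \<or>
            (\<exists>N L. subgroup L (GL N) \<and>
                   \<not> nilpotent_group ((GL N)\<lparr>carrier := L\<rparr>) \<and>
                   G\<lparr>carrier := K\<rparr> \<cong> (GL N)\<lparr>carrier := L\<rparr> \<and>
                   (\<exists>n (H :: nat monoid) rho. fg_ZZn_module n H rho \<and>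
                      embeds_into ((GL N)\<lparr>carrier := L\<rparr>) (semidirect n H rho))))"
proof -
  interpret group G by (rule assms(1))
  obtain R where R: "finite_index G R" "torsion_free_set G R"
    using assms(5) unfolding virtually_torsion_free_def by blast
  have RG: "subgroup R G" using R(1) by (simp add: finite_index_def)
  interpret R: subgroup R G by (rule RG)
  let ?R = "G\<lparr>carrier := R\<rparr>"
  have gR: "group ?R" by (rule subgroup_imp_group[OF RG])
  have coR: "cofinite_in G (carrier G) R" using R(1) finite_index_iff_cofinite[OF RG] by simp
  have "fg_subgroup G (carrier G)"
    using assms(2) unfolding finitely_generated_group_def fg_subgroup_def by blast
  then have fgR: "fg_subgroup G R"
    by (rule fg_subgroup_cofinite[OF RG subgroup_self R.subset _ coR])
  have pow: "x [^]\<^bsub>?R\<^esub> (k::int) = x [^]\<^bsub>G\<^esub> k" if "x \<in> R" for x k using int_pow_consistent[OF RG that] by simp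
  have len: "length_function G l" and pos: "\<And>g. g \<in> carrier G \<Longrightarrow> infinite_order G g \<Longrightarrow> l g > 0"
    using assms(4) unfolding purely_positive_def by auto
  \<comment> \<open>Torsion-freeness of \<open>R\<close> turns positivity on elements of infinite
    order into positivity away from 1. The other hypotheses are inherited, but derived series,
    powers and independence have to be compared between the two group records.\<close>
  have "torsion_free_length_group ?R l"
  proof (intro torsion_free_length_group.intro torsion_free_length_group_axioms.intro gR)
    show "length_function ?R l"
      using len unfolding length_function_def by (auto simp: pow m_inv_consistent[OF RG])
    show "l g > 0" if "g \<in> carrier ?R" "g \<noteq> \<one>\<^bsub>?R\<^esub>" for g
      using that R(2) pos[of g] unfolding torsion_free_set_def by auto
    have "solvable_seq G R" by (rule solvable_subgroup[OF RG assms(3)])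
    then obtain n where n: "(derived G ^^ n) R = {\<one>\<^bsub>G\<^esub>}" using solvable_imp_trivial_derived_seq by blast
    have "(derived ?R ^^ i) R = (derived G ^^ i) R \<and> (derived G ^^ i) R \<subseteq> R" for i
    proof (induction i)
      case (Suc i)
      then show ?case
        using derived_consistent[OF _ RG, of "(derived G ^^ i) R"] derived_incl[of "(derived G ^^ i) R" R] RG by auto
    qed simp
    then show "\<exists>n. (derived ?R ^^ n) (carrier ?R) = {\<one>\<^bsub>?R\<^esub>}" using n by (intro exI[of _ n]) simp
    fix A assume A: "subgroup A ?R" "abelian_set ?R A"
    have AR: "A \<subseteq> R" using subgroup.subset[OF A(1)] by simp
    have AG: "subgroup A G" using incl_subgroup[OF RG A(1)] .
    have "abelian_set G A" using A(2) by (simp add: abelian_set_def)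
    then have fin: "finite_Q_rank G A" using assms(6)[OF AG] by blast
    have fold: "foldr (\<lambda>(x, e) acc. (x [^]\<^bsub>?R\<^esub> (e::int)) \<otimes>\<^bsub>?R\<^esub> acc) (zip xs es) \<one>\<^bsub>?R\<^esub>
        = foldr (\<lambda>(x, e) acc. (x [^]\<^bsub>G\<^esub> e) \<otimes>\<^bsub>G\<^esub> acc) (zip xs es) \<one>\<^bsub>G\<^esub>" if "set xs \<subseteq> R" for xs es
      using that
    proof (induction xs arbitrary: es)
      case (Cons x xs)
      then show ?case by (cases es) (auto simp: pow)
    qed simp
    have "Z_independent ?R xs \<longleftrightarrow> Z_independent G xs" if "set xs \<subseteq> A" for xs
      unfolding Z_independent_def using fold[of xs] that AR by simp
    then show "finite_Q_rank ?R A" using fin unfolding finite_Q_rank_def by blast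
  qed
  then interpret tf: torsion_free_length_group ?R l .
  obtain S where S: "finite S" "S \<subseteq> R" "generate G S = R" using fgR unfolding fg_subgroup_def by blast
  have "generate ?R S = R" using generate_consistent[OF S(2) RG] S(3) by simp
  then have "fg_subgroup ?R (carrier ?R)"
    unfolding fg_subgroup_def using S(1,2) by (intro exI[of _ S]) simp
  then obtain K where K: "subgroup K ?R" "cofinite_in ?R (carrier ?R) K"
    "abelian_set ?R K \<or>
            (\<exists>N L. subgroup L (GL N) \<and>
                   \<not> nilpotent_group ((GL N)\<lparr>carrier := L\<rparr>) \<and>
                   ?R\<lparr>carrier := K\<rparr> \<cong> (GL N)\<lparr>carrier := L\<rparr> \<and>
                   (\<exists>n (H :: nat monoid) rho. fg_ZZn_module n H rho \<and>
                      embeds_into ((GL N)\<lparr>carrier := L\<rparr>) (semidirect n H rho)))"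
    by (rule tf.linear_or_abelian)
  have KG: "subgroup K G" by (rule incl_subgroup[OF RG K(1)])
  have KR: "K \<subseteq> R" using subgroup.subset[OF K(1)] by simp
  have "cofinite_in G R K" using K(2) by (simp add: cofinite_in_def)
  then have "cofinite_in G (carrier G) K"
    by (rule cofinite_in_trans[OF order_refl R.subset KR subgroup_self coR])
  then have "finite_index G K" using finite_index_iff_cofinite[OF KG] by simp
  moreover have "abelian_set ?R K \<longleftrightarrow> abelian_set G K" by (simp add: abelian_set_def)
  moreover have "?R\<lparr>carrier := K\<rparr> = G\<lparr>carrier := K\<rparr>" by simp
  ultimately show ?thesis using K(3) by metis
qed

end
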